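(* Let $n\geq 1$. Every element of $\ker(\pi_n\Lambda_n\to\pi_n\Lambda_{n+1})$, the kernel of the stabilization map, admits a representative of the form $\alpha(\Sigma,v)$ for some formal fold $(\Sigma,v)$ in $\mathbf{R}^n$.
   Context: $\Lambda_n$ is the Grassmannian of linear Lagrangian subspaces of $\mathbf{C}^n$. The stabilization map is induced by $\Lambda_n\hookrightarrow\Lambda_{n+1}$, $P\mapsto P\oplus\mathbf{R}\subset\mathbf{C}^n\oplus\mathbf{C}$. The basepoint of $\Lambda_n$ is $i\mathbf{R}^n$. A formal fold in a smooth manifold $L$ is a pair $(\Sigma,v)$ with $\Sigma\subset L$ a co-orientable smooth closed hypersurface (possibly empty or disconnected) and $v$ a choice of co-orientation of $\Sigma$. For $L=\mathbf{R}^n$, $\Sigma$ is assumed compact. The Lagrangian distribution $\gamma(\Sigma,v)\subset T(T^*L)|_L$ (well-defined up to homotopy) is defined as follows. Let $\Sigma\times[-1,1]\subset L$ be a tubular neighborhood of $\Sigma$ whose coordinate $t\in[-1,1]$ satisfies $v=\partial/\partial t$. Outside $\Sigma\times[-1,1]$, $\gamma(\Sigma,v)$ is the vertical distribution $\nu=\ker(d\pi)$, $\pi:T^*L\to L$. On $\Sigma\times[-1,1]$ it is the direct sum of the vertical distribution in $T(T^*\Sigma)|_\Sigma$ and the line field $\ell_t=\mathrm{span}\langle\sin(\tfrac{\pi t}{2})\tfrac{\partial}{\partial u}+\cos(\tfrac{\pi t}{2})\tfrac{\partial}{\partial t}\rangle\subset T_t(T^*[-1,1])$, where $u$ is the momentum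 coordinate dual to $t$. For a formal fold in $\mathbf{R}^n$, $\gamma(\Sigma,v)$ is vertical outside a compact set. Using $T(T^*\mathbf{R}^n)|_{\mathbf{R}^n}\simeq\mathbf{R}^n\times\mathbf{C}^n$ (with the vertical distribution corresponding to $i\mathbf{R}^n$ and the tangent space of $\mathbf{R}^n$ to $\mathbf{R}^n$), and viewing $S^n$ as the one-point compactification of $\mathbf{R}^n$ with basepoint at infinity, $\gamma(\Sigma,v)$ determines an element $\alpha(\Sigma,v)\in\pi_n\Lambda_n$. *)

theory Defs
  imports "HOL-Analysis.Analysis"
begin

section \<open>The Lagrangian Grassmannian of \<open>\<complex>\<^sup>n\<close>\<close>

text \<open>\<open>\<complex>\<^sup>n\<close> is \<^typ>\<open>complex^'n\<close> with \<open>n = CARD('n)\<close>. The constants \<^const>\<open>subspace\<close>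
  and \<^const>\<open>dim\<close> below refer to its structure as a real vector space.\<close>

definition symp :: "complex^'n \<Rightarrow> complex^'n \<Rightarrow> real" where
  "symp z w = (\<Sum>j\<in>UNIV. Im (cnj (z $ j) * w $ j))"

definition lagrangian :: "(complex^'n) set \<Rightarrow> bool" where
  "lagrangian P \<longleftrightarrow> subspace P \<and> dim P = CARD('n) \<and> (\<forall>z\<in>P. \<forall>w\<in>P. symp z w = 0)"

text \<open>For a linear subspace \<open>P\<close>, \<^term>\<open>closest_point P\<close> is the orthogonal projection onto \<open>P\<close>.
  The Grassmannian carries the topology induced from the identification of a subspace with its
  orthogonal projection. The topology on the function space is that of pointwise convergence, which
  on linear maps of a finite-dimensional space is the operator norm topology.\<close>

definition Lag :: "(complex^'n) set topology" where
  "Lag = pullback_topology {P. lagrangian P} closest_point euclidean"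

definition cvec :: "real^'n \<Rightarrow> real^'n \<Rightarrow> complex^'n" where
  "cvec a b = (\<chi> j. Complex (a $ j) (b $ j))"

definition iR :: "(complex^'n) set" where
  "iR = range (\<lambda>b. cvec 0 b)"

text \<open>The index type \<^typ>\<open>'n option\<close> has one element more than \<^typ>\<open>'n\<close>; the coordinate
  \<^const>\<open>None\<close> is the additional summand in \<open>\<complex>\<^sup>n \<oplus> \<complex>\<close>.\<close>

definition stab :: "(complex^'n) set \<Rightarrow> (complex^('n option)) set" where
  "stab P = {z. (\<chi> j. z $ Some j) \<in> P \<and> z $ None \<in> \<real>}"

section \<open>Homotopy groups\<close>

text \<open>The sphere \<open>S\<^sup>n\<close> is the one-point compactification of \<open>\<real>\<^sup>n\<close>, and its basepoint \<^const>\<open>None\<close>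
  is the point at infinity.\<close>

definition sphere_top :: "(real^'n) option topology" where
  "sphere_top = Alexandroff_compactification euclidean"

definition sphere_maps :: "'b topology \<Rightarrow> 'b \<Rightarrow> ((real^'n) option \<Rightarrow> 'b) set" where
  "sphere_maps X b = {f. continuous_map sphere_top X f \<and> f None = b}"

definition htpy_class ::
    "'b topology \<Rightarrow> 'b \<Rightarrow> ((real^'n) option \<Rightarrow> 'b) \<Rightarrow> ((real^'n) option \<Rightarrow> 'b) set" where
  "htpy_class X b f = {g. homotopic_with (\<lambda>h. h None = b) sphere_top X f g}"

text \<open>The underlying set of \<open>\<pi>\<^sub>n(X, b)\<close>. Its neutral element is the class of the constant map;
  a kernel depends on the group structure only through this element.\<close>

definition pi_n :: "'b topology \<Rightarrow> 'b \<Rightarrow> ((real^'n) option \<Rightarrow> 'b) set set" where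
  "pi_n X b = htpy_class X b ` sphere_maps X b"

definition pi_one :: "'b topology \<Rightarrow> 'b \<Rightarrow> ((real^'n) option \<Rightarrow> 'b) set" where
  "pi_one X b = htpy_class X b (\<lambda>_. b)"

definition pi_induced :: "'c topology \<Rightarrow> 'c \<Rightarrow> ('b \<Rightarrow> 'c) \<Rightarrow>
    ((real^'n) option \<Rightarrow> 'b) set \<Rightarrow> ((real^'n) option \<Rightarrow> 'c) set" where
  "pi_induced Y b' h c = (\<Union>f\<in>c. htpy_class Y b' (h \<circ> f))"

text \<open>The stabilization map sends the basepoint \<open>i\<real>\<^sup>n\<close> to \<open>i\<real>\<^sup>n \<oplus> \<real>\<close>, which is therefore used as
  the basepoint of \<open>\<Lambda>\<^sub>n\<^sub>+\<^sub>1\<close>. Transporting it to \<open>i\<real>\<^sup>n\<^sup>+\<^sup>1\<close> along any path is an isomorphism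
  of homotopy groups, so it does not affect the kernel.\<close>

definition stab_kernel :: "((real^'n) option \<Rightarrow> (complex^'n) set) set set" where
  "stab_kernel = {c \<in> pi_n Lag iR. pi_induced Lag (stab iR) stab c = pi_one Lag (stab iR)}"

section \<open>Formal folds in \<open>\<real>\<^sup>n\<close>\<close>

text \<open>The following two notions are meant for open \<open>S\<close> in a finite-dimensional space:
  \<open>f\<close> is of class \<open>C\<^sup>k\<close>, respectively \<open>C\<^sup>\<infinity>\<close>, on \<open>S\<close>.\<close>

primrec Ck_on :: "nat \<Rightarrow> 'a set \<Rightarrow> ('a::real_normed_vector \<Rightarrow> 'b::real_normed_vector) \<Rightarrow> bool" where
  "Ck_on 0 S f \<longleftrightarrow> continuous_on S f"
| "Ck_on (Suc k) S f \<longleftrightarrow> (\<forall>x\<in>S. f differentiable (at x)) \<and>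
     (\<forall>v. Ck_on k S (\<lambda>x. frechet_derivative f (at x) v))"

definition smooth_on :: "'a set \<Rightarrow> ('a::real_normed_vector \<Rightarrow> 'b::real_normed_vector) \<Rightarrow> bool" where
  "smooth_on S f \<longleftrightarrow> (\<forall>k. Ck_on k S f)"

definition diffeo_on :: "'a set \<Rightarrow> 'b set \<Rightarrow>
    ('a::real_normed_vector \<Rightarrow> 'b::real_normed_vector) \<Rightarrow> ('b \<Rightarrow> 'a) \<Rightarrow> bool" where
  "diffeo_on U V f g \<longleftrightarrow> open U \<and> open V \<and> homeomorphism U V f g \<and> smooth_on U f \<and> smooth_on V g"

text \<open>Embedded smooth hypersurfaces without boundary, by means of slice charts.\<close>

definition hypersurface :: "(real^'n) set \<Rightarrow> bool" where
  "hypersurface \<Sigma> \<longleftrightarrow> (\<forall>p\<in>\<Sigma>. \<exists>U V f g k. p \<in> U \<and> diffeo_on U V f g \<and>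
     f ` (U \<inter> \<Sigma>) = V \<inter> {y :: real^'n. y $ k = 0})"

text \<open>Velocities at \<open>p\<close> of curves in \<open>\<Sigma>\<close>; for a hypersurface this is its tangent space.\<close>

definition tangent :: "(real^'n) set \<Rightarrow> real^'n \<Rightarrow> (real^'n) set" where
  "tangent \<Sigma> p = {w. \<exists>c e. e > 0 \<and> c 0 = p \<and> (\<forall>s. \<bar>s\<bar> < e \<longrightarrow> c s \<in> \<Sigma>) \<and>
     (c has_vector_derivative w) (at (0::real))}"

text \<open>A co-orientation, that is, an orientation of the normal line bundle of \<open>\<Sigma>\<close>, is given by the
  unique unit normal field representing it.\<close>

definition coorientation :: "(real^'n) set \<Rightarrow> (real^'n \<Rightarrow> real^'n) \<Rightarrow> bool" where
  "coorientation \<Sigma> v \<longleftrightarrow> continuous_on \<Sigma> v \<and>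
     (\<forall>x\<in>\<Sigma>. norm (v x) = 1 \<and> (\<forall>w\<in>tangent \<Sigma> x. v x \<bullet> w = 0))"

definition formal_fold :: "(real^'n) set \<Rightarrow> (real^'n \<Rightarrow> real^'n) \<Rightarrow> bool" where
  "formal_fold \<Sigma> v \<longleftrightarrow> compact \<Sigma> \<and> hypersurface \<Sigma> \<and> coorientation \<Sigma> v"

section \<open>The Lagrangian distribution of a formal fold\<close>

text \<open>Tubular neighbourhoods are smooth embeddings \<open>\<Phi>\<close> of \<open>\<Sigma> \<times> [-1,1]\<close>; smoothness means that \<open>\<Phi>\<close>
  is smooth on a neighbourhood of \<open>\<Sigma> \<times> [-1,1]\<close> in \<open>\<real>\<^sup>n \<times> \<real>\<close>. As \<open>\<Sigma>\<close> is compact, an injective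
  immersion is an embedding. The last condition says that \<open>\<partial>/\<partial>t\<close> along \<open>\<Sigma>\<close> represents the
  co-orientation \<open>v\<close>.\<close>

definition tubular :: "(real^'n) set \<Rightarrow> (real^'n \<Rightarrow> real^'n) \<Rightarrow> ((real^'n) \<times> real \<Rightarrow> real^'n) \<Rightarrow> bool" where
  "tubular \<Sigma> v \<Phi> \<longleftrightarrow>
     (\<exists>W. open W \<and> \<Sigma> \<times> {-1..1} \<subseteq> W \<and> smooth_on W \<Phi>) \<and>
     inj_on \<Phi> (\<Sigma> \<times> {-1..1}) \<and>
     (\<forall>x\<in>\<Sigma>. \<forall>t\<in>{-1..1}. inj_on (frechet_derivative \<Phi> (at (x, t))) (tangent \<Sigma> x \<times> UNIV)) \<and>
     (\<forall>x\<in>\<Sigma>. \<Phi> (x, 0) = x) \<and>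
     (\<forall>x\<in>\<Sigma>. frechet_derivative \<Phi> (at (x, 0)) (0, 1) \<bullet> v x > 0)"

text \<open>The identification of \<open>T(T\<^sup>*\<real>\<^sup>n)|\<^sub>\<real>\<^sub>n\<close> with \<open>\<real>\<^sup>n \<times> \<complex>\<^sup>n\<close> sends a pair of a tangent vector \<open>a\<close> and a
  covector, represented through the inner product by a vector \<open>b\<close>, to \<^term>\<open>cvec a b\<close>.

  At \<open>q = \<Phi>(x, t)\<close> let \<open>w = \<partial>/\<partial>t\<close> and let \<open>H\<close> be the tangent space of the leaf \<open>\<Phi>(\<Sigma> \<times> {t})\<close>. In the
  splitting \<open>H \<oplus> \<real>w\<close> of the tangent space at \<open>q\<close>, the vertical distribution of \<open>T(T\<^sup>*\<Sigma>)|\<^sub>\<Sigma>\<close>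
  consists of the covectors \<open>\<xi>\<close> vanishing on \<open>w\<close>, and the fibre direction \<open>\<partial>/\<partial>u\<close> is the covector
  \<open>\<eta> = dt\<close>, which is determined by \<open>\<eta>(w) = 1\<close> and \<open>\<eta>|\<^sub>H = 0\<close>.\<close>

definition tube_plane ::
    "(real^'n) set \<Rightarrow> ((real^'n) \<times> real \<Rightarrow> real^'n) \<Rightarrow> (real^'n) \<times> real \<Rightarrow> (complex^'n) set" where
  "tube_plane \<Sigma> \<Phi> = (\<lambda>(x, t).
     let D = frechet_derivative \<Phi> (at (x, t)); w = D (0, 1) in
     {cvec 0 \<xi> + s *\<^sub>R (sin (pi * t / 2) *\<^sub>R cvec 0 \<eta> + cos (pi * t / 2) *\<^sub>R cvec w 0) | \<xi> \<eta> s.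
        \<xi> \<bullet> w = 0 \<and> \<eta> \<bullet> w = 1 \<and> (\<forall>h\<in>tangent \<Sigma> x. \<eta> \<bullet> D (h, 0) = 0)})"

definition fold_map ::
    "(real^'n) set \<Rightarrow> ((real^'n) \<times> real \<Rightarrow> real^'n) \<Rightarrow> (real^'n) option \<Rightarrow> (complex^'n) set" where
  "fold_map \<Sigma> \<Phi> p = (case p of None \<Rightarrow> iR
     | Some q \<Rightarrow> if q \<in> \<Phi> ` (\<Sigma> \<times> {-1..1})
               then tube_plane \<Sigma> \<Phi> (inv_into (\<Sigma> \<times> {-1..1}) \<Phi> q) else iR)"

text \<open>The maps \<^term>\<open>fold_map \<Sigma> \<Phi>\<close> for the various tubular neighbourhoods \<open>\<Phi>\<close> of \<open>(\<Sigma>, v)\<close> are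
  homotopic, so for a formal fold the union is their common homotopy class.\<close>

definition alpha :: "(real^'n) set \<Rightarrow> (real^'n \<Rightarrow> real^'n) \<Rightarrow> ((real^'n) option \<Rightarrow> (complex^'n) set) set" where
  "alpha \<Sigma> v = (\<Union>\<Phi>\<in>{\<Phi>. tubular \<Sigma> v \<Phi>}. htpy_class Lag iR (fold_map \<Sigma> \<Phi>))"

end

theory Submission
  imports Defs
begin

text \<open>Let \<open>f\<close> represent an element of the kernel. A null homotopy of \<open>f \<oplus> \<real>\<close> carries the unit vector \<open>e\<^sub>0\<close> of
  the extra summand along, by repeated orthogonal projection to the moving Lagrangians, and turns it
  into a map \<open>s\<close> to the unit sphere of \<open>i\<real>\<^sup>n \<oplus> \<real>\<close>. Over this sphere, explicit unitary rotations move the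
  pair \<open>(i\<real>\<^sup>n \<oplus> \<real>, s)\<close> to a pair \<open>(\<lambda>(s) \<oplus> \<real>, e\<^sub>0)\<close>, where \<open>\<lambda>\<close> turns \<open>i\<real>\<^sup>n\<close> by a full half turn along the
  radial lines of a disc, the basic ``kink''. The path of vectors \<open>e\<^sub>0\<close> obtained along the way is a map
  of an \<open>(n+1)\<close>-dimensional space to \<open>S\<^sup>2\<^sup>n\<^sup>+\<^sup>1\<close>, so it misses a point after a perturbation and can be
  made constant; hence \<open>f\<close> is homotopic to \<open>\<lambda> \<circ> s\<close>.

  Near a regular value, \<open>\<lambda> \<circ> s\<close> becomes a finite sum of linear kinks. Linear isomorphisms deform to the
  identity or to a reflection. The kink of the identity is the fold along a sphere; the kink of a
  reflection is turned by a loop of unitary maps into folds along three spheres. (An inward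
  co-oriented sphere alone would not do when \<open>n\<close> is even.) The resulting family of disjoint round spheres
  is \<open>\<Sigma>\<close>. That the choice of the tubular neighbourhood is irrelevant is seen by a convex interpolation
  in a thin tube.\<close>

text \<open>Behind the argument stand two fibrations of the space of pairs (P, v), where P is a
  Lagrangian of C^(n+1) and v a unit vector in P. Over P the fibre is an n-sphere; over v in
  S^(2n+1) it is the Grassmannian of C^n. As n >= 1 gives n + 1 < 2n + 1, the second base has no
  homotopy up to degree n + 1, so every kernel element comes from the sphere fibre. Neither
  fibration is constructed: repeated projection replaces lifting in the one, and the rotations
  \<open>rot\<close> trivialize the other away from a point. This is why homotopies carry a vector
  along with the plane (\<open>ehom\<close>).

  The sign is a separate obstacle. The turn \<open>phase u\<close> depends on u only up to sign, so
  \<open>kink\<close> is even. Negating all angles makes the deformation start from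
  \<open>swell\<close> composed with y -> -y, a map of degree (-1)^n. For even n an inward sphere
  therefore has the class of an outward one, and the inverse class has to be produced by a
  reflection, at the price of two more spheres.\<close>

definition herm :: "complex^'n \<Rightarrow> complex^'n \<Rightarrow> complex" where
  "herm z w = (\<Sum>j\<in>UNIV. cnj (z $ j) * w $ j)"

lemma herm_add_left: "herm (a + b) c = herm a c + herm b c"
  and herm_add_right: "herm a (b + c) = herm a b + herm a c"
  and herm_diff_left: "herm (a - b) c = herm a c - herm b c"
  and herm_diff_right: "herm a (b - c) = herm a b - herm a c"
  and herm_minus_left: "herm (- a) b = - herm a b"
  and herm_minus_right: "herm a (- b) = - herm a b"
  and herm_cmult_left: "herm (k *s a) b = cnj k * herm a b"
  and herm_cmult_right: "herm a (k *s b) = k * herm a b"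
  by (simp_all add: herm_def ring_distribs sum.distrib sum_subtractf sum_negf sum_distrib_left
      mult.assoc mult.left_commute)

lemmas herm_simps = herm_add_left herm_add_right herm_diff_left herm_diff_right herm_minus_left
  herm_minus_right herm_cmult_left herm_cmult_right

lemma herm_zero [simp]: "herm 0 a = 0" "herm a 0 = 0"
  by (simp_all add: herm_def)

lemma scaleR_eq_cmult: "r *\<^sub>R (z::complex^'n) = complex_of_real r *s z"
  by (simp add: vec_eq_iff) (simp add: scaleR_conv_of_real)

lemma herm_cnj: "cnj (herm a b) = herm b a"
  by (simp add: herm_def mult.commute)

lemma Re_herm: "Re (herm a b) = a \<bullet> b"
  by (simp add: herm_def inner_vec_def inner_complex_def)

lemma Im_herm: "Im (herm a b) = symp a b"
  by (simp add: herm_def symp_def)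

lemma herm_self: "herm a a = of_real ((norm a)\<^sup>2)"
  by (rule complex_eqI)
     (simp_all add: Re_herm dot_square_norm, simp add: herm_def)

lemma herm_norm1: "norm a = 1 \<Longrightarrow> herm a a = 1"
  by (simp add: herm_self)

lemma herm_axis: "herm (axis j 1) z = z $ j"
proof -
  have "(\<Sum>i\<in>UNIV. cnj (axis j 1 $ i) * z $ i) = (\<Sum>i\<in>UNIV. if i = j then z $ i else 0)"
    by (rule sum.cong) (auto simp: axis_def)
  then show ?thesis by (simp add: herm_def)
qed

lemma cmult_sum_axis: "(z::complex^'n) = (\<Sum>j\<in>UNIV. z $ j *s axis j 1)"
  by (simp add: vec_eq_iff axis_def if_distrib cong: if_cong)

section \<open>Unitary maps, Lagrangians and orthogonal projections\<close>

definition uni :: "(complex^'n \<Rightarrow> complex^'n) \<Rightarrow> bool" where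
  "uni U \<longleftrightarrow> (\<forall>z w. U (z + w) = U z + U w) \<and> (\<forall>c z. U (c *s z) = c *s U z) \<and>
     (\<forall>z w. herm (U z) (U w) = herm z w)"

lemma uniD:
  assumes "uni U"
  shows uni_add: "U (z + w) = U z + U w" and uni_cmult: "U (c *s z) = c *s U z"
    and uni_herm: "herm (U z) (U w) = herm z w"
  using assms by (auto simp: uni_def)

lemma uni_linear: "uni U \<Longrightarrow> linear U"
  by (rule linearI) (auto simp: uniD scaleR_eq_cmult)

lemma uni_inner: "uni U \<Longrightarrow> U z \<bullet> U w = z \<bullet> w"
  by (simp add: uniD flip: Re_herm)

lemma uni_norm: "uni U \<Longrightarrow> norm (U z) = norm z"
  by (simp add: uni_inner norm_eq_sqrt_inner)

lemma uni_inj: "uni U \<Longrightarrow> inj U"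
  using uni_linear uni_norm by (metis linear_injective_0 norm_eq_zero)

lemma uni_surj: "uni U \<Longrightarrow> surj U"
  using linear_injective_imp_surjective uni_inj uni_linear by blast

lemma uni_bij: "uni U \<Longrightarrow> bij U"
  using uni_inj[of U] uni_surj[of U] by (auto simp: bij_def)

lemma uni_inv: assumes U: "uni U" shows "uni (inv U)"
  unfolding uni_def
proof (intro conjI allI)
  note s = surj_f_inv_f[OF uni_surj[OF U]] and i = inv_f_eq[OF uni_inj[OF U]]
  show "inv U (z + w) = inv U z + inv U w" for z w by (rule i) (simp add: uniD[OF U] s)
  show "inv U (c *s z) = c *s inv U z" for c z by (rule i) (simp add: uniD[OF U] s)
  show "herm (inv U z) (inv U w) = herm z w" for z w
    using uni_herm[OF U, of "inv U z" "inv U w"] by (simp add: s)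
qed

lemma uni_comp: "uni U \<Longrightarrow> uni V \<Longrightarrow> uni (\<lambda>z. U (V z))"
  by (simp add: uni_def)

text \<open>The symplectic form is the imaginary part of \<open>herm\<close>, hence invariant under
  unitary maps.\<close>

lemma lagrangian_image:
  assumes U: "uni U" and P: "lagrangian P"
  shows "lagrangian (U ` P)"
proof -
  have "subspace (U ` P)" using P U uni_linear linear_subspace_image by (auto simp: lagrangian_def)
  moreover have "dim (U ` P) = dim P"
    using U uni_linear uni_inj by (metis dim_image_eq inj_on_subset top_greatest)
  moreover have "symp (U z) (U w) = symp z w" for z w
    by (simp add: uniD[OF U] flip: Im_herm)
  ultimately show ?thesis using P by (auto simp: lagrangian_def)
qed

text \<open>Pythagoras: a residual orthogonal to P makes p the nearest point of P. All later
  formulas for projections are verified through this criterion.\<close>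

lemma closest_point_subspace_eq:
  fixes P :: "'a::euclidean_space set"
  assumes "subspace P" "p \<in> P" "\<And>w. w \<in> P \<Longrightarrow> (z - p) \<bullet> w = 0"
  shows "closest_point P z = p"
proof (rule closest_point_unique[symmetric])
  show "convex P" "closed P" using assms(1) by (auto simp: subspace_imp_convex closed_subspace)
  show "\<forall>w\<in>P. dist z p \<le> dist z w"
  proof
    fix w assume "w \<in> P"
    then have "p - w \<in> P" using assms by (simp add: subspace_diff)
    then have "(z - p) \<bullet> (p - w) = 0" by (rule assms)
    then have "norm ((z - p) + (p - w))^2 = norm (z - p)^2 + norm (p - w)^2"
      by (intro norm_add_Pythagorean) (simp add: orthogonal_def)
    then have "norm (z - p)^2 \<le> norm (z - w)^2" by simp
    then show "dist z p \<le> dist z w" by (simp add: dist_norm)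
  qed
qed fact

lemma closest_point_subspace:
  fixes P :: "'a::euclidean_space set"
  assumes "subspace P"
  shows closest_point_mem: "closest_point P z \<in> P"
    and closest_point_perp: "w \<in> P \<Longrightarrow> (z - closest_point P z) \<bullet> w = 0"
proof -
  obtain p q where pq: "p \<in> span P" "\<And>w. w \<in> span P \<Longrightarrow> orthogonal q w" "z = p + q"
    using orthogonal_subspace_decomp_exists[of P z] by metis
  have sp: "span P = P" using assms by (simp add: span_eq_iff)
  have "closest_point P z = p"
    using pq assms by (intro closest_point_subspace_eq) (auto simp: sp orthogonal_def)
  then show "closest_point P z \<in> P" "w \<in> P \<Longrightarrow> (z - closest_point P z) \<bullet> w = 0"
    using pq by (auto simp: sp orthogonal_def)
qed

lemma closest_point_linear:
  fixes P :: "'a::euclidean_space set"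
  assumes "subspace P" shows "linear (closest_point P)"
proof (rule linearI)
  note cp = closest_point_subspace[OF assms]
  show "closest_point P (x + y) = closest_point P x + closest_point P y" for x y
  proof (rule closest_point_subspace_eq[OF assms])
    fix w assume "w \<in> P"
    then have "(x - closest_point P x) \<bullet> w = 0" "(y - closest_point P y) \<bullet> w = 0" by (auto simp: cp)
    then show "(x + y - (closest_point P x + closest_point P y)) \<bullet> w = 0"
      by (simp add: inner_diff_left inner_add_left)
  qed (use assms cp in \<open>auto simp: subspace_add\<close>)
  show "closest_point P (r *\<^sub>R x) = r *\<^sub>R closest_point P x" for r x
  proof (rule closest_point_subspace_eq[OF assms])
    fix w assume "w \<in> P"
    then have "(x - closest_point P x) \<bullet> w = 0" by (auto simp: cp)
    then show "(r *\<^sub>R x - r *\<^sub>R closest_point P x) \<bullet> w = 0"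
      by (simp add: inner_diff_left inner_add_left)
  qed (use assms cp in \<open>auto simp: subspace_mul\<close>)
qed

lemma lagrangian_subspace: "lagrangian P \<Longrightarrow> subspace P"
  by (simp add: lagrangian_def)

lemma closest_point_uni:
  assumes U: "uni U" and P: "subspace P"
  shows "closest_point (U ` P) (U z) = U (closest_point P z)"
proof (rule closest_point_subspace_eq)
  show "subspace (U ` P)" using P U uni_linear linear_subspace_image by blast
  show "U (closest_point P z) \<in> U ` P" using closest_point_mem[OF P] by blast
  fix w assume "w \<in> U ` P"
  then obtain v where v: "v \<in> P" "w = U v" by blast
  show "(U z - U (closest_point P z)) \<bullet> w = 0"
    using closest_point_perp[OF P v(1), of z] uni_inner[OF U, of "z - closest_point P z" v]
    by (simp add: v linear_diff[OF uni_linear[OF U]])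
qed

section \<open>Continuous families of Lagrangians and of unitary maps\<close>

definition lagc :: "'a::topological_space set \<Rightarrow> ('a \<Rightarrow> (complex^'n) set) \<Rightarrow> bool" where
  "lagc S P \<longleftrightarrow> (\<forall>q\<in>S. lagrangian (P q)) \<and> (\<forall>z. continuous_on S (\<lambda>q. closest_point (P q) z))"

text \<open>The function space carries the product topology, so continuity of the projections may be
  tested at one vector z at a time.\<close>

lemma continuous_map_Lag:
  "continuous_map X Lag P \<longleftrightarrow> (\<forall>q\<in>topspace X. lagrangian (P q)) \<and>
     (\<forall>z. continuous_map X euclidean (\<lambda>q. closest_point (P q) z))"
proof
  assume *: "continuous_map X Lag P"
  have "continuous_map Lag euclidean closest_point"
    unfolding Lag_def using continuous_map_pullback[of euclidean euclidean id "{P. lagrangian P}" closest_point] 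
    by simp
  with * have "continuous_map X euclidean (closest_point \<circ> P)" by (rule continuous_map_compose)
  then have "\<forall>z. continuous_map X euclidean (\<lambda>q. closest_point (P q) z)"
    by (simp add: continuous_map_componentwise_UNIV o_def flip: euclidean_product_topology)
  moreover have "\<forall>q\<in>topspace X. lagrangian (P q)"
    using continuous_map_image_subset_topspace[OF *] by (auto simp: Lag_def topspace_pullback_topology)
  ultimately show "(\<forall>q\<in>topspace X. lagrangian (P q)) \<and>
     (\<forall>z. continuous_map X euclidean (\<lambda>q. closest_point (P q) z))" by blast
next
  assume *: "(\<forall>q\<in>topspace X. lagrangian (P q)) \<and>
     (\<forall>z. continuous_map X euclidean (\<lambda>q. closest_point (P q) z))"
  then have "continuous_map X euclidean (closest_point \<circ> P)"
    by (simp add: continuous_map_componentwise_UNIV o_def flip: euclidean_product_topology)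
  then show "continuous_map X Lag P"
    unfolding Lag_def using * by (intro continuous_map_pullback') auto
qed

lemma lagc_iff: "lagc S P \<longleftrightarrow> continuous_map (top_of_set S) Lag P"
  by (simp add: lagc_def continuous_map_Lag)

text \<open>A projection is linear, so its value at a moving vector is a combination of its values
  on a finite basis with continuous coefficients. Here continuity for fixed vectors becomes joint
  continuity.\<close>

lemma lagc_closest_point:
  fixes P :: "'a::topological_space \<Rightarrow> (complex^'n) set"
  assumes P: "lagc S P" and v: "continuous_on S v"
  shows "continuous_on S (\<lambda>q. closest_point (P q) (v q))"
proof -
  have "closest_point (P q) (v q) = (\<Sum>b\<in>Basis. (v q \<bullet> b) *\<^sub>R closest_point (P q) b)" if "q \<in> S" for q
  proof -
    have "linear (closest_point (P q))"
      using P that by (auto simp: lagc_def lagrangian_def intro: closest_point_linear)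
    then show ?thesis
      by (subst euclidean_representation[symmetric, of "v q"]) (simp add: linear_sum linear_scale)
  qed
  moreover have "continuous_on S (\<lambda>q. \<Sum>b\<in>Basis. (v q \<bullet> b) *\<^sub>R closest_point (P q) b)"
    using P v by (intro continuous_intros) (auto simp: lagc_def)
  ultimately show ?thesis by (simp cong: continuous_on_cong)
qed

definition unic :: "'a::topological_space set \<Rightarrow> ('a \<Rightarrow> complex^'n \<Rightarrow> complex^'n) \<Rightarrow> bool" where
  "unic S U \<longleftrightarrow> (\<forall>q\<in>S. uni (U q)) \<and> (\<forall>z. continuous_on S (\<lambda>q. U q z))"

lemma continuous_on_cmult [continuous_intros]:
  fixes f :: "'a::topological_space \<Rightarrow> complex" and g :: "'a \<Rightarrow> complex^'n"
  assumes "continuous_on S f" "continuous_on S g"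
  shows "continuous_on S (\<lambda>x. f x *s g x)"
  unfolding vector_scalar_mult_def
  by (intro continuous_on_vec_lambda continuous_intros assms)

lemma continuous_on_herm [continuous_intros]:
  assumes "continuous_on S f" "continuous_on S g"
  shows "continuous_on S (\<lambda>x. herm (f x) (g x))"
  unfolding herm_def by (intro continuous_intros assms)

lemma unic_apply:
  fixes U :: "'a::topological_space \<Rightarrow> complex^'n \<Rightarrow> complex^'n"
  assumes U: "unic S U" and v: "continuous_on S v"
  shows "continuous_on S (\<lambda>q. U q (v q))"
proof -
  have "U q (v q) = (\<Sum>j\<in>UNIV. (v q $ j) *s U q (axis j 1))" if "q \<in> S" for q
  proof -
    have u: "uni (U q)" using U that by (auto simp: unic_def)
    show ?thesis
      by (subst cmult_sum_axis[of "v q"]) (simp add: linear_sum[OF uni_linear[OF u]] uniD[OF u])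
  qed
  moreover have "continuous_on S (\<lambda>q. \<Sum>j\<in>UNIV. (v q $ j) *s U q (axis j 1))"
    using U v by (intro continuous_intros) (auto simp: unic_def)
  ultimately show ?thesis by (simp cong: continuous_on_cong)
qed

lemma unic_comp: "unic S U \<Longrightarrow> unic S V \<Longrightarrow> unic S (\<lambda>q z. U q (V q z))"
  using unic_apply[of S U] by (simp add: unic_def uni_comp)

text \<open>The inverse is the adjoint: its j-th coordinate is the Hermitian product with the image
  of the j-th axis.\<close>

lemma unic_inv:
  assumes U: "unic S U" shows "unic S (\<lambda>q. inv (U q))"
  unfolding unic_def
proof (intro conjI ballI allI)
  show "uni (inv (U q))" if "q \<in> S" for q using that U by (auto simp: unic_def uni_inv)
  fix z
  have "inv (U q) z = (\<chi> j. herm (U q (axis j 1)) z)" if "q \<in> S" for q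
  proof -
    have u: "uni (U q)" using U that by (auto simp: unic_def)
    have "inv (U q) z $ j = herm (U q (axis j 1)) z" for j
      using uni_herm[OF u, of "axis j 1" "inv (U q) z"]
      by (simp add: herm_axis surj_f_inv_f[OF uni_surj[OF u]])
    then show ?thesis by (simp add: vec_eq_iff)
  qed
  moreover have "continuous_on S (\<lambda>q. \<chi> j. herm (U q (axis j 1)) z)"
    using U by (intro continuous_intros) (auto simp: unic_def)
  ultimately show "continuous_on S (\<lambda>q. inv (U q) z)" by (simp cong: continuous_on_cong)
qed

text \<open>The projection onto the image plane is the conjugate of the original projection by the
  unitary map.\<close>

lemma lagc_unic:
  fixes U :: "'a::topological_space \<Rightarrow> complex^'n \<Rightarrow> complex^'n"
  assumes U: "unic S U" and P: "lagc S P"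
  shows "lagc S (\<lambda>q. U q ` P q)"
  unfolding lagc_def
proof (intro conjI ballI allI)
  show "lagrangian (U q ` P q)" if "q \<in> S" for q
    using that U P by (auto simp: lagc_def unic_def intro: lagrangian_image)
  fix z
  have "closest_point (U q ` P q) z = U q (closest_point (P q) (inv (U q) z))" if "q \<in> S" for q
  proof -
    have u: "uni (U q)" using U that by (auto simp: unic_def)
    have "subspace (P q)" using P that by (auto simp: lagc_def lagrangian_def)
    from closest_point_uni[OF u this, of "inv (U q) z"] show ?thesis
      by (simp add: surj_f_inv_f[OF uni_surj[OF u]])
  qed
  moreover have "continuous_on S (\<lambda>q. U q (closest_point (P q) (inv (U q) z)))"
    using unic_inv[OF U] by (intro unic_apply[OF U] lagc_closest_point[OF P]) (auto simp: unic_def)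
  ultimately show "continuous_on S (\<lambda>q. closest_point (U q ` P q) z)" by (simp cong: continuous_on_cong)
qed

lemma lagc_const: "lagrangian P \<Longrightarrow> lagc S (\<lambda>_. P)"
  by (simp add: lagc_def)

lemma lagc_subset: "lagc S P \<Longrightarrow> T \<subseteq> S \<Longrightarrow> lagc T P"
  unfolding lagc_def using continuous_on_subset by blast

lemma lagc_cong: "(\<And>q. q \<in> S \<Longrightarrow> P q = Q q) \<Longrightarrow> lagc S P \<longleftrightarrow> lagc S Q"
  unfolding lagc_def by (simp cong: continuous_on_cong)

lemma lagc_compose: "lagc S P \<Longrightarrow> continuous_on T f \<Longrightarrow> f ` T \<subseteq> S \<Longrightarrow> lagc T (\<lambda>x. P (f x))"
  unfolding lagc_def by (auto simp: image_subset_iff intro: continuous_on_compose2)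

lemma lagc_closed_Un:
  assumes "lagc A P" "lagc B P" "closedin (top_of_set (A \<union> B)) A" "closedin (top_of_set (A \<union> B)) B"
  shows "lagc (A \<union> B) P"
  unfolding lagc_def
proof (intro conjI allI)
  show "continuous_on (A \<union> B) (\<lambda>q. closest_point (P q) z)" for z
    by (rule continuous_on_Un_local[OF assms(3,4)]) (use assms(1,2) in \<open>auto simp: lagc_def\<close>)
qed (use assms in \<open>auto simp: lagc_def\<close>)

lemma lagc_at:
  "lagc S P \<longleftrightarrow> (\<forall>q\<in>S. lagrangian (P q) \<and> (\<forall>z. continuous (at q within S) (\<lambda>q. closest_point (P q) z)))"
  by (auto simp: lagc_def continuous_on_eq_continuous_within)

text \<open>Needed for maps glued from pieces with disjoint supports, where near each point a single
  continuous family describes the map.\<close>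

lemma lagc_open_local:
  fixes S :: "'a::t2_space set"
  assumes "\<And>q. q \<in> S \<Longrightarrow> \<exists>U Q. open U \<and> q \<in> U \<and> lagc (S \<inter> U) Q \<and> (\<forall>x\<in>S \<inter> U. P x = Q x)"
  shows "lagc S P"
  unfolding lagc_at
proof (intro ballI conjI allI)
  fix q assume q: "q \<in> S"
  obtain U Q where U: "open U" "q \<in> U" "lagc (S \<inter> U) Q" "\<forall>x\<in>S \<inter> U. P x = Q x"
    using assms[OF q] by blast
  then have *: "lagc (S \<inter> U) P" using lagc_cong[of "S \<inter> U" P Q] by auto
  then show "lagrangian (P q)" using q U by (auto simp: lagc_def)
  fix z
  have "continuous (at q within S \<inter> U) (\<lambda>q. closest_point (P q) z)"
    using * q U by (auto simp: lagc_at)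
  moreover have "at q within S \<inter> U = at q within S"
    by (rule at_within_nhd[OF U(2,1)]) auto
  ultimately show "continuous (at q within S) (\<lambda>q. closest_point (P q) z)" by simp
qed

section \<open>The sphere as a quotient of the disc\<close>

text \<open>Radial stretching of the open unit disc onto R^n, with the boundary collapsed to the
  point at infinity.\<close>

definition dm :: "real^'n \<Rightarrow> (real^'n) option" where
  "dm y = (if norm y < 1 then Some (y /\<^sub>R (1 - norm y)) else None)"

text \<open>A section of \<open>dm\<close>. At infinity an arbitrary point of the unit sphere is
  chosen, so \<open>dinv\<close> itself is not meant to be continuous there.\<close>

definition dinv :: "(real^'n) option \<Rightarrow> real^'n" where
  "dinv p = (case p of None \<Rightarrow> axis undefined 1 | Some q \<Rightarrow> q /\<^sub>R (1 + norm q))"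

lemma dinv_simps: "dinv None = axis undefined 1" "dinv (Some q) = q /\<^sub>R (1 + norm q)"
  by (simp_all add: dinv_def)

lemma norm_dinv_None: "norm (dinv None) = 1"
  by (simp add: dinv_def norm_axis_1)

lemma norm_dinv_Some: "norm (dinv (Some q)) < 1"
proof -
  have "norm q / (1 + norm q) < 1" by (simp add: divide_less_eq add_pos_nonneg)
  then show ?thesis by (simp add: dinv_def divide_inverse mult.commute)
qed

lemma dm_dinv: "dm (dinv p) = p"
proof (cases p)
  case None
  then show ?thesis by (simp add: dm_def norm_dinv_None)
next
  case (Some q)
  have pos: "1 + norm q > 0" by (simp add: add_pos_nonneg)
  then have "1 - norm (q /\<^sub>R (1 + norm q)) = inverse (1 + norm q)"
    by (simp add: field_simps)
  then show ?thesis using norm_dinv_Some[of q] pos by (simp add: Some dm_def dinv_simps)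
qed

lemma dinv_dm: "norm y < 1 \<Longrightarrow> dinv (dm y) = y"
proof -
  assume y: "norm y < 1"
  then have "1 + norm (y /\<^sub>R (1 - norm y)) = inverse (1 - norm y)"
    by (simp add: field_simps)
  then show ?thesis using y by (simp add: dm_def dinv_simps)
qed

lemma norm_dinv_le: "norm (dinv p) \<le> 1"
  by (cases p) (auto intro: less_imp_le simp: norm_dinv_None norm_dinv_Some)

lemma topspace_sphere_top [simp]: "topspace sphere_top = UNIV"
  by (simp add: sphere_top_def UNIV_option_conv)

lemma Hausdorff_sphere_top: "Hausdorff_space sphere_top"
  by (simp add: sphere_top_def Hausdorff_space_Alexandroff_compactification locally_compact_space_euclidean)

text \<open>A neighbourhood of infinity is the complement of a compact set C, and its preimage is
  the complement in the disc of the compact image of C under \<open>dinv\<close>.\<close>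

lemma continuous_dm: "continuous_map (top_of_set (cball 0 1)) sphere_top (dm :: real^'n \<Rightarrow> _)"
proof -
  have op: "openin (top_of_set (cball 0 1)) {y \<in> cball 0 1. dm y \<in> V}" if "openin sphere_top V" 
    for V :: "(real^'n) option set"
  proof -
    consider U where "open U" "V = Some ` U" | C where "compact C" "V = insert None (Some ` (- C))"
      using \<open>openin sphere_top V\<close> 
      by (auto simp: sphere_top_def openin_Alexandroff_compactification compactin_euclidean_iff Compl_eq_Diff_UNIV)
    then show ?thesis
    proof cases
      case 1
      have "{y \<in> cball 0 1. dm y \<in> V} = ball 0 1 \<inter> (\<lambda>y. y /\<^sub>R (1 - norm y)) -` U"
        using 1 by (auto simp: dm_def)
      moreover have "open (ball 0 1 \<inter> (\<lambda>y::real^'n. y /\<^sub>R (1 - norm y)) -` U)"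
        by (intro continuous_open_preimage continuous_intros 1) auto
      ultimately show ?thesis by (auto simp: openin_open)
    next
      case 2
      define K where "K = (\<lambda>q. dinv (Some q)) ` C"
      have "compact K" unfolding K_def dinv_simps
        by (intro compact_continuous_image continuous_intros 2) (simp add: add_nonneg_eq_0_iff)
      moreover have "{y \<in> cball 0 1. dm y \<in> V} = cball 0 1 \<inter> - K"
      proof -
        have "dm y \<in> V \<longleftrightarrow> y \<notin> K" if y: "norm y \<le> 1" for y
        proof -
          have "dm y \<in> V \<longleftrightarrow> dm y \<notin> Some ` C" using 2 by (cases "dm y") auto
          also have "\<dots> \<longleftrightarrow> y \<notin> K"
          proof -
            have "dm y \<in> Some ` C \<longleftrightarrow> y \<in> K"
            proof
              assume "dm y \<in> Some ` C"
              then obtain q where q: "q \<in> C" "dm y = Some q" by auto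
              then have "norm y < 1" by (auto simp: dm_def split: if_splits)
              then have "y = dinv (Some q)" using dinv_dm q(2) by metis
              then show "y \<in> K" using q by (auto simp: K_def)
            qed (auto simp: K_def dm_dinv)
            then show ?thesis by blast
          qed
          finally show ?thesis .
        qed
        then show ?thesis by auto
      qed
      ultimately show ?thesis by (metis openin_open_Int compact_imp_closed open_Compl)
    qed
  qed
  show ?thesis
    unfolding continuous_map_def using op by (auto simp: topspace_euclidean_subtopology)
qed

text \<open>A continuous surjection from a compact space onto a Hausdorff space is a quotient map.
  The time factor is included because homotopies, not only maps, have to descend.\<close>

lemma quotient_dm:
  "quotient_map (top_of_set ({0..1} \<times> cball 0 1)) (prod_topology (top_of_set {0..1::real}) sphere_top)
     (\<lambda>(t, y::real^'n). (t, dm y))"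
proof (rule continuous_imp_quotient_map)
  have eq: "top_of_set ({0..1::real} \<times> cball (0::real^'n) 1) =
      prod_topology (top_of_set {0..1}) (top_of_set (cball 0 1))"
    by (simp add: prod_topology_subtopology_eu)
  have "continuous_map (prod_topology (top_of_set {0..1::real}) (top_of_set (cball (0::real^'n) 1)))
     (prod_topology (top_of_set {0..1}) sphere_top) (\<lambda>(t, y). (id t, dm y))"
    unfolding continuous_map_prod_top by (intro disjI2 conjI continuous_dm) (simp add: continuous_map_id[unfolded id_def])
  then show "continuous_map (top_of_set ({0..1} \<times> cball 0 1))
     (prod_topology (top_of_set {0..1::real}) sphere_top) (\<lambda>(t, y::real^'n). (t, dm y))"
    by (simp only: eq id_apply)
  show "compact_space (top_of_set ({0..1::real} \<times> cball (0::real^'n) 1))"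
    by (simp add: compact_space_subtopology compact_Times)
  show "Hausdorff_space (prod_topology (top_of_set {0..1::real}) (sphere_top :: (real^'n) option topology))"
    by (simp add: Hausdorff_space_prod_topology Hausdorff_sphere_top Hausdorff_space_subtopology)
  have "(t, p) \<in> (\<lambda>(t, y). (t, dm y)) ` ({0..1} \<times> cball 0 1)" if "t \<in> {0..1}" for t::real and p :: "(real^'n) option"
    using that dm_dinv[of p] norm_dinv_le[of p] by (intro image_eqI[of _ _ "(t, dinv p)"]) auto
  then have "{0..1::real} \<times> (UNIV :: (real^'n) option set) \<subseteq> (\<lambda>(t, y). (t, dm y)) ` ({0..1} \<times> cball 0 1)" by blast
  moreover have "(\<lambda>(t, y::real^'n). (t, dm y)) ` ({0..1::real} \<times> cball 0 1) \<subseteq> {0..1} \<times> UNIV" by auto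
  ultimately show "(\<lambda>(t, y). (t, dm y)) ` topspace (top_of_set ({0..1} \<times> cball 0 1)) =
      topspace (prod_topology (top_of_set {0..1::real}) (sphere_top :: (real^'n) option topology))"
    by (simp add: subset_antisym)
qed

text \<open>A homotopy constant on the boundary of the disc factors through the quotient map, and
  composition with the section \<open>dinv\<close> yields the factor.\<close>

lemma homotopic_of_disc:
  fixes H :: "real \<times> (real^'n) \<Rightarrow> 'b"
  assumes H: "continuous_map (top_of_set ({0..1} \<times> cball 0 1)) Y H"
    and b: "\<And>t y. t \<in> {0..1} \<Longrightarrow> norm y = 1 \<Longrightarrow> H (t, y) = b"
  shows "homotopic_with (\<lambda>h. h None = b) sphere_top Y (\<lambda>p. H (0, dinv p)) (\<lambda>p. H (1, dinv p))"
proof -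
  define K where "K = (\<lambda>(t, p). H (t, dinv p))"
  have "continuous_map (top_of_set ({0..1} \<times> cball 0 1)) Y (K \<circ> (\<lambda>(t, y). (t, dm y)))"
  proof (rule continuous_map_eq[OF H])
    fix x assume "x \<in> topspace (top_of_set ({0..1::real} \<times> cball (0::real^'n) 1))"
    then obtain t y where x: "x = (t, y)" "t \<in> {0..1}" "norm y \<le> 1" by auto
    show "H x = (K \<circ> (\<lambda>(t, y). (t, dm y))) x"
    proof (cases "norm y < 1")
      case True
      then show ?thesis by (simp add: K_def x dinv_dm)
    next
      case False
      then have "dm y = None" "norm y = 1" using x by (auto simp: dm_def)
      then show ?thesis using x by (simp add: K_def b norm_dinv_None)
    qed
  qed
  then have "continuous_map (prod_topology (top_of_set {0..1::real}) sphere_top) Y K"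
    by (rule continuous_compose_quotient_map[OF quotient_dm])
  then show ?thesis unfolding homotopic_with_def
    by (intro exI[of _ K]) (auto simp: K_def b norm_dinv_None)
qed

lemma disc_of_homotopic:
  fixes f :: "(real^'n) option \<Rightarrow> 'b"
  assumes "homotopic_with (\<lambda>h. h None = b) sphere_top Y f g"
  obtains H :: "real \<times> (real^'n) \<Rightarrow> 'b" where "continuous_map (top_of_set ({0..1} \<times> cball 0 1)) Y H"
    "\<And>t y. t \<in> {0..1} \<Longrightarrow> norm y = 1 \<Longrightarrow> H (t, y) = b"
    "\<And>y. H (0, y) = f (dm y)" "\<And>y. H (1, y) = g (dm y)"
proof -
  obtain K where K: "continuous_map (prod_topology (top_of_set {0..1::real}) sphere_top) Y K"
    "\<And>x. K (0, x) = f x" "\<And>x. K (1, x) = g x" "\<And>t. t \<in> {0..1} \<Longrightarrow> K (t, None) = b"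
    using assms unfolding homotopic_with_def by metis
  have "continuous_map (top_of_set ({0..1} \<times> cball 0 1)) Y (K \<circ> (\<lambda>(t, y). (t, dm y)))"
    using quotient_imp_continuous_map[OF quotient_dm] K(1) by (rule continuous_map_compose)
  from that[OF this] show ?thesis
    using K by (auto simp: dm_def)
qed

text \<open>Pulled back to the open disc, the homotopy is constantly \<open>b\<close> in a collar of
  the boundary, so it extends continuously by \<open>b\<close>.\<close>

lemma homotopic_of_compact_support:
  fixes H :: "real \<times> (real^'n) \<Rightarrow> (complex^'n) set"
  assumes H: "lagc ({0..1} \<times> UNIV) H" and b: "\<And>t q. t \<in> {0..1} \<Longrightarrow> norm q \<ge> r \<Longrightarrow> H (t, q) = b"
  shows "homotopic_with (\<lambda>h. h None = b) sphere_top Lag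
    (\<lambda>p. case p of None \<Rightarrow> b | Some q \<Rightarrow> H (0, q)) (\<lambda>p. case p of None \<Rightarrow> b | Some q \<Rightarrow> H (1, q))"
proof -
  define K where "K = (\<lambda>(t, y). if norm y < 1 then H (t, y /\<^sub>R (1 - norm y)) else b)"
  \<comment> \<open>The radius in the disc that corresponds to the radius |r| in R^n.\<close>
  define r' where "r' = \<bar>r\<bar> / (1 + \<bar>r\<bar>)"
  have r': "0 \<le> r'" "r' < 1" by (auto simp: r'_def divide_less_eq)
  \<comment> \<open>Two closed pieces that overlap between the radii r' and (1 + r') / 2. The first
    stays away from the boundary, where the stretching is undefined.\<close>
  let ?A = "{0..1::real} \<times> cball (0::real^'n) ((1 + r')/2)" and ?B = "{0..1::real} \<times> {y::real^'n. r' \<le> norm y \<and> norm y \<le> 1}"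
  have Kb: "K (t, y) = b" if "t \<in> {0..1}" "r' \<le> norm y" for t y
  proof (cases "norm y < 1")
    case True
    have "\<bar>r\<bar> \<le> norm y * (1 + \<bar>r\<bar>)" using that by (simp add: r'_def pos_divide_le_eq)
    then have "\<bar>r\<bar> * (1 - norm y) \<le> norm y" by (simp add: algebra_simps)
    then have "\<bar>r\<bar> \<le> norm y / (1 - norm y)" using True by (simp add: pos_le_divide_eq)
    then have "r \<le> norm (y /\<^sub>R (1 - norm y))" using True by (simp add: divide_inverse mult.commute)
    then show ?thesis using that b True by (simp add: K_def)
  qed (auto simp: K_def)
  have lb: "lagrangian b"
  proof -
    \<comment> \<open>Any point of norm at least r shows that \<open>b\<close> is a value of H; this
      constant vector is such a point.\<close>
    have "lagrangian (H (0, vec (\<bar>r\<bar> + 1)))" using H by (auto simp: lagc_def)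
    moreover have "norm (vec (\<bar>r\<bar> + 1) :: real^'n) \<ge> r"
      using component_le_norm_cart[of "vec (\<bar>r\<bar> + 1) :: real^'n" undefined] by simp
    ultimately show ?thesis using b[of 0] by simp
  qed
  have "lagc ?A (\<lambda>x. H (fst x, snd x /\<^sub>R (1 - norm (snd x))))"
  proof (rule lagc_compose[OF H])
    show "continuous_on ?A (\<lambda>x. (fst x, snd x /\<^sub>R (1 - norm (snd x))))"
      using r' by (intro continuous_intros) auto
  qed auto
  then have 1: "lagc ?A K" by (rule lagc_cong[THEN iffD1, rotated]) (use r' in \<open>auto simp: K_def\<close>)
  have 2: "lagc ?B K" by (rule lagc_cong[THEN iffD1, OF _ lagc_const[OF lb]]) (auto simp: Kb)
  have U: "?A \<union> ?B = {0..1} \<times> cball 0 1" using r' by auto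
  have "closed ?A" by (intro closed_Times) auto
  moreover have "{y::real^'n. r' \<le> norm y \<and> norm y \<le> 1} = cball 0 1 - ball 0 r'" by auto
  then have "closed ?B" by (intro closed_Times) (auto simp: closed_Diff)
  ultimately have "lagc ({0..1} \<times> cball 0 1) K"
    using lagc_closed_Un[OF 1 2] unfolding U[symmetric] by (auto intro!: closed_subset)
  then have "continuous_map (top_of_set ({0..1} \<times> cball 0 1)) Lag K" by (simp add: lagc_iff)
  then have "homotopic_with (\<lambda>h. h None = b) sphere_top Lag (\<lambda>p. K (0, dinv p)) (\<lambda>p. K (1, dinv p))"
    by (rule homotopic_of_disc) (use Kb r' in auto)
  moreover have "K (t, dinv p) = (case p of None \<Rightarrow> b | Some q \<Rightarrow> H (t, q))" for t p
  proof (cases p)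
    case None
    then show ?thesis by (simp add: K_def norm_dinv_None)
  next
    case (Some q)
    have "dinv p /\<^sub>R (1 - norm (dinv p)) = q" 
      using dm_dinv[of p] norm_dinv_Some[of q] by (auto simp: Some dm_def)
    then show ?thesis using norm_dinv_Some[of q] by (simp add: K_def Some)
  qed
  ultimately show ?thesis by simp
qed

section \<open>General position of maps into a sphere\<close>

text \<open>The cone over a polynomial approximation has at most DIM('a) + 1 dimensions and is
  negligible in the target, so some direction b is missed. It is sought near -e because the map must
  be kept where it equals e, and there a direction near -e is avoided anyway. The inequalities for
  \<open>g'\<close> are what makes the rotations from g to g' and from g' to -b well
  defined.\<close>

lemma avoid_sphere_point:
  fixes g :: "'a::euclidean_space \<Rightarrow> 'b::euclidean_space"
  assumes S: "compact S" and g: "continuous_on S g" and g1: "\<And>x. x \<in> S \<Longrightarrow> norm (g x) = 1"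
    and e: "norm e = 1" and dim: "DIM('a) + 1 < DIM('b)"
  obtains g' b where "continuous_on S g'" "\<And>x. x \<in> S \<Longrightarrow> norm (g' x) = 1" "norm b = 1" "b \<noteq> e"
    "\<And>x. x \<in> S \<Longrightarrow> g' x \<noteq> b" "\<And>x. x \<in> S \<Longrightarrow> g' x \<noteq> - g x" "\<And>x. x \<in> S \<Longrightarrow> g x = e \<Longrightarrow> g' x = e"
proof -
  obtain p where p: "polynomial_function p" "\<And>x. x \<in> S \<Longrightarrow> norm (g x - p x) < 1/4"
    using Stone_Weierstrass_polynomial_function[OF S g, of "1/4"] by auto
  \<comment> \<open>With all multiples included, the direction b is missed by p even after
    normalization, which spares normalizing p before the dimension count.\<close>
  define cone where "cone = (\<lambda>(x, l::real). l *\<^sub>R p x) ` UNIV"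
  have "negligible cone" unfolding cone_def
  proof (rule negligible_differentiable_image_lowdim)
    show "DIM('a \<times> real) < DIM('b)" using dim by simp
    have "p differentiable (at x)" for x
      using differentiable_at_polynomial_function[OF p(1)] by simp
    then have "(\<lambda>z. p (fst z)) differentiable (at z)" for z :: "'a \<times> real"
      using differentiable_chain_at[of fst z p] by (simp add: o_def bounded_linear_imp_differentiable[OF bounded_linear_fst])
    then show "(\<lambda>(x, l::real). l *\<^sub>R p x) differentiable_on UNIV"
      unfolding differentiable_on_def case_prod_beta by (auto intro!: differentiable_scaleR bounded_linear_imp_differentiable[OF bounded_linear_snd])
  qed
  then have "\<not> ball (- e) (1/20) \<subseteq> cone"
    using negligible_subset[of cone "ball (- e) (1/20)"] open_not_negligible[of "ball (- e) (1/20)"] by auto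
  then obtain b' where b': "b' \<notin> cone" "b' \<in> ball (- e) (1/20)" by blast
  then have b'e: "norm (b' + e) < 1/20"
    using norm_minus_commute[of "- e" b'] by (simp add: dist_norm)
  define b where "b = b' /\<^sub>R norm b'"
  have nb': "\<bar>norm b' - 1\<bar> < 1/20"
    using norm_triangle_ineq3[of b' "- e"] b'e e by simp
  then have nz: "norm b' \<noteq> 0" by auto
  then have nb: "norm b = 1" by (simp add: b_def)
  have bc: "l *\<^sub>R b \<notin> cone" if "l > 0" for l
  proof
    assume "l *\<^sub>R b \<in> cone"
    then obtain x m where "l *\<^sub>R b = m *\<^sub>R p x" by (auto simp: cone_def)
    then have "(1 / l) *\<^sub>R (l *\<^sub>R b) = (1 / l) *\<^sub>R (m *\<^sub>R p x)" by simp
    then have "b = (1 / l) *\<^sub>R (m *\<^sub>R p x)" using that by simp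
    moreover have "b' = norm b' *\<^sub>R b" using nz by (simp add: b_def)
    ultimately have "b' = norm b' *\<^sub>R (1 / l) *\<^sub>R (m *\<^sub>R p x)" by simp
    then have "b' = (norm b' * (1 / l) * m) *\<^sub>R p x" by simp
    then have "b' \<in> cone" unfolding cone_def by (intro image_eqI[of _ _ "(x, norm b' * (1 / l) * m)"]) auto
    then show False using b' by blast
  qed
  have be: "norm (b + e) < 1/10"
  proof -
    have "b' - b = (norm b' - 1) *\<^sub>R b" using nz by (simp add: b_def algebra_simps)
    then have "norm (b' - b) < 1/20" using nb nb' by simp
    then show ?thesis using b'e norm_triangle_ineq4[of "b' + e" "b' - b"] by (simp add: add.commute)
  qed
  \<comment> \<open>Cut-off: 0 within distance 1/2 of e, where g is kept, and 1 beyond distance 1,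
    where the polynomial takes over.\<close>
  define ch where "ch = (\<lambda>x. min 1 (max 0 (2 * norm (g x - e) - 1)))"
  define k where "k = (\<lambda>x. g x + ch x *\<^sub>R (p x - g x))"
  have ch: "0 \<le> ch x" "ch x \<le> 1" for x by (auto simp: ch_def)
  have kg: "norm (k x - g x) < 1/4" if "x \<in> S" for x
  proof -
    have "norm (k x - g x) = ch x * norm (g x - p x)" using ch by (simp add: k_def norm_minus_commute)
    also have "\<dots> \<le> 1 * norm (g x - p x)" using ch by (intro mult_right_mono) auto
    finally show ?thesis using p(2)[OF that] by simp
  qed
  have kn: "norm (k x) > 3/4" if "x \<in> S" for x
    using kg[OF that] norm_triangle_ineq3[of "k x" "g x"] g1[OF that] by simp
  have kn0: "norm (k x) \<noteq> 0" if "x \<in> S" for x using kn[OF that] by linarith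
  have kb: "k x \<noteq> l *\<^sub>R b" if x: "x \<in> S" and l: "l > 0" for x l
  proof
    assume eq: "k x = l *\<^sub>R b"
    show False
    proof (cases "norm (g x - e) \<ge> 1")
      case True
      then have "k x = 1 *\<^sub>R p x" by (simp add: k_def ch_def)
      then have "l *\<^sub>R b \<in> cone" using eq unfolding cone_def by (intro image_eqI[of _ _ "(x, 1)"]) auto
      then show False using bc l by blast
    next
      case False
      \<comment> \<open>Here k stays within 5/4 of e, whereas a multiple of b of length above 3/4 is
        farther from e than that, b being almost -e.\<close>
      have "norm (k x - e) < 5/4" using False kg[OF x] norm_triangle_ineq[of "k x - g x" "g x - e"] by simp
      moreover have "l > 3/4" using kn[OF x] eq nb l by simp
      moreover have "norm (k x - e) \<ge> 1 + l - l * (1/10)"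
      proof -
        have "norm ((1 + l) *\<^sub>R e) - norm (l *\<^sub>R (b + e)) \<le> norm ((1 + l) *\<^sub>R e - l *\<^sub>R (b + e))"
          by (rule norm_triangle_ineq2)
        moreover have "(1 + l) *\<^sub>R e - l *\<^sub>R (b + e) = - (k x - e)" by (simp add: eq algebra_simps)
        moreover have "norm (l *\<^sub>R (b + e)) \<le> l * (1/10)" using be l by (simp add: less_imp_le)
        moreover have "norm ((1 + l) *\<^sub>R e) = 1 + l" using l e by simp
        ultimately show ?thesis by (simp add: norm_minus_commute)
      qed
      ultimately show False by linarith
    qed
  qed
  show ?thesis
  proof (rule that[of "\<lambda>x. k x /\<^sub>R norm (k x)" b])
    show "continuous_on S (\<lambda>x. k x /\<^sub>R norm (k x))"
    proof -
      have "continuous_on S k" unfolding k_def ch_def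
        by (intro continuous_intros g continuous_on_polymonial_function p)
      then show ?thesis by (intro continuous_intros ballI kn0)
    qed
    show "norm (k x /\<^sub>R norm (k x)) = 1" if "x \<in> S" for x using kn0[OF that] by simp
    show "b \<noteq> e"
    proof
      assume "b = e"
      then have "norm (b + e) = norm (2 *\<^sub>R e)" by (simp add: scaleR_2)
      then have "norm (b + e) = 2" using e by simp
      then show False using be by simp
    qed
    show "k x /\<^sub>R norm (k x) \<noteq> b" if "x \<in> S" for x
    proof
      assume "k x /\<^sub>R norm (k x) = b"
      then have "k x = norm (k x) *\<^sub>R b" using kn0[OF that] by (metis norm_eq_zero scaleR_one scaleR_scaleR right_inverse)
      then show False using kb[OF that, of "norm (k x)"] kn0[OF that] zero_less_norm_iff by force
    qed
    show "k x /\<^sub>R norm (k x) \<noteq> - g x" if "x \<in> S" for x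
    proof
      assume "k x /\<^sub>R norm (k x) = - g x"
      then have "norm (k x) *\<^sub>R (k x /\<^sub>R norm (k x)) = norm (k x) *\<^sub>R (- g x)" by simp
      then have "k x = norm (k x) *\<^sub>R (- g x)" using kn0[OF that] by simp
      then have "k x - g x = - ((norm (k x) + 1) *\<^sub>R g x)" by (simp add: algebra_simps)
      then have "norm (k x - g x) = norm (k x) + 1" using g1[OF that] by simp
      then show False using kg[OF that] norm_ge_zero[of "k x"] by linarith
    qed
    show "k x /\<^sub>R norm (k x) = e" if "x \<in> S" "g x = e" for x
      using that e by (simp add: k_def ch_def)
  qed (use nb in auto)
qed

section \<open>Lagrangians as maximal isotropic subspaces\<close>

lemma symp_axioms:
  shows symp_add_left: "symp (a + b) c = symp a c + symp b c"
    and symp_add_right: "symp a (b + c) = symp a b + symp a c"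
    and symp_scaleR_left: "symp (r *\<^sub>R a) b = r * symp a b"
    and symp_scaleR_right: "symp a (r *\<^sub>R b) = r * symp a b"
    and symp_zero [simp]: "symp 0 a = 0" "symp a 0 = 0"
  by (auto simp: herm_simps scaleR_eq_cmult complex_eq_iff simp flip: Im_herm)

text \<open>Let J be multiplication by i. It maps the symplectic complement Q of P onto the
  orthogonal complement of P, so dim Q + dim P = 2n. For isotropic P, half dimension thus means Q =
  P. In this form no dimensions have to be counted for \<open>stab\<close> and
  \<open>unstab\<close>.\<close>

lemma lagrangian_iff:
  fixes P :: "(complex^'n) set"
  shows "lagrangian P \<longleftrightarrow> subspace P \<and> (\<forall>z\<in>P. \<forall>w\<in>P. symp z w = 0) \<and>
     (\<forall>z. (\<forall>w\<in>P. symp w z = 0) \<longrightarrow> z \<in> P)"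
proof (cases "subspace P \<and> (\<forall>z\<in>P. \<forall>w\<in>P. symp z w = 0)")
  case True
  then have sP: "subspace P" and iso: "\<And>z w. z \<in> P \<Longrightarrow> w \<in> P \<Longrightarrow> symp z w = 0" by auto
  define Q where "Q = {z. \<forall>w\<in>P. symp w z = 0}"
  have sQ: "subspace Q" unfolding Q_def subspace_def by (auto simp: symp_axioms)
  have PQ: "P \<subseteq> Q" using iso by (auto simp: Q_def)
  define J where "J = (\<lambda>z::complex^'n. \<i> *s z)"
  have J: "linear J" by (rule linearI) (auto simp: J_def vec_eq_iff algebra_simps)
  have JJ: "J (- J z) = z" for z by (simp add: J_def vec_eq_iff flip: mult.assoc)
  have injJ: "inj J" by (rule injI) (auto simp: J_def vec_eq_iff)
  have "J ` Q = {y \<in> UNIV. \<forall>x\<in>P. orthogonal x y}"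
  proof -
    have s: "symp w z = - (w \<bullet> J z)" for w z
      by (simp add: J_def herm_simps flip: Re_herm Im_herm)
    have "y \<in> J ` Q" if "\<forall>x\<in>P. orthogonal x y" for y
    proof (rule image_eqI)
      show "y = J (- J y)" by (simp add: JJ)
      show "- J y \<in> Q" using that by (simp add: Q_def s JJ orthogonal_def)
    qed
    then show ?thesis by (auto simp: Q_def s orthogonal_def)
  qed
  then have "dim (J ` Q) + dim P = DIM(complex^'n)"
    using dim_subspace_orthogonal_to_vectors[OF sP subspace_UNIV] by simp
  moreover have "dim (J ` Q) = dim Q"
    using J injJ by (metis dim_image_eq inj_on_subset top_greatest)
  ultimately have d: "dim Q + dim P = 2 * CARD('n)" by simp
  have "dim P = CARD('n) \<longleftrightarrow> Q \<subseteq> P"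
  proof
    assume "dim P = CARD('n)"
    then have "P = Q" using d by (intro subspace_dim_equal sP sQ PQ) auto
    then show "Q \<subseteq> P" by simp
  next
    assume "Q \<subseteq> P"
    then have "P = Q" using PQ by auto
    then show "dim P = CARD('n)" using d by simp
  qed
  then show ?thesis using sP iso by (auto simp: lagrangian_def Q_def)
qed (auto simp: lagrangian_def)

lemma lagrangianI:
  assumes "subspace P" "\<And>z w. z \<in> P \<Longrightarrow> w \<in> P \<Longrightarrow> symp z w = 0"
    "\<And>z. (\<And>w. w \<in> P \<Longrightarrow> symp w z = 0) \<Longrightarrow> z \<in> P"
  shows "lagrangian P"
  unfolding lagrangian_iff using assms by blast

lemma lagrangianD:
  assumes "lagrangian P"
  shows lagrangian_isotropic: "z \<in> P \<Longrightarrow> w \<in> P \<Longrightarrow> symp z w = 0"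
    and lagrangian_maximal: "(\<And>w. w \<in> P \<Longrightarrow> symp w z = 0) \<Longrightarrow> z \<in> P"
  using assms unfolding lagrangian_iff by blast+

definition e0 :: "complex^('n::finite option)" where "e0 = axis None 1"

section \<open>Lagrangians containing the stabilizing direction\<close>

definition emb :: "complex^'n \<Rightarrow> complex^('n::finite option)" where
  "emb z = (\<chi> k. case k of None \<Rightarrow> 0 | Some j \<Rightarrow> z $ j)"

definition unemb :: "complex^('n::finite option) \<Rightarrow> complex^'n" where
  "unemb z = (\<chi> j. z $ Some j)"

lemma emb_nth [simp]: "emb z $ None = 0" "emb z $ Some j = z $ j"
  by (simp_all add: emb_def)

lemma unemb_nth [simp]: "unemb z $ j = z $ Some j"
  by (simp add: unemb_def)

lemma e0_nth [simp]: "e0 $ None = 1" "e0 $ Some j = 0"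
  by (simp_all add: e0_def axis_def)

lemma vec_option_eq_iff: "(z::'a^('n::finite option)) = w \<longleftrightarrow> z $ None = w $ None \<and> (\<forall>j. z $ Some j = w $ Some j)"
  by (auto simp: vec_eq_iff) (metis not_None_eq)

lemma unemb_emb [simp]: "unemb (emb z) = z"
  by (simp add: vec_eq_iff)

lemma unemb_linear [simp]: "unemb (z + w) = unemb z + unemb w" "unemb (c *s z) = c *s unemb z"
   "unemb (z - w) = unemb z - unemb w" "unemb 0 = 0" "unemb (r *\<^sub>R z) = r *\<^sub>R unemb z" "unemb e0 = 0"
  by (simp_all add: vec_eq_iff)

lemma emb_linear [simp]: "emb (z + w) = emb z + emb w" "emb (c *s z) = c *s emb z"
   "emb (z - w) = emb z - emb w" "emb 0 = 0" "emb (r *\<^sub>R z) = r *\<^sub>R emb z"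
  by (simp_all add: vec_option_eq_iff)

lemma sum_option: "(\<Sum>k\<in>UNIV. f k) = f None + (\<Sum>j\<in>(UNIV::'n::finite set). f (Some j))"
  by (simp add: UNIV_option_conv sum.reindex)

lemma herm_option: "herm z w = cnj (z $ None) * w $ None + herm (unemb z) (unemb w)"
  by (simp add: herm_def sum_option)

lemma symp_option: "symp z w = Im (cnj (z $ None) * w $ None) + symp (unemb z) (unemb w)"
  using arg_cong[OF herm_option, of Im z w] by (simp add: Im_herm)

lemma inner_option: "z \<bullet> w = Re (cnj (z $ None) * w $ None) + unemb z \<bullet> unemb w" 
  for z w :: "complex^('n::finite option)"
  using arg_cong[OF herm_option, of Re z w] by (simp add: Re_herm)

lemma herm_e0: "herm e0 z = z $ None"
  by (simp add: e0_def herm_axis)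

lemma norm_e0 [simp]: "norm e0 = 1"
  by (simp add: e0_def norm_axis_1)

lemma stab_iff: "z \<in> stab P \<longleftrightarrow> unemb z \<in> P \<and> z $ None \<in> \<real>"
  by (simp add: stab_def unemb_def)

lemma subspace_stab: "subspace P \<Longrightarrow> subspace (stab P)"
  by (auto simp: subspace_def stab_iff complex_is_Real_iff)

lemma e0_in_stab: "subspace P \<Longrightarrow> e0 \<in> stab P"
  by (simp add: stab_iff subspace_0)

lemma lagrangian_stab:
  assumes "lagrangian P" shows "lagrangian (stab P)"
proof -
  note P = lagrangian_subspace[OF assms] lagrangianD[OF assms]
  have "z \<in> stab P" if z: "\<And>w. w \<in> stab P \<Longrightarrow> symp w z = 0" for z
  proof -
    have "symp w (unemb z) = 0" if "w \<in> P" for w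
      using z[of "emb w"] that by (simp add: stab_iff symp_option)
    then have "unemb z \<in> P" by (rule P(3))
    moreover have "z $ None \<in> \<real>" using z[OF e0_in_stab[OF P(1)]] by (simp add: symp_option complex_is_Real_iff)
    ultimately show ?thesis by (simp add: stab_iff)
  qed
  moreover have "symp z w = 0" if "z \<in> stab P" "w \<in> stab P" for z w
    using that P(2)[of "unemb z" "unemb w"] by (auto simp: stab_iff symp_option complex_is_Real_iff)
  ultimately show ?thesis by (intro lagrangianI subspace_stab P(1)) auto
qed

lemma closest_point_stab:
  assumes "subspace P"
  shows "closest_point (stab P) z = emb (closest_point P (unemb z)) + of_real (Re (z $ None)) *s e0"
proof (rule closest_point_subspace_eq[OF subspace_stab[OF assms]])
  show "emb (closest_point P (unemb z)) + of_real (Re (z $ None)) *s e0 \<in> stab P"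
    using closest_point_mem[OF assms] by (simp add: stab_iff)
  fix w assume "w \<in> stab P"
  then show "(z - (emb (closest_point P (unemb z)) + of_real (Re (z $ None)) *s e0)) \<bullet> w = 0"
    using closest_point_perp[OF assms, of "unemb w" "unemb z"]
    by (auto simp: inner_option stab_iff complex_is_Real_iff)
qed

lemma continuous_on_emb [continuous_intros]:
  "continuous_on S f \<Longrightarrow> continuous_on S (\<lambda>x. emb (f x))"
  unfolding emb_def
proof (rule continuous_on_vec_lambda)
  fix k assume "continuous_on S f"
  then show "continuous_on S (\<lambda>x. case k of None \<Rightarrow> 0 | Some j \<Rightarrow> f x $ j)"
    by (cases k) (auto intro!: continuous_intros)
qed

lemma continuous_on_unemb [continuous_intros]:
  "continuous_on S f \<Longrightarrow> continuous_on S (\<lambda>x. unemb (f x))"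
  unfolding unemb_def by (intro continuous_intros)

definition unstab :: "(complex^('n::finite option)) set \<Rightarrow> (complex^'n) set" where
  "unstab P = {z. emb z \<in> P}"

lemma unstab_stab: "unstab (stab P) = P"
  by (auto simp: unstab_def stab_iff)

context
  fixes P :: "(complex^('n::finite option)) set"
  assumes P: "lagrangian P" and eP: "e0 \<in> P"
begin

text \<open>Isotropy against \<open>e0\<close> makes the coordinate along \<open>e0\<close> real,
  and subtracting that real multiple of \<open>e0\<close> stays in P. Hence P splits off the real
  line of \<open>e0\<close>, and \<open>unstab\<close> inverts \<open>stab\<close>.\<close>

lemma real_coordinate: assumes "v \<in> P" shows "v $ None \<in> \<real>" "emb (unemb v) \<in> P"
proof -
  have "symp e0 v = 0" by (rule lagrangian_isotropic[OF P eP assms])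
  then show r: "v $ None \<in> \<real>" by (simp add: symp_option complex_is_Real_iff)
  have "emb (unemb v) = v - Re (v $ None) *\<^sub>R e0"
    using r by (simp add: vec_option_eq_iff complex_eq_iff complex_is_Real_iff)
  then show "emb (unemb v) \<in> P"
    using lagrangian_subspace[OF P] eP assms by (auto intro: subspace_diff subspace_mul)
qed

lemma lagrangian_unstab: "lagrangian (unstab P)"
proof -
  show ?thesis
  proof (rule lagrangianI)
    show "subspace (unstab P)"
      using lagrangian_subspace[OF P] by (simp add: subspace_def unstab_def)
    show "symp z w = 0" if "z \<in> unstab P" "w \<in> unstab P" for z w
    proof -
      have "symp (emb z) (emb w) = 0" using that by (intro lagrangian_isotropic[OF P]) (auto simp: unstab_def)
      then show ?thesis by (simp add: symp_option)
    qed
    show "z \<in> unstab P" if z: "\<And>w. w \<in> unstab P \<Longrightarrow> symp w z = 0" for z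
    proof -
      have "symp v (emb z) = 0" if "v \<in> P" for v
        using z[of "unemb v"] real_coordinate(2)[OF that] by (simp add: symp_option unstab_def)
      then have "emb z \<in> P" by (rule lagrangian_maximal[OF P])
      then show ?thesis by (simp add: unstab_def)
    qed
  qed
qed

lemma closest_point_unstab: "closest_point (unstab P) z = unemb (closest_point P (emb z))"
proof (rule closest_point_subspace_eq)
  note sP = lagrangian_subspace[OF P]
  show "subspace (unstab P)" using lagrangian_unstab lagrangian_subspace by blast
  let ?p = "closest_point P (emb z)"
  show "unemb ?p \<in> unstab P"
    using real_coordinate(2) closest_point_mem[OF sP] by (simp add: unstab_def)
  fix w assume "w \<in> unstab P"
  then have "(emb z - ?p) \<bullet> emb w = 0" by (intro closest_point_perp[OF sP]) (simp add: unstab_def)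
  then show "(z - unemb ?p) \<bullet> w = 0" by (simp add: inner_option)
qed

end

lemma lagc_unstab:
  assumes P: "lagc S P" and e: "\<And>q. q \<in> S \<Longrightarrow> e0 \<in> P q"
  shows "lagc S (\<lambda>q. unstab (P q))"
proof -
  have "continuous_on S (\<lambda>q. closest_point (unstab (P q)) z)" for z
  proof (rule continuous_on_eq)
    show "continuous_on S (\<lambda>q. unemb (closest_point (P q) (emb z)))"
      using P by (intro continuous_intros) (auto simp: lagc_def)
    show "unemb (closest_point (P q) (emb z)) = closest_point (unstab (P q)) z"
      if "q \<in> S" for q using P e that by (simp add: closest_point_unstab lagc_def)
  qed
  then show ?thesis using P e by (auto simp: lagc_def lagrangian_unstab)
qed

text \<open>The complex analogue of the rotation taking \<open>a\<close> to \<open>b\<close>; it depends continuously on the unit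
  vectors \<open>a\<close> and \<open>b\<close> as long as they are not antipodal.\<close>

definition rot :: "complex^'n \<Rightarrow> complex^'n \<Rightarrow> complex^'n \<Rightarrow> complex^'n" where
  "rot a b v = v - (herm (a + b) v / (1 + herm b a)) *s (a + b) + (2 * herm a v) *s b"

text \<open>For unit vectors, real part -1 is the equality case of Cauchy-Schwarz. The quantity is
  the denominator in \<open>rot\<close>.\<close>

lemma herm_neq_minus_one:
  assumes "norm a = 1" "norm b = 1" "a \<noteq> - b" shows "1 + herm b a \<noteq> 0"
proof
  assume "1 + herm b a = 0"
  then have "Re (herm b a) = - 1" by (simp add: complex_eq_iff add_eq_0_iff)
  then have "b \<bullet> a = - 1" by (simp add: Re_herm)
  then have "(a + b) \<bullet> (a + b) = 0"
    unfolding inner_add_left inner_add_right using assms by (simp add: inner_commute dot_square_norm)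
  then show False using assms(3) by (simp add: add_eq_0_iff2)
qed

lemma rot_self:
  assumes "norm a = 1" shows "rot a a v = v"
proof -
  have "herm (a + a) v / (1 + herm a a) = herm a v"
    unfolding herm_add_left herm_norm1[OF assms] by simp
  then show ?thesis unfolding rot_def by (simp only:) (simp add: vec_eq_iff)
qed

text \<open>Vectors orthogonal to both a and b are fixed, so only the components along a and b enter
  the computation.\<close>

lemma rot_uni:
  assumes a: "norm a = 1" and b: "norm b = 1" and ab: "a \<noteq> - b" shows "uni (rot a b)" "rot a b a = b"
proof -
  define z where "z = herm a b"
  have k: "1 + cnj z \<noteq> 0" using herm_neq_minus_one[OF assms] by (simp add: z_def herm_cnj)
  then have k': "1 + z \<noteq> 0" by (metis complex_cnj_add complex_cnj_cnj complex_cnj_one complex_cnj_zero)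
  have h: "herm a a = 1" "herm b b = 1" "herm a b = z" "herm b a = cnj z"
    using a b by (auto simp: herm_norm1 z_def herm_cnj)
  show "rot a b a = b"
    using k by (simp add: rot_def h herm_simps vec_eq_iff)
  show "uni (rot a b)" unfolding uni_def
  proof (intro conjI allI)
    show "rot a b (v + w) = rot a b v + rot a b w" for v w
      by (simp add: rot_def herm_simps vec_eq_iff add_divide_distrib algebra_simps)
    show "rot a b (c *s v) = c *s rot a b v" for c v
      by (simp add: rot_def herm_simps vec_eq_iff algebra_simps)
    fix v w
    define p q r s where "p = herm a v" and "q = herm b v" and "r = herm a w" and "s = herm b w"
    \<comment> \<open>A and B are the coefficients of a + b in the two images. Eliminating s and q
      through them removes all denominators, and what is left is polynomial algebra.\<close>
    define A where "A = herm (a + b) w / (1 + herm b a)"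
    define B where "B = herm (a + b) v / (1 + herm b a)"
    have c: "herm v a = cnj p" "herm v b = cnj q" by (simp_all add: p_def q_def herm_cnj)
    have AB: "r + s = A * (1 + cnj z)" "p + q = B * (1 + cnj z)"
      using k by (simp_all add: A_def B_def h herm_simps p_def q_def r_def s_def)
    have e: "rot a b v = v - B *s (a + b) + (2 * p) *s b" "rot a b w = w - A *s (a + b) + (2 * r) *s b"
      by (simp_all add: rot_def A_def B_def p_def r_def)
    have s: "s = A * (1 + cnj z) - r" and q: "cnj q = cnj B * (1 + z) - cnj p"
      using AB(1) arg_cong[OF AB(2), of cnj] by (auto simp: algebra_simps)
    have "herm (rot a b v) (rot a b w) = herm v w - A * (cnj p + cnj q) + 2 * r * cnj q
       - cnj B * (r + s) + A * cnj B * (2 + z + cnj z)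
       - 2 * r * cnj B * (z + 1) + 2 * cnj p * s - 2 * A * cnj p * (cnj z + 1) + 4 * cnj p * r"
      unfolding e by (simp add: herm_simps h c flip: p_def q_def r_def s_def) (simp add: algebra_simps)
    also have "\<dots> = herm v w" unfolding q s by (simp add: algebra_simps)
    finally show "herm (rot a b v) (rot a b w) = herm v w" .
  qed
qed

lemma rot_unic:
  assumes "continuous_on S a" "continuous_on S b"
    "\<And>x. x \<in> S \<Longrightarrow> norm (a x) = 1" "\<And>x. x \<in> S \<Longrightarrow> norm (b x) = 1" "\<And>x. x \<in> S \<Longrightarrow> a x \<noteq> - b x"
  shows "unic S (\<lambda>x. rot (a x) (b x))"
  unfolding unic_def
proof (intro conjI ballI allI)
  show "uni (rot (a x) (b x))" if "x \<in> S" for x using assms that by (intro rot_uni) auto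
  have "1 + herm (b x) (a x) \<noteq> 0" if "x \<in> S" for x
    using assms that by (intro herm_neq_minus_one) auto
  then show "continuous_on S (\<lambda>x. rot (a x) (b x) z)" for z
    unfolding rot_def by (intro continuous_intros assms) auto
qed

text \<open>A continuous family N of unitary maps moves the vectors g to \<open>e0\<close>;
  afterwards the planes contain \<open>e0\<close> and can be cut down by \<open>unstab\<close>.
  Since N is the identity wherever g is already \<open>e0\<close>, planes given there as
  stabilizations return unchanged, which preserves ends and boundary values.\<close>

lemma destabilize_homotopy:
  fixes P :: "real \<times> (real^'n) \<Rightarrow> (complex^('n::finite option)) set"
  defines "S \<equiv> {0..1::real} \<times> cball (0::real^'n) 1"
  assumes P: "lagc S P" and g: "continuous_on S g" and gP: "\<And>x. x \<in> S \<Longrightarrow> g x \<in> P x \<and> norm (g x) = 1"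
  obtains Q where "lagc S Q" "\<And>x A. x \<in> S \<Longrightarrow> P x = stab A \<Longrightarrow> g x = e0 \<Longrightarrow> Q x = A"
proof -
  have dim: "DIM(real \<times> (real^'n)) + 1 < DIM(complex^('n::finite option))"
  proof -
    \<comment> \<open>The count reads n + 2 < 2 (n + 1), which is where n >= 1 enters.\<close>
    have "CARD('n) > 0" by simp
    then show ?thesis by (simp add: card_UNIV_option)
  qed
  have S: "compact S" by (simp add: S_def compact_Times)
  obtain g' b where g': "continuous_on S g'" "\<And>x. x \<in> S \<Longrightarrow> norm (g' x) = 1" "norm b = 1" "b \<noteq> e0"
    "\<And>x. x \<in> S \<Longrightarrow> g' x \<noteq> b" "\<And>x. x \<in> S \<Longrightarrow> g' x \<noteq> - g x" "\<And>x. x \<in> S \<Longrightarrow> g x = e0 \<Longrightarrow> g' x = e0"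
    using avoid_sphere_point[OF S g _ norm_e0 dim] gP by blast
  have gn: "g x \<noteq> - g' x" if "x \<in> S" for x using g'(6)[OF that] by (metis minus_minus)
  have u1: "unic S (\<lambda>x. rot (g x) (g' x))"
    using g' gP by (intro rot_unic g) (auto simp: gn)
  have u2: "unic S (\<lambda>x. rot (g' x) (- b))"
    using g' by (intro rot_unic) (auto intro!: continuous_intros)
  have r0: "uni (rot e0 (- b))" "rot e0 (- b) e0 = - b" using g' by (auto intro: rot_uni)
  then have u3: "unic S (\<lambda>x. inv (rot e0 (- b)))" by (simp add: unic_def uni_inv)
  \<comment> \<open>From g to g', on to the fixed vector -b, which is nowhere antipodal to g', and
    back to \<open>e0\<close> by a constant map. Where g and g' equal \<open>e0\<close>, the last
    two factors cancel.\<close>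
  define N where "N = (\<lambda>x v. inv (rot e0 (- b)) (rot (g' x) (- b) (rot (g x) (g' x) v)))"
  have uN: "unic S N" using unic_comp[OF u3 unic_comp[OF u2 u1]] by (simp add: N_def[abs_def])
  have N_e0: "N x (g x) = e0" if "x \<in> S" for x
  proof -
    have "rot (g x) (g' x) (g x) = g' x" using g' gP that by (intro rot_uni) (auto simp: gn)
    moreover have "rot (g' x) (- b) (g' x) = - b" using g' that by (intro rot_uni) auto
    ultimately show ?thesis using r0 uni_inj[OF r0(1)] by (simp add: N_def inv_f_eq)
  qed
  have N_id: "N x v = v" if "x \<in> S" "g x = e0" for x v
    using that g' uni_inj[OF r0(1)] by (simp add: N_def rot_self)
  show ?thesis
  proof (rule that[of "\<lambda>x. unstab (N x ` P x)"])
    show "lagc S (\<lambda>x. unstab (N x ` P x))"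
    proof (rule lagc_unstab[OF lagc_unic[OF uN P]])
      show "e0 \<in> N x ` P x" if "x \<in> S" for x using N_e0[OF that] gP[OF that] by (metis image_eqI)
    qed
    show "unstab (N x ` P x) = A" if "x \<in> S" "P x = stab A" "g x = e0" for x A
      using N_id[OF that(1,3)] by (simp add: that unstab_stab)
  qed
qed

lemma lagrangian_subset_eq: "lagrangian A \<Longrightarrow> lagrangian B \<Longrightarrow> A \<subseteq> B \<Longrightarrow> A = B"
  using lagrangian_isotropic lagrangian_maximal by (metis subset_antisym subsetD subsetI)

section \<open>Coordinates on the base plane and rank-one phases\<close>

lemma cvec_nth [simp]: "cvec a b $ j = Complex (a $ j) (b $ j)"
  by (simp add: cvec_def)

lemma iR_iff: "z \<in> iR \<longleftrightarrow> (\<forall>j. Re (z $ j) = 0)"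
proof
  assume "\<forall>j. Re (z $ j) = 0"
  then have "z = cvec 0 (\<chi> j. Im (z $ j))" by (simp add: vec_eq_iff complex_eq_iff)
  then show "z \<in> iR" unfolding iR_def by (rule range_eqI)
qed (auto simp: iR_def)

lemma herm_rv: "herm (cvec x 0) (cvec a b) = Complex (x \<bullet> a) (x \<bullet> b)"
  by (simp add: herm_def complex_eq_iff inner_vec_def)

lemma norm_rv [simp]: "norm (cvec x 0) = norm x"
proof -
  have "cvec x 0 \<bullet> cvec x 0 = x \<bullet> x" using herm_rv[of x x 0] by (simp flip: Re_herm)
  then show ?thesis by (simp add: norm_eq_sqrt_inner)
qed

lemma lagrangian_iR: "lagrangian (iR :: (complex^'n) set)"
proof (rule lagrangianI)
  show "subspace iR" by (auto simp: subspace_def iR_iff)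
  show "symp z w = 0" if "z \<in> iR" "w \<in> iR" for z w :: "complex^'n"
    using that by (simp add: symp_def iR_iff)
  show "z \<in> iR" if "\<And>w. w \<in> iR \<Longrightarrow> symp w z = 0" for z :: "complex^'n"
    unfolding iR_iff
  proof
    fix j
    have "symp (\<i> *s axis j 1) z = 0" by (rule that) (auto simp: iR_iff axis_def)
    then show "Re (z $ j) = 0" by (simp add: herm_simps herm_axis flip: Im_herm)
  qed
qed

lemma continuous_on_cvec [continuous_intros]:
  assumes "continuous_on S f" "continuous_on S g"
  shows "continuous_on S (\<lambda>x. cvec (f x) (g x))"
  unfolding cvec_def by (intro continuous_intros assms)

text \<open>For a unit vector u: multiplication by e^(i \<theta>) on the complex line of u, the
  identity on its orthogonal complement.\<close>

definition phase :: "complex^'n \<Rightarrow> real \<Rightarrow> complex^'n \<Rightarrow> complex^'n" where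
  "phase u \<theta> v = v + ((cis \<theta> - 1) * herm u v) *s u"

lemma phase_uni: assumes "norm u = 1" shows "uni (phase u \<theta>)"
  unfolding uni_def
proof (intro conjI allI)
  show "phase u \<theta> (v + w) = phase u \<theta> v + phase u \<theta> w" for v w
    by (simp add: phase_def herm_simps vec_eq_iff algebra_simps)
  show "phase u \<theta> (c *s v) = c *s phase u \<theta> v" for c v
    by (simp add: phase_def herm_simps vec_eq_iff algebra_simps)
  fix v w
  define c where "c = cis \<theta>"
  have c: "c * cnj c = 1" by (simp add: c_def cis_cnj cis_mult)
  have "herm (phase u \<theta> v) (phase u \<theta> w) = herm v w + (c * cnj c - 1) * (cnj (herm u v) * herm u w)"
    by (simp add: phase_def herm_simps herm_norm1[OF assms] herm_cnj flip: c_def) (simp add: algebra_simps)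
  then show "herm (phase u \<theta> v) (phase u \<theta> w) = herm v w" by (simp add: c)
qed

lemma phase_zero [simp]: "phase u 0 v = v"
  by (simp add: phase_def)

lemma phase_unic:
  assumes "continuous_on S u" "continuous_on S \<theta>" "\<And>x. x \<in> S \<Longrightarrow> norm (u x) = 1"
  shows "unic S (\<lambda>x. phase (u x) (\<theta> x))"
  unfolding unic_def
proof (intro conjI ballI allI)
  show "continuous_on S (\<lambda>x. phase (u x) (\<theta> x) z)" for z
    unfolding phase_def cis_conv_exp by (intro continuous_intros assms)
qed (use assms phase_uni in auto)

lemma lagrangian_image_eq:
  assumes "uni U" "lagrangian P" "lagrangian Q" "\<And>z. z \<in> P \<Longrightarrow> U z \<in> Q" shows "U ` P = Q"
  using assms by (intro lagrangian_subset_eq lagrangian_image) auto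

abbreviation Q0 :: "(complex^('n::finite option)) set" where "Q0 \<equiv> stab iR"

text \<open>An isometry of R x R^n onto the base plane, through which unit vectors of
  \<open>Q0\<close> become points of the n-sphere.\<close>

definition iota :: "real \<times> (real^'n) \<Rightarrow> complex^('n::finite option)" where
  "iota p = fst p *\<^sub>R e0 + emb (cvec 0 (snd p))"

lemma iota_nth [simp]: "iota p $ None = of_real (fst p)" "iota p $ Some j = Complex 0 (snd p $ j)"
  by (simp_all add: iota_def) (simp add: complex_eq_iff)

lemma iota_linear: "iota (p + q) = iota p + iota q" "iota (r *\<^sub>R p) = r *\<^sub>R iota p"
  by (simp_all add: vec_option_eq_iff complex_eq_iff)

lemma lagrangian_Q0: "lagrangian Q0"
  by (intro lagrangian_stab lagrangian_iR)

lemma iota_in_Q0 [simp]: "iota p \<in> Q0"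
  by (simp add: stab_iff iR_iff)

lemma Q0_iota: assumes "v \<in> Q0" shows "v = iota (Re (v $ None), \<chi> j. Im (v $ Some j))"
  using assms by (auto simp: stab_iff iR_iff vec_option_eq_iff complex_eq_iff complex_is_Real_iff)

lemma norm_iota [simp]: "norm (iota p) = norm p"
proof -
  have "iota p \<bullet> iota p = p \<bullet> p"
    by (simp add: inner_option inner_prod_def) (simp add: inner_vec_def inner_complex_def)
  then show ?thesis by (simp add: norm_eq_sqrt_inner)
qed

lemma continuous_on_iota [continuous_intros]: "continuous_on S f \<Longrightarrow> continuous_on S (\<lambda>x. iota (f x))"
  unfolding iota_def by (intro continuous_intros)

lemma iota_e0: "iota (1, 0) = e0"
  by (simp add: vec_option_eq_iff complex_eq_iff)

section \<open>Transport of a vector along moving planes\<close>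

text \<open>Over a sufficiently short time step, projecting a unit vector to the moved plane cannot
  annihilate it, and finitely many steps cover the unit interval. Where the planes stand still, so
  does the vector; this gives the last conclusion, on which the boundary values depend.\<close>

lemma transport_in_lagrangians:
  fixes F :: "real \<times> 'a::metric_space \<Rightarrow> (complex^'n) set"
  assumes D: "compact D" and F: "lagc ({0..1} \<times> D) F"
    and v: "continuous_on D v" "\<And>y. y \<in> D \<Longrightarrow> v y \<in> F (0, y) \<and> norm (v y) = 1"
  obtains s where "continuous_on ({0..1} \<times> D) s"
    "\<And>x. x \<in> {0..1} \<times> D \<Longrightarrow> s x \<in> F x \<and> norm (s x) = 1"
    "\<And>y. y \<in> D \<Longrightarrow> s (0, y) = v y"
    "\<And>t y. t \<in> {0..1} \<Longrightarrow> y \<in> D \<Longrightarrow> (\<And>t'. t' \<in> {0..1} \<Longrightarrow> F (t', y) = F (0, y)) \<Longrightarrow> s (t, y) = v y"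
proof -
  let ?X = "({0..1::real} \<times> D) \<times> sphere (0::complex^'n) 1"
  have sub: "subspace (F (t, y))" if "t \<in> {0..1}" "y \<in> D" for t y
    using F that by (auto simp: lagc_def lagrangian_subspace)
  have "continuous_on ?X (\<lambda>x. closest_point (F (fst x)) (snd x))"
    by (intro lagc_closest_point lagc_compose[OF F] continuous_intros) auto
  \<comment> \<open>Uniformity is taken jointly over time, base point and unit vector, so one step
    length serves all of them.\<close>
  then have "uniformly_continuous_on ?X (\<lambda>x. closest_point (F (fst x)) (snd x))"
    by (intro compact_uniformly_continuous compact_Times D) auto
  then obtain d where d: "d > 0" "\<And>x x'. x \<in> ?X \<Longrightarrow> x' \<in> ?X \<Longrightarrow> dist x' x < d \<Longrightarrow>
      dist (closest_point (F (fst x')) (snd x')) (closest_point (F (fst x)) (snd x)) < 1/2"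
    unfolding uniformly_continuous_on_def by (metis half_gt_zero_iff zero_less_one)
  have near: "closest_point (F (t, y)) w \<noteq> 0"
    if "t \<in> {0..1}" "t' \<in> {0..1}" "\<bar>t - t'\<bar> < d" "y \<in> D" "w \<in> F (t', y)" "norm w = 1" for t t' y w
  proof -
    have "closest_point (F (t', y)) w = w" using closest_point_self that(5) by metis
    moreover have "dist ((t, y), w) ((t', y), w) < d" using that by (simp add: dist_Pair_Pair dist_real_def)
    ultimately have "dist (closest_point (F (t, y)) w) w < 1/2"
      using d(2)[of "((t', y), w)" "((t, y), w)"] that by simp
    then show ?thesis using that by auto
  qed
  obtain N :: nat where N: "N > 0" "1 / real N < d"
    using d(1) by (metis reals_Archimedean inverse_eq_divide of_nat_0_less_iff zero_less_Suc)
  let ?P = "\<lambda>a s. continuous_on ({0..a} \<times> D) s \<and>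
    (\<forall>t\<in>{0..a}. \<forall>y\<in>D. s (t, y) \<in> F (t, y) \<and> norm (s (t, y)) = 1) \<and> (\<forall>y\<in>D. s (0, y) = v y) \<and>
    (\<forall>t\<in>{0..a}. \<forall>y\<in>D. (\<forall>t'\<in>{0..1}. F (t', y) = F (0, y)) \<longrightarrow> s (t, y) = v y)"
  have "\<exists>s. ?P (real k / real N) s" if "k \<le> N" for k
    using that
  proof (induction k)
    case 0
    have "continuous_on ({0..0} \<times> D) (\<lambda>x::real \<times> 'a. v (snd x))"
      by (intro continuous_on_compose2[OF v(1)] continuous_intros) auto
    then show ?case using v by (intro exI[of _ "\<lambda>x. v (snd x)"]) auto
  next
    case (Suc k)
    define a b where "a = real k / real N" and "b = real (Suc k) / real N"
    have ab: "0 \<le> a" "a \<le> b" "b \<le> 1" "b - a < d"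
      using Suc.prems N by (auto simp: a_def b_def divide_right_mono diff_divide_distrib[symmetric])
    have "k \<le> N" using Suc.prems by simp
    then obtain s where s: "?P a s" using Suc.IH unfolding a_def by blast
    then have sc: "continuous_on ({0..a} \<times> D) s" and sF: "\<And>t y. t \<in> {0..a} \<Longrightarrow> y \<in> D \<Longrightarrow> s (t, y) \<in> F (t, y)"
      and s1: "\<And>t y. t \<in> {0..a} \<Longrightarrow> y \<in> D \<Longrightarrow> norm (s (t, y)) = 1" and s0: "\<And>y. y \<in> D \<Longrightarrow> s (0, y) = v y"
      and sv: "\<And>t y. t \<in> {0..a} \<Longrightarrow> y \<in> D \<Longrightarrow> \<forall>t'\<in>{0..1}. F (t', y) = F (0, y) \<Longrightarrow> s (t, y) = v y"
      by blast+
    \<comment> \<open>Throughout the step the vector reached at time a is projected, so every step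
      is a single closed formula.\<close>
    define r where "r = (\<lambda>(t, y). sgn (closest_point (F (t, y)) (s (a, y))))"
    define s' where "s' = (\<lambda>(t, y). if t \<le> a then s (t, y) else r (t, y))"
    have sa: "s (a, y) \<in> F (a, y)" "norm (s (a, y)) = 1" if "y \<in> D" for y
      using sF s1 that ab by auto
    have nz: "closest_point (F (t, y)) (s (a, y)) \<noteq> 0" if "t \<in> {a..b}" "y \<in> D" for t y
      by (rule near[of t a]) (use that ab sa in auto)
    have ra: "r (a, y) = s (a, y)" if "y \<in> D" for y
      using sa[OF that] by (simp add: r_def closest_point_self sgn_div_norm)
    have s'r: "s' (t, y) = r (t, y)" if "t \<in> {a..b}" "y \<in> D" for t y
      using that ra by (auto simp: s'_def)
    have split: "{0..b} \<times> D = {0..a} \<times> D \<union> {a..b} \<times> D" using ab by auto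
    have csa: "continuous_on ({a..b} \<times> D) (\<lambda>x. s (a, snd x))"
      by (rule continuous_on_compose2[OF sc]) (use ab in \<open>auto intro!: continuous_intros\<close>)
    have "continuous_on ({a..b} \<times> D) (\<lambda>x. closest_point (F x) (s (a, snd x)))"
      using ab by (intro lagc_closest_point csa lagc_subset[OF F]) auto
    then have "continuous_on ({a..b} \<times> D) r"
      unfolding r_def sgn_div_norm case_prod_beta
      by (intro continuous_intros) (use nz in \<open>auto simp: split_beta\<close>)
    then have c2: "continuous_on ({a..b} \<times> D) s'"
      by (rule continuous_on_eq) (use s'r in auto)
    have c1: "continuous_on ({0..a} \<times> D) s'"
      by (rule continuous_on_eq[OF sc]) (auto simp: s'_def)
    have "continuous_on ({0..b} \<times> D) s'"
      unfolding split
    proof (rule continuous_on_closed_Un[OF _ _ c1 c2])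
      show "closed ({0..a} \<times> D)" "closed ({a..b} \<times> D)"
        using compact_imp_closed[OF D] by (auto intro: closed_Times)
    qed
    moreover have "s' (t, y) \<in> F (t, y) \<and> norm (s' (t, y)) = 1" if "t \<in> {0..b}" "y \<in> D" for t y
    proof (cases "t \<le> a")
      case False
      then have t: "t \<in> {a..b}" using that by auto
      have sp: "subspace (F (t, y))" using that ab by (intro sub) auto
      have "r (t, y) \<in> F (t, y)" unfolding r_def sgn_div_norm case_prod_conv
        by (intro subspace_mul sp closest_point_mem)
      then show ?thesis using s'r[OF t that(2)] nz[OF t that(2)] by (simp add: r_def norm_sgn)
    qed (use sF s1 that in \<open>auto simp: s'_def\<close>)
    moreover have "s' (t, y) = v y" if "t \<in> {0..b}" "y \<in> D" "\<forall>t'\<in>{0..1}. F (t', y) = F (0, y)" for t y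
    proof (cases "t \<le> a")
      case False
      then have t: "t \<in> {a..b}" using that by auto
      have "F (t, y) = F (a, y)" using that ab t by (metis atLeastAtMost_iff order_trans)
      then have "r (t, y) = r (a, y)" by (simp add: r_def)
      moreover have "s (a, y) = v y" by (rule sv[OF _ that(2,3)]) (use ab in simp)
      ultimately show ?thesis using s'r[OF t that(2)] ra[OF that(2)] by simp
    next
      case True
      then show ?thesis using sv[OF _ that(2,3), of t] that(1) by (simp add: s'_def)
    qed
    moreover have "s' (0, y) = v y" if "y \<in> D" for y
      using s0 that ab by (auto simp: s'_def)
    ultimately show ?case unfolding b_def[symmetric] by (intro exI[of _ s'] conjI ballI impI) blast+
  qed
  from this[of N] have "\<exists>s. ?P 1 s" using N(1) by simp
  then obtain s where s: "?P 1 s" by blast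
  show ?thesis
  proof (rule that[of s])
    show "continuous_on ({0..1} \<times> D) s" using s by blast
    show "s x \<in> F x \<and> norm (s x) = 1" if "x \<in> {0..1} \<times> D" for x using s that by (cases x) blast
    show "s (0, y) = v y" if "y \<in> D" for y using s that by blast
    show "s (t, y) = v y" if "t \<in> {0..1}" "y \<in> D" "\<And>t'. t' \<in> {0..1} \<Longrightarrow> F (t', y) = F (0, y)" for t y
      using s that by blast
  qed
qed

section \<open>Kinks and destabilization\<close>

text \<open>Homotopy of pairs, a Lagrangian with a unit vector in it, over the disc and relative to
  its boundary. Keeping track of the vector is what permits destabilization once it is
  \<open>e0\<close> at both ends.\<close>

definition ehom :: "(real^'n \<Rightarrow> (complex^('n::finite option)) set) \<Rightarrow> (real^'n \<Rightarrow> complex^('n option)) \<Rightarrow>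
    (real^'n \<Rightarrow> (complex^('n option)) set) \<Rightarrow> (real^'n \<Rightarrow> complex^('n option)) \<Rightarrow> bool" where
  "ehom P0 g0 P1 g1 \<longleftrightarrow> (\<exists>P g. lagc ({0..1::real} \<times> cball 0 1) P \<and> continuous_on ({0..1} \<times> cball 0 1) g \<and>
     (\<forall>x\<in>{0..1} \<times> cball 0 1. g x \<in> P x \<and> norm (g x) = 1) \<and>
     (\<forall>y\<in>cball 0 1. P (0, y) = P0 y \<and> g (0, y) = g0 y \<and> P (1, y) = P1 y \<and> g (1, y) = g1 y) \<and>
     (\<forall>t\<in>{0..1}. \<forall>y. norm y = 1 \<longrightarrow> P (t, y) = Q0 \<and> g (t, y) = e0))"

lemma ehom_trans:
  assumes "ehom P0 g0 P1 g1" "ehom P1 g1 P2 g2" shows "ehom P0 g0 P2 g2"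
proof -
  let ?D = "cball (0::real^'n) 1"
  obtain P g where 1: "lagc ({0..1::real} \<times> ?D) P" "continuous_on ({0..1} \<times> ?D) g"
     "\<And>x. x \<in> {0..1} \<times> ?D \<Longrightarrow> g x \<in> P x \<and> norm (g x) = 1"
     "\<And>y. y \<in> ?D \<Longrightarrow> P (0, y) = P0 y \<and> g (0, y) = g0 y \<and> P (1, y) = P1 y \<and> g (1, y) = g1 y"
     "\<And>t y. t \<in> {0..1} \<Longrightarrow> norm y = 1 \<Longrightarrow> P (t, y) = Q0 \<and> g (t, y) = e0"
    using assms(1) unfolding ehom_def by blast
  obtain P' g' where 2: "lagc ({0..1::real} \<times> ?D) P'" "continuous_on ({0..1} \<times> ?D) g'"
     "\<And>x. x \<in> {0..1} \<times> ?D \<Longrightarrow> g' x \<in> P' x \<and> norm (g' x) = 1"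
     "\<And>y. y \<in> ?D \<Longrightarrow> P' (0, y) = P1 y \<and> g' (0, y) = g1 y \<and> P' (1, y) = P2 y \<and> g' (1, y) = g2 y"
     "\<And>t y. t \<in> {0..1} \<Longrightarrow> norm y = 1 \<Longrightarrow> P' (t, y) = Q0 \<and> g' (t, y) = e0"
    using assms(2) unfolding ehom_def by blast
  define R where "R = (\<lambda>(t::real, y). if t \<le> 1/2 then P (2 * t, y) else P' (2 * t - 1, y))"
  define h where "h = (\<lambda>(t::real, y). if t \<le> 1/2 then g (2 * t, y) else g' (2 * t - 1, y))"
  let ?A = "{0..1/2::real} \<times> ?D" and ?B = "{1/2..1::real} \<times> ?D"
  have U: "{0..1::real} \<times> ?D = ?A \<union> ?B" by auto
  have cl: "closed ?A" "closed ?B" by (auto intro: closed_Times)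
  have eqA: "R x = P (2 * fst x, snd x)" "h x = g (2 * fst x, snd x)" if "x \<in> ?A" for x
    using that by (auto simp: R_def h_def)
  have eqB: "R x = P' (2 * fst x - 1, snd x) \<and> h x = g' (2 * fst x - 1, snd x)" if x: "x \<in> ?B" for x
  proof (cases "fst x = 1/2")
    case True
    then obtain y where y: "x = (1/2, y)" "y \<in> ?D" using x by (cases x) auto
    show ?thesis using 1(4)[OF y(2)] 2(4)[OF y(2)] by (simp add: y R_def h_def)
  next
    case False
    then show ?thesis using x by (auto simp: R_def h_def)
  qed
  have A: "lagc ?A (\<lambda>x. P (2 * fst x, snd x))" "continuous_on ?A (\<lambda>x. g (2 * fst x, snd x))"
    by (rule lagc_compose[OF 1(1)], auto intro!: continuous_intros)
      (rule continuous_on_compose2[OF 1(2)], auto intro!: continuous_intros)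
  have B: "lagc ?B (\<lambda>x. P' (2 * fst x - 1, snd x))" "continuous_on ?B (\<lambda>x. g' (2 * fst x - 1, snd x))"
    by (rule lagc_compose[OF 2(1)], auto intro!: continuous_intros)
      (rule continuous_on_compose2[OF 2(2)], auto intro!: continuous_intros)
  have "lagc ?A R" by (rule iffD2[OF lagc_cong A(1)]) (rule eqA(1))
  moreover have "lagc ?B R" by (rule iffD2[OF lagc_cong B(1)]) (rule eqB[THEN conjunct1])
  ultimately have "lagc (?A \<union> ?B) R" by (rule lagc_closed_Un) (auto intro!: closed_subset cl)
  then have R: "lagc ({0..1} \<times> ?D) R" unfolding U .
  have "continuous_on ?A h" using A(2) by (rule continuous_on_eq) (simp add: eqA)
  moreover have "continuous_on ?B h" using B(2) by (rule continuous_on_eq) (simp add: eqB)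
  ultimately have h: "continuous_on ({0..1} \<times> ?D) h" unfolding U by (rule continuous_on_closed_Un[OF cl])
  have hR: "h x \<in> R x \<and> norm (h x) = 1" if "x \<in> {0..1} \<times> ?D" for x
  proof (cases "x \<in> ?A")
    case True
    then show ?thesis unfolding eqA[OF True] by (intro 1(3)) auto
  next
    case False
    then have "x \<in> ?B" using that by auto
    then show ?thesis using eqB[of x] 2(3)[of "(2 * fst x - 1, snd x)"] by auto
  qed
  have bd: "R (t, y) = Q0 \<and> h (t, y) = e0" if "t \<in> {0..1}" "norm y = 1" for t y
    using 1(5)[of "2 * t" y] 2(5)[of "2 * t - 1" y] that by (auto simp: R_def h_def)
  have ends: "R (0, y) = P0 y \<and> h (0, y) = g0 y \<and> R (1, y) = P2 y \<and> h (1, y) = g2 y" if "y \<in> ?D" for y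
    using 1(4)[OF that] 2(4)[OF that] by (simp add: R_def h_def)
  show ?thesis unfolding ehom_def
    by (intro exI[of _ R] exI[of _ h] conjI ballI allI impI)
      (use R h hR bd ends in blast)+
qed

text \<open>Falls linearly from pi at radius 1/3 to 0 at radius 1. The inner ball where it is
  constant keeps the radial direction, undefined at the origin, out of play.\<close>

definition ang :: "real \<Rightarrow> real" where
  "ang r = pi * max 0 (min 1 ((1 - r) * 3 / 2))"

lemma ang_eq: "r \<le> 1/3 \<Longrightarrow> ang r = pi" "r \<ge> 1 \<Longrightarrow> ang r = 0"
  by (simp_all add: ang_def)

lemma ang_range: "0 \<le> ang r" "ang r \<le> pi"
proof -
  show "0 \<le> ang r" by (simp add: ang_def)
  have "pi * max 0 (min 1 ((1 - r) * 3 / 2)) \<le> pi * 1" by (intro mult_left_mono) auto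
  then show "ang r \<le> pi" by (simp add: ang_def)
qed

lemma continuous_on_ang [continuous_intros]: "continuous_on S f \<Longrightarrow> continuous_on S (\<lambda>x. ang (f x))"
  unfolding ang_def by (intro continuous_intros) auto

text \<open>At radius 1/3 the turn is by -pi and maps \<open>iR\<close> to itself, so the two cases
  fit together.\<close>

definition kink :: "real^'n \<Rightarrow> (complex^'n) set" where
  "kink y = (if norm y \<le> 1/3 then iR else phase (cvec (y /\<^sub>R norm y) 0) (- ang (norm y)) ` iR)"

text \<open>The radius is read as polar angle on the n-sphere: everything outside the unit ball goes
  to (1, 0), the inner ball to (-1, 0).\<close>

definition swell :: "real^'n \<Rightarrow> real \<times> (real^'n)" where
  "swell y = (if norm y \<le> 1/3 then (-1, 0) else (cos (ang (norm y)), (sin (ang (norm y)) / norm y) *\<^sub>R y))"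

lemma kink_outside: "norm y \<ge> 1 \<Longrightarrow> kink y = iR"
  by (simp add: kink_def ang_eq)

definition axis2 :: "real^'n \<Rightarrow> real \<Rightarrow> real \<Rightarrow> complex^('n::finite option)" where
  "axis2 x a b = of_real a *s e0 + of_real b *s emb (cvec x 0)"

lemma axis2_nth [simp]: "axis2 x a b $ None = of_real a" "unemb (axis2 x a b) = of_real b *s cvec x 0"
  by (simp_all add: axis2_def)

lemma herm_axis2: "herm (axis2 x a b) v = a * v $ None + b * herm (cvec x 0) (unemb v)"
  by (simp add: herm_option herm_simps)

lemma norm_axis2:
  assumes "norm x = 1" "a\<^sup>2 + b\<^sup>2 = 1"
  shows "norm (axis2 x a b) = 1"
proof -
  have "herm (axis2 x a b) (axis2 x a b) = of_real (a\<^sup>2 + b\<^sup>2)"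
    using assms(1) by (simp add: herm_axis2 herm_simps herm_norm1 power2_eq_square)
  then have "(norm (axis2 x a b))\<^sup>2 = 1"
    using assms(2) unfolding herm_self of_real_eq_iff by simp
  then show ?thesis by (simp add: power2_eq_1_iff) (metis norm_ge_zero not_one_le_zero neg_0_le_iff_le)
qed

text \<open>In the complex plane of \<open>e0\<close> and x these are opposite phases on an
  orthonormal pair of axes turned by \<alpha>. For \<alpha> = pi/4 the matrix has cos \<phi> on the
  diagonal and i sin \<phi> off it; for \<alpha> = 0 it is diagonal. Letting \<alpha> run from pi/4
  to 0 trades a motion of the vector for a motion of the plane.\<close>

definition twist :: "real^'n \<Rightarrow> real \<Rightarrow> real \<Rightarrow> real \<Rightarrow> complex^('n::finite option) \<Rightarrow> complex^('n option)" where
  "twist x \<alpha> \<phi> \<theta> v = phase e0 \<theta>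
     (phase (axis2 x (cos \<alpha>) (sin \<alpha>)) \<phi> (phase (axis2 x (- sin \<alpha>) (cos \<alpha>)) (- \<phi>) v))"

lemma twist_uni: assumes "norm x = 1" shows "uni (twist x \<alpha> \<phi> \<theta>)"
proof -
  have 1: "uni (phase (axis2 x (cos \<alpha>) (sin \<alpha>)) \<phi>)" and 2: "uni (phase (axis2 x (- sin \<alpha>) (cos \<alpha>)) (- \<phi>))"
    by (intro phase_uni norm_axis2 assms; simp)+
  from uni_comp[OF phase_uni[OF norm_e0] uni_comp[OF 1 2]] show ?thesis by (simp add: twist_def[abs_def])
qed

lemma twist_iota:
  fixes a \<alpha> :: real and \<sigma> :: "real^'n"
  assumes "norm x = 1"
  defines "c \<equiv> complex_of_real (cos \<alpha>)" and "s \<equiv> complex_of_real (sin \<alpha>)" and "m \<equiv> \<i> * complex_of_real (x \<bullet> \<sigma>)"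
  shows "twist x \<alpha> \<phi> 0 (iota (a, \<sigma>)) = iota (a, \<sigma>)
     + ((cis \<phi> - 1) * (c * a + s * m) * c - (cis (- \<phi>) - 1) * (c * m - s * a) * s) *s e0
     + ((cis \<phi> - 1) * (c * a + s * m) * s + (cis (- \<phi>) - 1) * (c * m - s * a) * c) *s emb (cvec x 0)"
proof -
  have u: "unemb (iota (a, \<sigma>)) = cvec 0 \<sigma>" by (simp add: vec_eq_iff)
  have h: "herm (cvec x 0) (cvec 0 \<sigma>) = m" by (simp add: herm_rv m_def complex_eq_iff)
  have "herm (axis2 x (cos \<alpha>) (sin \<alpha>)) (axis2 x (- sin \<alpha>) (cos \<alpha>)) = 0"
    using assms(1) by (simp add: herm_axis2 herm_simps herm_norm1)
  moreover have "herm (axis2 x (cos \<alpha>) (sin \<alpha>)) (iota (a, \<sigma>)) = c * a + s * m"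
     "herm (axis2 x (- sin \<alpha>) (cos \<alpha>)) (iota (a, \<sigma>)) = c * m - s * a"
    by (simp_all add: herm_axis2 u h c_def s_def)
  ultimately show ?thesis
    by (simp add: twist_def phase_def herm_simps) (simp add: axis2_def vec_eq_iff c_def s_def algebra_simps)
qed

lemma iota_add_axes:
  "iota (a, \<sigma>) + complex_of_real p *s e0 + (\<i> * complex_of_real q) *s emb (cvec x 0) = iota (a + p, \<sigma> + q *\<^sub>R x)"
  by (simp add: vec_option_eq_iff complex_eq_iff)

text \<open>At \<alpha> = pi/4 the map rotates the real plane of \<open>e0\<close> and i x, which
  lies in \<open>Q0\<close>. So the Lagrangian stays fixed while \<open>e0\<close> runs through the
  polar angle \<phi>.\<close>

lemma twist_iota_start:
  assumes "norm x = 1"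
  shows "twist x (pi/4) \<phi> 0 (iota (a, \<sigma>)) =
    iota (cos \<phi> * a - sin \<phi> * (x \<bullet> \<sigma>), \<sigma> + ((cos \<phi> - 1) * (x \<bullet> \<sigma>) + sin \<phi> * a) *\<^sub>R x)"
proof -
  define k where "k = sqrt 2 / 2"
  define m where "m = x \<bullet> \<sigma>"
  have k2: "k * k = 1/2" and k2': "k * (k * z) = z / 2" for z by (simp_all add: k_def)
  have 1: "(cis \<phi> - 1) * (complex_of_real k * complex_of_real a + complex_of_real k * (\<i> * complex_of_real m)) * complex_of_real k - (cis (- \<phi>) - 1) * (complex_of_real k * (\<i> * complex_of_real m) - complex_of_real k * complex_of_real a) * complex_of_real k
      = complex_of_real ((cos \<phi> - 1) * a - sin \<phi> * m)"
    by (simp add: complex_eq_iff algebra_simps k2 k2')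
  have 2: "(cis \<phi> - 1) * (complex_of_real k * complex_of_real a + complex_of_real k * (\<i> * complex_of_real m)) * complex_of_real k + (cis (- \<phi>) - 1) * (complex_of_real k * (\<i> * complex_of_real m) - complex_of_real k * complex_of_real a) * complex_of_real k
      = \<i> * complex_of_real ((cos \<phi> - 1) * m + sin \<phi> * a)"
    by (simp add: complex_eq_iff algebra_simps k2 k2')
  show ?thesis
    unfolding twist_iota[OF assms] cos_45 sin_45 k_def[symmetric] m_def[symmetric] 1 2 iota_add_axes
    by (simp add: algebra_simps)
qed

text \<open>At \<phi> = pi both phases are -1, so the choice of axes is irrelevant. The images of
  \<open>Q0\<close> and of \<open>e0\<close> become independent of \<alpha> and x, which lets the
  family continue over the inner ball.\<close>

lemma twist_iota_pi:
  assumes "norm x = 1"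
  shows "twist x \<alpha> pi 0 (iota (a, \<sigma>)) = iota (- a, \<sigma> - (2 * (x \<bullet> \<sigma>)) *\<^sub>R x)"
proof -
  define c s m where "c = cos \<alpha>" and "s = sin \<alpha>" and "m = x \<bullet> \<sigma>"
  have c2: "c * c = 1 - s * s"
    using cos_squared_eq[of \<alpha>] by (simp add: c_def s_def power2_eq_square)
  then have c2': "c * (c * z) = z - s * (s * z)" for z by (metis mult.assoc left_diff_distrib mult_1)
  have 1: "(cis pi - 1) * (complex_of_real c * complex_of_real a + complex_of_real s * (\<i> * complex_of_real m)) * complex_of_real c - (cis (- pi) - 1) * (complex_of_real c * (\<i> * complex_of_real m) - complex_of_real s * complex_of_real a) * complex_of_real s
      = complex_of_real (- 2 * a)"
    by (simp add: complex_eq_iff algebra_simps c2 c2')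
  have 2: "(cis pi - 1) * (complex_of_real c * complex_of_real a + complex_of_real s * (\<i> * complex_of_real m)) * complex_of_real s + (cis (- pi) - 1) * (complex_of_real c * (\<i> * complex_of_real m) - complex_of_real s * complex_of_real a) * complex_of_real c
      = \<i> * complex_of_real (- 2 * m)"
    by (simp add: complex_eq_iff algebra_simps c2 c2')
  show ?thesis
    unfolding twist_iota[OF assms] c_def[symmetric] s_def[symmetric] m_def[symmetric] 1 2 iota_add_axes
    by simp
qed

lemma twist_theta: "twist x \<alpha> \<phi> \<theta> v = phase e0 \<theta> (twist x \<alpha> \<phi> 0 v)"
  by (simp add: twist_def)

text \<open>For \<alpha> = 0 the axes are \<open>e0\<close> and x. The additional phase on
  \<open>e0\<close> cancels the first factor and leaves the radial turn alone.\<close>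

lemma twist_end: "twist x 0 \<phi> (- \<phi>) v = phase (emb (cvec x 0)) (- \<phi>) v"
proof -
  have *: "phase e0 (- \<phi>) (phase e0 \<phi> w) = w" for w :: "complex^('a option)"
    by (simp add: phase_def herm_simps herm_e0 vec_eq_iff algebra_simps cis_mult)
  have "axis2 x 1 0 = e0" "axis2 x 0 1 = emb (cvec x 0)" by (simp_all add: axis2_def)
  then show ?thesis by (simp add: twist_def *)
qed

lemma twist_id: "twist x \<alpha> 0 0 v = v"
  by (simp add: twist_def)

lemma Q0_cases: assumes "v \<in> Q0" obtains a \<sigma> where "v = iota (a, \<sigma>)"
  using Q0_iota[OF assms] by blast

lemma twist_Q0_start: "norm x = 1 \<Longrightarrow> twist x (pi/4) \<phi> 0 ` Q0 = Q0"
  by (rule lagrangian_image_eq[OF twist_uni lagrangian_Q0 lagrangian_Q0])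
    (auto elim!: Q0_cases simp: twist_iota_start)

lemma twist_Q0_pi: "norm x = 1 \<Longrightarrow> twist x \<alpha> pi 0 ` Q0 = Q0"
  by (rule lagrangian_image_eq[OF twist_uni lagrangian_Q0 lagrangian_Q0])
    (auto elim!: Q0_cases simp: twist_iota_pi)

lemma cis_minus_pi [simp]: "cis (- pi) = - 1"
  by (simp add: complex_eq_iff)

lemma phase_e0_pi: "phase e0 (- pi) ` Q0 = Q0"
  by (rule lagrangian_image_eq[OF phase_uni lagrangian_Q0 lagrangian_Q0])
    (auto simp: phase_def stab_iff herm_e0)

lemma phase_emb_image: "norm x = 1 \<Longrightarrow> phase (emb (cvec x 0)) \<theta> ` stab P = stab (phase (cvec x 0) \<theta> ` P)"
proof -
  assume x: "norm x = 1"
  have n: "norm (emb (cvec x 0)) = 1" using norm_axis2[OF x, of 0 1] by (simp add: axis2_def)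
  have u: "unemb (phase (emb (cvec x 0)) \<theta> v) = phase (cvec x 0) \<theta> (unemb v)"
    and c: "phase (emb (cvec x 0)) \<theta> v $ None = v $ None" for v
    by (simp_all add: phase_def herm_option)
  note bij = uni_bij[OF phase_uni[OF n]] 
  show ?thesis
  proof (intro equalityI subsetI)
    fix z assume "z \<in> phase (emb (cvec x 0)) \<theta> ` stab P"
    then show "z \<in> stab (phase (cvec x 0) \<theta> ` P)" by (auto simp: stab_iff u c)
  next
    fix z assume z: "z \<in> stab (phase (cvec x 0) \<theta> ` P)"
    obtain v where v: "z = phase (emb (cvec x 0)) \<theta> v" using bij by (meson bij_pointE)
    have "inj (phase (cvec x 0) \<theta>)" using uni_inj[OF phase_uni[of "cvec x 0" \<theta>]] x by simp
    then show "z \<in> phase (emb (cvec x 0)) \<theta> ` stab P"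
      using z by (auto simp: v stab_iff u c inj_image_mem_iff)
  qed
qed

text \<open>Together with \<open>kinkv\<close>, the homotopy of pairs from the fixed plane
  \<open>Q0\<close> with vector \<open>swell\<close> to the stabilized kink with vector
  \<open>e0\<close>. The axes turn from pi/4 to 0 while a compensating phase on \<open>e0\<close>
  builds up; on the inner ball only the latter is visible.\<close>

definition kinkP :: "real \<times> (real^'n) \<Rightarrow> (complex^('n::finite option)) set" where
  "kinkP = (\<lambda>(t, y). if norm y \<le> 1/3 then phase e0 (- (t * pi)) ` Q0
     else twist (y /\<^sub>R norm y) ((1 - t) * (pi/4)) (ang (norm y)) (- (t * ang (norm y))) ` Q0)"

definition kinkv :: "real \<times> (real^'n) \<Rightarrow> complex^('n::finite option)" where
  "kinkv = (\<lambda>(t, y). if norm y \<le> 1/3 then phase e0 (- (t * pi)) (- e0)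
     else twist (y /\<^sub>R norm y) ((1 - t) * (pi/4)) (ang (norm y)) (- (t * ang (norm y))) e0)"

lemma norm_direction: "norm y \<ge> 1/3 \<Longrightarrow> norm (y /\<^sub>R norm y) = 1"
  by (cases "y = 0") auto

lemma e0_iota: "e0 = iota (1, 0)"
  by (rule iota_e0[symmetric])

lemma twist_e0_pi: "norm x = 1 \<Longrightarrow> twist x \<alpha> pi 0 e0 = - e0"
  by (simp add: e0_iota twist_iota_pi) (simp add: vec_option_eq_iff complex_eq_iff)

text \<open>The outer formula is valid on a closed region, radius 1/3 included, so the two formulas
  can be pasted along closed sets.\<close>

lemma kink_far:
  assumes "norm y \<ge> 1/3"
  shows "kinkP (t, y) = twist (y /\<^sub>R norm y) ((1 - t) * (pi/4)) (ang (norm y)) (- (t * ang (norm y))) ` Q0"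
    and "kinkv (t, y) = twist (y /\<^sub>R norm y) ((1 - t) * (pi/4)) (ang (norm y)) (- (t * ang (norm y))) e0"
proof -
  let ?tw = "twist (y /\<^sub>R norm y) ((1 - t) * (pi/4))"
  note y = norm_direction[OF assms]
  have im: "?tw pi \<theta> ` Q0 = phase e0 \<theta> ` Q0" for \<theta>
  proof -
    have "?tw pi \<theta> ` Q0 = phase e0 \<theta> ` (?tw pi 0 ` Q0)"
      unfolding image_image by (rule image_cong) (auto simp: twist_theta[of _ _ _ \<theta>])
    then show ?thesis by (simp add: twist_Q0_pi[OF y])
  qed
  have ve: "?tw pi \<theta> e0 = phase e0 \<theta> (- e0)" for \<theta>
    by (simp add: twist_theta[of _ _ _ \<theta>] twist_e0_pi[OF y])
  have "kinkP (t, y) = ?tw (ang (norm y)) (- (t * ang (norm y))) ` Q0 \<and>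
    kinkv (t, y) = ?tw (ang (norm y)) (- (t * ang (norm y))) e0"
  proof (cases "norm y = 1/3")
    case True
    then have e: "ang (norm y) = pi" by (intro ang_eq) simp
    show ?thesis unfolding e im ve using True by (simp add: kinkP_def kinkv_def)
  qed (use assms in \<open>auto simp: kinkP_def kinkv_def\<close>)
  then show "kinkP (t, y) = ?tw (ang (norm y)) (- (t * ang (norm y))) ` Q0"
    "kinkv (t, y) = ?tw (ang (norm y)) (- (t * ang (norm y))) e0" by blast+
qed

lemma kinkP_lagc: "lagc ({0..1} \<times> (UNIV :: (real^'n) set)) kinkP"
  and kinkv_cont: "continuous_on ({0..1} \<times> (UNIV :: (real^'n) set)) kinkv"
proof -
  let ?A = "{0..1::real} \<times> {y::real^'n. norm y \<le> 1/3}" and ?B = "{0..1::real} \<times> {y::real^'n. norm y \<ge> 1/3}"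
  have U: "{0..1} \<times> UNIV = ?A \<union> ?B" by auto
  have cl: "closed ?A" "closed ?B"
    by (intro closed_Times closed_Collect_le closed_atLeastAtMost continuous_intros)+
  have u1: "unic ?A (\<lambda>x. phase e0 (- (fst x * pi)) :: complex^('n option) \<Rightarrow> _)"
    by (intro phase_unic continuous_intros) auto
  have "unic ?B (\<lambda>x. phase e0 (- (fst x * ang (norm (snd x)))) :: complex^('n option) \<Rightarrow> _)"
    by (intro phase_unic continuous_intros) auto
  moreover have "unic ?B (\<lambda>x. phase (axis2 (snd x /\<^sub>R norm (snd x)) (cos ((1 - fst x) * (pi/4))) (sin ((1 - fst x) * (pi/4)))) (ang (norm (snd x))))"
    by (intro phase_unic continuous_intros norm_axis2 norm_direction) (auto simp: axis2_def intro!: continuous_intros)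
  moreover have "unic ?B (\<lambda>x. phase (axis2 (snd x /\<^sub>R norm (snd x)) (- sin ((1 - fst x) * (pi/4))) (cos ((1 - fst x) * (pi/4)))) (- ang (norm (snd x))))"
    by (intro phase_unic continuous_intros norm_axis2 norm_direction) (auto simp: axis2_def intro!: continuous_intros)
  ultimately have u2: "unic ?B (\<lambda>x. twist (snd x /\<^sub>R norm (snd x)) ((1 - fst x) * (pi/4)) (ang (norm (snd x))) (- (fst x * ang (norm (snd x)))))"
    using unic_comp[OF _ unic_comp] unfolding twist_def[abs_def] by blast
  have "lagc ?A kinkP"
    by (rule iffD2[OF lagc_cong lagc_unic[OF u1 lagc_const[OF lagrangian_Q0]]]) (auto simp: kinkP_def)
  moreover have "lagc ?B kinkP"
    by (rule iffD2[OF lagc_cong lagc_unic[OF u2 lagc_const[OF lagrangian_Q0]]]) (auto simp: kink_far)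
  ultimately show "lagc ({0..1} \<times> (UNIV :: (real^'n) set)) kinkP"
    unfolding U by (rule lagc_closed_Un) (intro closed_subset cl Un_upper1 Un_upper2)+
  have "continuous_on ?A kinkv"
    by (rule continuous_on_eq[OF unic_apply[OF u1 continuous_on_const[of _ "- e0"]]]) (auto simp: kinkv_def)
  moreover have "continuous_on ?B kinkv"
    by (rule continuous_on_eq[OF unic_apply[OF u2 continuous_on_const[of _ "e0"]]]) (auto simp: kink_far)
  ultimately show "continuous_on ({0..1} \<times> (UNIV :: (real^'n) set)) kinkv"
    unfolding U by (rule continuous_on_closed_Un[OF cl])
qed

lemma kinkv_mem: "kinkv (t, y) \<in> kinkP (t, y)" "norm (kinkv (t, y)) = 1"
proof -
  have e: "e0 \<in> Q0" "- e0 \<in> Q0" by (auto simp: stab_iff iR_iff)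
  show "kinkv (t, y) \<in> kinkP (t, y)" using e by (auto simp: kinkv_def kinkP_def)
  show "norm (kinkv (t, y)) = 1"
    by (auto simp: kinkv_def uni_norm[OF phase_uni[OF norm_e0]] uni_norm[OF twist_uni[OF norm_direction]])
qed

lemma kink_start: "kinkP (0, y) = Q0" "kinkv (0, y) = iota (swell y)"
proof -
  consider "norm y \<le> 1/3" | "norm y > 1/3" by linarith
  then have "kinkP (0, y) = Q0 \<and> kinkv (0, y) = iota (swell y)"
  proof cases
    case 1
    then have "iota (swell y) = - e0" by (simp add: swell_def vec_option_eq_iff complex_eq_iff)
    then show ?thesis using 1 by (simp add: kinkP_def kinkv_def)
  next
    case 2
    then have y: "norm (y /\<^sub>R norm y) = 1" by (intro norm_direction) simp
    have sw: "swell y = (cos (ang (norm y)), (sin (ang (norm y)) / norm y) *\<^sub>R y)"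
      using 2 by (simp add: swell_def)
    have "twist (y /\<^sub>R norm y) (pi/4) (ang (norm y)) 0 e0 = iota (swell y)"
      unfolding e0_iota twist_iota_start[OF y] sw
      by (rule arg_cong[of _ _ iota]) (simp add: divide_inverse)
    moreover have "kinkP (0, y) = Q0" using 2 twist_Q0_start[OF y, of "ang (norm y)"] unfolding kinkP_def by simp
    ultimately show ?thesis using 2 unfolding kinkv_def by simp
  qed
  then show "kinkP (0, y) = Q0" "kinkv (0, y) = iota (swell y)" by auto
qed

lemma kink_end: "kinkP (1, y) = stab (kink y)" "kinkv (1, y) = e0"
proof -
  consider "norm y \<le> 1/3" | "norm y > 1/3" by linarith
  then have "kinkP (1, y) = stab (kink y) \<and> kinkv (1, y) = e0"
  proof cases
    case 1
    have "phase e0 (- pi) (- e0) = e0" by (simp add: phase_def herm_simps herm_e0 vec_eq_iff)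
    then show ?thesis using 1 by (simp add: kinkP_def kinkv_def kink_def phase_e0_pi)
  next
    case 2
    then have y: "norm (y /\<^sub>R norm y) = 1" by (intro norm_direction) simp
    have "phase (emb (cvec (y /\<^sub>R norm y) 0)) \<theta> e0 = e0" for \<theta>
      by (simp add: phase_def herm_option)
    then show ?thesis using 2 phase_emb_image[OF y, of "- ang (norm y)" iR]
      by (simp add: kinkP_def kinkv_def kink_def twist_end)
  qed
  then show "kinkP (1, y) = stab (kink y)" "kinkv (1, y) = e0" by auto
qed

lemma kink_outer: "norm y \<ge> 1 \<Longrightarrow> kinkP (t, y) = Q0 \<and> kinkv (t, y) = e0"
  using kink_far[of y t] by (simp add: ang_eq twist_id)

text \<open>The kink pulled back to a cap of the n-sphere. On the edge of the cap the last component
  has length sqrt 3 / 2, so its double lies outside the unit ball, where the kink is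
  \<open>iR\<close>.\<close>

definition cap_kink :: "real \<times> (real^'n) \<Rightarrow> (complex^'n) set" where
  "cap_kink p = (if fst p \<le> - 1/2 then kink (2 *\<^sub>R snd p) else iR)"

definition cap_swell :: "real \<times> (real^'n) \<Rightarrow> real \<times> (real^'n)" where
  "cap_swell p = (if fst p \<le> - 1/2 then swell (2 *\<^sub>R snd p) else (1, 0))"

lemma norm_pair1: "norm p = 1 \<Longrightarrow> (fst p)\<^sup>2 + (norm (snd p))\<^sup>2 = 1"
  by (cases p) (simp add: norm_Pair real_sqrt_eq_1_iff)

lemma cap_edge:
  fixes p :: "real \<times> 'a::real_normed_vector"
  assumes "norm p = 1" "fst p = - 1/2" shows "norm (2 *\<^sub>R snd p) \<ge> 1"
proof -
  have "(norm (snd p))\<^sup>2 = 3/4" using norm_pair1[OF assms(1)] assms(2) by (simp add: power2_eq_square)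
  then have "(1/2)\<^sup>2 \<le> (norm (snd p))\<^sup>2" by (simp add: power2_eq_square)
  then have "1/2 \<le> norm (snd p)" by (rule power2_le_imp_le) auto
  then show ?thesis by simp
qed

lemma swell_norm: "norm (swell y) = 1"
  by (auto simp: swell_def norm_Pair abs_mult power_divide simp flip: power_abs)

lemma ehom_cap_kink:
  fixes s :: "real^'n \<Rightarrow> real \<times> (real^'n)"
  assumes s: "continuous_on (cball 0 1) s" "\<And>y. y \<in> cball 0 1 \<Longrightarrow> norm (s y) = 1"
    "\<And>y. norm y = 1 \<Longrightarrow> s y = (1, 0)"
  shows "ehom (\<lambda>_. Q0) (\<lambda>y. iota (cap_swell (s y))) (\<lambda>y. stab (cap_kink (s y))) (\<lambda>_. e0)"
proof -
  let ?D = "cball (0::real^'n) 1"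
  define P where "P = (\<lambda>(t::real, y). if fst (s y) \<le> - 1/2 then kinkP (t, 2 *\<^sub>R snd (s y)) else Q0)"
  define g where "g = (\<lambda>(t::real, y). if fst (s y) \<le> - 1/2 then kinkv (t, 2 *\<^sub>R snd (s y)) else e0)"
  let ?A = "{x \<in> {0..1::real} \<times> ?D. fst (s (snd x)) \<le> - 1/2}"
  let ?B = "{x \<in> {0..1::real} \<times> ?D. - 1/2 \<le> fst (s (snd x))}"
  have U: "{0..1} \<times> ?D = ?A \<union> ?B" by auto
  have cs: "continuous_on ({0..1::real} \<times> ?D) (\<lambda>x. s (snd x))"
    by (rule continuous_on_compose2[OF s(1)]) (auto intro!: continuous_intros)
  have cl: "closed ?A" "closed ?B"
    by (intro continuous_on_closed_Collect_le continuous_intros cs closed_Times closed_cball closed_atLeastAtMost)+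
  have cA: "continuous_on ?A (\<lambda>x. (fst x, 2 *\<^sub>R snd (s (snd x))))"
    by (intro continuous_intros continuous_on_subset[OF cs]) auto
  have edge: "P x = Q0 \<and> g x = e0" if "x \<in> ?B" for x
  proof (cases "fst (s (snd x)) = - 1/2")
    case True
    then show ?thesis using that kink_outer[OF cap_edge[of "s (snd x)"], of "fst x"] s(2)
      by (auto simp: P_def g_def split: prod.splits)
  qed (use that in \<open>auto simp: P_def g_def\<close>)
  have "lagc ?A P"
    by (rule iffD2[OF lagc_cong lagc_compose[OF kinkP_lagc cA]]) (auto simp: P_def)
  moreover have "lagc ?B P"
    by (rule iffD2[OF lagc_cong lagc_const[OF lagrangian_Q0]]) (use edge in blast)
  ultimately have "lagc (?A \<union> ?B) P" by (rule lagc_closed_Un) (intro closed_subset cl Un_upper1 Un_upper2)+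
  then have P: "lagc ({0..1} \<times> ?D) P" by (subst U)
  have "continuous_on ?A g"
    by (rule continuous_on_eq[OF continuous_on_compose2[OF kinkv_cont cA]]) (auto simp: g_def)
  moreover have "continuous_on ?B g"
    by (rule continuous_on_eq[OF continuous_on_const[of _ e0]]) (use edge in auto)
  ultimately have g: "continuous_on ({0..1} \<times> ?D) g"
    by (subst U) (rule continuous_on_closed_Un[OF cl])
  have gP: "g x \<in> P x \<and> norm (g x) = 1" for x
    using kinkv_mem e0_in_stab[OF lagrangian_subspace[OF lagrangian_iR]] by (auto simp: g_def P_def split: prod.splits)
  have bd: "P (t, y) = Q0 \<and> g (t, y) = e0" if "norm y = 1" for t y
    using s(3)[OF that] by (simp add: P_def g_def)
  have ends: "P (0, y) = Q0 \<and> g (0, y) = iota (cap_swell (s y)) \<and> P (1, y) = stab (cap_kink (s y)) \<and> g (1, y) = e0"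
    for y by (simp add: P_def g_def cap_swell_def cap_kink_def kink_start kink_end iota_e0)
  show ?thesis unfolding ehom_def
    by (intro exI[of _ P] exI[of _ g] conjI ballI allI impI) (use P g gP bd ends in blast)+
qed

text \<open>Outside the cap the value is (1, 0), whose antipode lies in the cap. Inside, the last
  components of p and of its image are non-negative multiples of one vector, so antipodality would
  make them vanish; but then both first components are negative.\<close>

lemma cap_swell_not_antipodal:
  assumes p: "norm p = 1" shows "cap_swell p \<noteq> - p"
proof
  assume eq: "cap_swell p = - p"
  show False
  proof (cases "fst p \<le> - 1/2")
    case False
    then have "- p = (1, 0)" using eq by (simp add: cap_swell_def)
    then have "fst (- p) = 1" by simp
    then show False using False by simp
  next
    case True
    define q where "q = 2 *\<^sub>R snd p"
    have sw: "swell q = - p" using eq True by (simp add: cap_swell_def q_def)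
    then have 1: "fst (swell q) \<ge> 1/2" using True by simp
    then have "norm q > 1/3" by (auto simp: swell_def split: if_splits)
    then have "snd (swell q) = (sin (ang (norm q)) / norm q) *\<^sub>R q" by (simp add: swell_def)
    moreover have "snd (swell q) = - (1/2) *\<^sub>R q" using sw by (simp add: q_def)
    ultimately have "(sin (ang (norm q)) / norm q) *\<^sub>R q = - (1/2) *\<^sub>R q" by metis
    then have "(sin (ang (norm q)) / norm q + 1/2) *\<^sub>R q = 0" unfolding scaleR_add_left by simp
    moreover have "sin (ang (norm q)) / norm q \<ge> 0"
      using ang_range[of "norm q"] by (intro divide_nonneg_nonneg sin_ge_zero) auto
    ultimately have "q = 0" by auto
    then show False using \<open>norm q > 1/3\<close> by simp
  qed
qed

text \<open>Read off as the initial vector of the preceding homotopy, for which continuity across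
  the edge of the cap is already known.\<close>

lemma cap_swell_cont:
  fixes s :: "real^'n \<Rightarrow> real \<times> (real^'n)"
  assumes s: "continuous_on (cball 0 1) s" "\<And>y. y \<in> cball 0 1 \<Longrightarrow> norm (s y) = 1"
    "\<And>y. norm y = 1 \<Longrightarrow> s y = (1, 0)"
  shows "continuous_on (cball 0 1) (\<lambda>y. iota (cap_swell (s y)))"
proof -
  from ehom_cap_kink[OF s] obtain g :: "real \<times> (real^'n) \<Rightarrow> complex^('n option)"
    where g: "continuous_on ({0..1} \<times> cball 0 1) g" "\<And>y. y \<in> cball 0 1 \<Longrightarrow> g (0, y) = iota (cap_swell (s y))"
    unfolding ehom_def by blast
  have "continuous_on (cball 0 1) (\<lambda>y. g (0, y))"
    by (rule continuous_on_compose2[OF g(1)]) (auto intro!: continuous_intros)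
  then show ?thesis by (rule continuous_on_eq) (use g in auto)
qed

text \<open>The segment between s and its image, normalized to the sphere; it avoids 0 because the
  two are never antipodal. In effect \<open>cap_swell\<close> is deformed to the identity of the
  sphere.\<close>

lemma ehom_cap_swell:
  fixes s :: "real^'n \<Rightarrow> real \<times> (real^'n)"
  assumes s: "continuous_on (cball 0 1) s" "\<And>y. y \<in> cball 0 1 \<Longrightarrow> norm (s y) = 1"
    "\<And>y. norm y = 1 \<Longrightarrow> s y = (1, 0)"
  shows "ehom (\<lambda>_. Q0) (\<lambda>y. iota (s y)) (\<lambda>_. Q0) (\<lambda>y. iota (cap_swell (s y)))"
proof -
  let ?D = "cball (0::real^'n) 1"
  define k where "k = (\<lambda>(t::real, y). (1 - t) *\<^sub>R s y + t *\<^sub>R cap_swell (s y))"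
  define g where "g = (\<lambda>x. iota (k x) /\<^sub>R norm (k x))"
  have n1: "norm (cap_swell p) = 1" for p :: "real \<times> (real^'n)"
    by (auto simp: cap_swell_def swell_norm norm_Pair)
  have k0: "k (t, y) \<noteq> 0" if "t \<in> {0..1}" "y \<in> ?D" for t y
  proof
    assume "k (t, y) = 0"
    then have e: "t *\<^sub>R cap_swell (s y) = - ((1 - t) *\<^sub>R s y)"
      by (simp add: k_def eq_neg_iff_add_eq_0 add.commute)
    have "norm (t *\<^sub>R cap_swell (s y)) = norm ((1 - t) *\<^sub>R s y)" unfolding e by simp
    then have "t = 1 - t" using that n1 s(2)[OF that(2)] by simp
    then have t: "t = 1/2" by simp
    have "2 *\<^sub>R ((1/2) *\<^sub>R cap_swell (s y)) = 2 *\<^sub>R (- ((1 - 1/2) *\<^sub>R s y))"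
      using e unfolding t by (rule arg_cong)
    then have "cap_swell (s y) = - s y" by simp
    then show False using cap_swell_not_antipodal s(2)[OF that(2)] by blast
  qed
  have cs: "continuous_on ({0..1::real} \<times> ?D) (\<lambda>x. iota (s (snd x)))"
    by (intro continuous_intros continuous_on_compose2[OF s(1)]) auto
  have cw: "continuous_on ({0..1::real} \<times> ?D) (\<lambda>x. iota (cap_swell (s (snd x))))"
    by (rule continuous_on_compose2[OF cap_swell_cont[OF s]]) (auto intro!: continuous_intros)
  have "continuous_on ({0..1} \<times> ?D) (\<lambda>x. (1 - fst x) *\<^sub>R iota (s (snd x)) + fst x *\<^sub>R iota (cap_swell (s (snd x))))"
    by (intro continuous_intros cs cw)
  then have ck: "continuous_on ({0..1} \<times> ?D) (\<lambda>x. iota (k x))"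
    by (simp add: k_def case_prod_beta iota_linear)
  from continuous_on_norm[OF this] have "continuous_on ({0..1} \<times> ?D) (\<lambda>x. norm (k x))" by simp
  then have g: "continuous_on ({0..1} \<times> ?D) g"
    unfolding g_def by (intro continuous_on_scaleR[OF continuous_on_inverse ck]) (use k0 in auto)
  have gP: "g x \<in> Q0 \<and> norm (g x) = 1" if "x \<in> {0..1} \<times> ?D" for x
  proof
    show "g x \<in> Q0" unfolding g_def by (intro subspace_mul lagrangian_subspace lagrangian_Q0 iota_in_Q0)
    show "norm (g x) = 1" using k0 that by (cases x) (auto simp: g_def)
  qed
  have bd: "g (t, y) = e0" if "norm y = 1" for t y
  proof -
    have "k (t, y) = (1, 0)" using s(3)[OF that] by (simp add: k_def cap_swell_def)
    then show ?thesis by (simp add: g_def iota_e0)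
  qed
  have ends: "g (0, y) = iota (s y)" "g (1, y) = iota (cap_swell (s y))" if "y \<in> ?D" for y
    using s(2)[OF that] n1 by (simp_all add: g_def k_def)
  show ?thesis unfolding ehom_def
    by (intro exI[of _ "\<lambda>_. Q0"] exI[of _ g] conjI ballI allI impI)
      (use lagc_const[OF lagrangian_Q0] g gP bd ends in \<open>blast\<close>)+
qed

lemma ehom_destabilize:
  assumes "ehom (\<lambda>y. stab (f0 y)) (\<lambda>_. e0) (\<lambda>y. stab (f1 y)) (\<lambda>_. e0)"
  obtains Q where "lagc ({0..1::real} \<times> cball 0 1) Q" "\<And>y. y \<in> cball 0 1 \<Longrightarrow> Q (0, y) = f0 y"
    "\<And>y. y \<in> cball 0 1 \<Longrightarrow> Q (1, y) = f1 y" "\<And>t y. t \<in> {0..1} \<Longrightarrow> norm y = 1 \<Longrightarrow> Q (t, y) = iR"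
proof -
  let ?D = "cball 0 1"
  obtain P g where 1: "lagc ({0..1::real} \<times> ?D) P" "continuous_on ({0..1} \<times> ?D) g"
     "\<And>x. x \<in> {0..1} \<times> ?D \<Longrightarrow> g x \<in> P x \<and> norm (g x) = 1"
     "\<And>y. y \<in> ?D \<Longrightarrow> P (0, y) = stab (f0 y) \<and> g (0, y) = e0 \<and> P (1, y) = stab (f1 y) \<and> g (1, y) = e0"
     "\<And>t y. t \<in> {0..1} \<Longrightarrow> norm y = 1 \<Longrightarrow> P (t, y) = Q0 \<and> g (t, y) = e0"
    using assms unfolding ehom_def by blast
  obtain Q where Q: "lagc ({0..1} \<times> ?D) Q" "\<And>x A. x \<in> {0..1} \<times> ?D \<Longrightarrow> P x = stab A \<Longrightarrow> g x = e0 \<Longrightarrow> Q x = A"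
    using destabilize_homotopy[OF 1(1-3)] by blast
  show ?thesis
    by (rule that[OF Q(1)]) (use Q(2) 1(4,5) in auto)
qed

section \<open>From the kernel to a map into the n-sphere\<close>

lemma htpy_class_eq:
  assumes "homotopic_with (\<lambda>h. h None = b) sphere_top X f g"
  shows "htpy_class X b f = htpy_class X b g"
  unfolding htpy_class_def using assms homotopic_with_trans homotopic_with_symD by blast

text \<open>The kernel condition is an equation between sets of maps. To extract a homotopy from it
  one needs that \<open>stab \<circ> f\<close> belongs to its own class, that is, that it is
  continuous.\<close>

lemma stab_kernel_representative:
  fixes c :: "((real^'n) option \<Rightarrow> (complex^'n) set) set"
  assumes "c \<in> stab_kernel"
  obtains f where "c = htpy_class Lag iR f"
    "homotopic_with (\<lambda>h. h None = Q0) sphere_top Lag (stab \<circ> f) (\<lambda>_. Q0)"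
proof -
  from assms obtain f where f: "f \<in> sphere_maps Lag iR" "c = htpy_class Lag iR f"
    and ker: "(\<Union>f\<in>c. htpy_class Lag Q0 (stab \<circ> f)) = htpy_class Lag Q0 (\<lambda>_. Q0)"
    unfolding stab_kernel_def pi_n_def pi_induced_def pi_one_def by blast
  have fc: "continuous_map sphere_top Lag f" "f None = iR" using f by (auto simp: sphere_maps_def)
  then have "homotopic_with (\<lambda>h. h None = iR) sphere_top Lag f f" by simp
  then have "f \<in> c" by (simp add: f htpy_class_def)
  have lf: "lagrangian (f p)" for p using fc(1) by (simp add: continuous_map_Lag)
  have "continuous_map sphere_top Lag (stab \<circ> f)"
    unfolding continuous_map_Lag
  proof (intro conjI ballI allI)
    fix z :: "complex^('n option)"
    have "continuous_map sphere_top euclidean (\<lambda>q. closest_point (f q) (unemb z))"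
      using fc(1) by (simp add: continuous_map_Lag)
    moreover have "continuous_map euclidean euclidean (\<lambda>w. emb w + of_real (Re (z $ None)) *s e0)"
      unfolding continuous_map_iff_continuous2 by (intro continuous_intros)
    ultimately have "continuous_map sphere_top euclidean
        ((\<lambda>w. emb w + of_real (Re (z $ None)) *s e0) \<circ> (\<lambda>q. closest_point (f q) (unemb z)))"
      by (rule continuous_map_compose)
    then show "continuous_map sphere_top euclidean (\<lambda>q. closest_point ((stab \<circ> f) q) z)"
      by (rule continuous_map_eq) (simp add: closest_point_stab lf lagrangian_subspace)
  qed (simp add: lf lagrangian_stab)
  then have "homotopic_with (\<lambda>h. h None = Q0) sphere_top Lag (stab \<circ> f) (stab \<circ> f)"
    by (simp add: fc)
  then have "stab \<circ> f \<in> htpy_class Lag Q0 (stab \<circ> f)" by (simp add: htpy_class_def)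
  then have "stab \<circ> f \<in> htpy_class Lag Q0 (\<lambda>_. Q0)" using ker \<open>f \<in> c\<close> by blast
  then have "homotopic_with (\<lambda>h. h None = Q0) sphere_top Lag (stab \<circ> f) (\<lambda>_. Q0)"
    by (simp add: htpy_class_def homotopic_with_symD)
  then show ?thesis using that f by blast
qed

definition extend :: "(real^'n \<Rightarrow> (complex^'n) set) \<Rightarrow> (real^'n) option \<Rightarrow> (complex^'n) set" where
  "extend f p = (case p of None \<Rightarrow> iR | Some q \<Rightarrow> f q)"

text \<open>Three homotopies of pairs are chained: the null homotopy with its transported vector,
  the passage from s to its image under \<open>cap_swell\<close>, and the kink homotopy. The chain
  has vector \<open>e0\<close> at both ends and on the boundary, so it destabilizes.\<close>

lemma stab_kernel_cap_kink:
  fixes c :: "((real^'n) option \<Rightarrow> (complex^'n) set) set"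
  assumes "c \<in> stab_kernel"
  obtains s :: "real^'n \<Rightarrow> real \<times> (real^'n)" where "continuous_on UNIV s" "\<And>q. norm (s q) = 1"
    "compact {q. fst (s q) \<le> - 1/2}" "c = htpy_class Lag iR (extend (\<lambda>q. cap_kink (s q)))"
proof -
  let ?D = "cball (0::real^'n) 1"
  obtain f where f: "c = htpy_class Lag iR f"
    "homotopic_with (\<lambda>h. h None = Q0) sphere_top Lag (stab \<circ> f) (\<lambda>_. Q0)"
    using stab_kernel_representative[OF assms] by blast
  obtain H :: "real \<times> (real^'n) \<Rightarrow> (complex^('n option)) set"
    where H0: "continuous_map (top_of_set ({0..1} \<times> ?D)) Lag H"
      and H1: "\<And>t y. t \<in> {0..1} \<Longrightarrow> norm y = 1 \<Longrightarrow> H (t, y) = Q0"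
      and H2: "\<And>y. H (0, y) = (stab \<circ> f) (dm y)" "\<And>y. H (1, y) = Q0"
    by (rule disc_of_homotopic[OF f(2)]) (rule that)
  have H: "lagc ({0..1} \<times> ?D) H" "\<And>t y. t \<in> {0..1} \<Longrightarrow> norm y = 1 \<Longrightarrow> H (t, y) = Q0"
    "\<And>y. H (0, y) = stab (f (dm y))" "\<And>y. H (1, y) = Q0"
    using H0 H1 H2 by (simp_all add: lagc_iff)
  have fN: "f None = iR"
  proof -
    have "stab (f None) = Q0"
      using homotopic_with_imp_property[OF f(2)] by simp
    then show ?thesis using unstab_stab by metis
  qed
  have lagf: "lagrangian (f (dm y))" if "y \<in> ?D" for y
  proof -
    have lag: "lagrangian (stab (f (dm y)))" using H(1) H(3)[symmetric] that by (auto simp: lagc_def)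
    have "0 \<in> stab (f (dm y))" using lagrangian_subspace[OF lag] subspace_0 by blast
    then have "e0 \<in> stab (f (dm y))" by (simp add: stab_iff)
    from lagrangian_unstab[OF lag this] show ?thesis by (simp add: unstab_stab)
  qed
  obtain g where g: "continuous_on ({0..1::real} \<times> ?D) g"
    "\<And>x. x \<in> {0..1} \<times> ?D \<Longrightarrow> g x \<in> H x \<and> norm (g x) = 1" "\<And>y. y \<in> ?D \<Longrightarrow> g (0, y) = e0"
    "\<And>t y. t \<in> {0..1} \<Longrightarrow> y \<in> ?D \<Longrightarrow> (\<And>t'. t' \<in> {0..1} \<Longrightarrow> H (t', y) = H (0, y)) \<Longrightarrow> g (t, y) = e0"
  proof (rule transport_in_lagrangians[OF compact_cball H(1) continuous_on_const])
    show "e0 \<in> H (0, y) \<and> norm e0 = 1" if "y \<in> ?D" for y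
      using e0_in_stab[OF lagrangian_subspace[OF lagf[OF that]]] by (simp add: H)
  qed blast
  have gb: "g (t, y) = e0" if "t \<in> {0..1}" "norm y = 1" for t y
    using that H(2) by (intro g(4)) auto
  \<comment> \<open>At time 1 the plane is \<open>Q0\<close>, so the transported unit vector is a
    point of the n-sphere in real coordinates.\<close>
  define s where "s = (\<lambda>y. (Re (g (1, y) $ None), (\<chi> j. Im (g (1, y) $ Some j)) :: real^'n))"
  have ios: "iota (s y) = g (1, y)" if "y \<in> ?D" for y
    unfolding s_def using Q0_iota[of "g (1, y)"] g(2)[of "(1, y)"] H(4) that by simp
  have cg: "continuous_on ?D (\<lambda>y. g (1, y))"
    by (rule continuous_on_compose2[OF g(1)]) (auto intro!: continuous_intros)
  have s: "continuous_on ?D s" "\<And>y. y \<in> ?D \<Longrightarrow> norm (s y) = 1" "\<And>y. norm y = 1 \<Longrightarrow> s y = (1, 0)"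
  proof -
    show "continuous_on ?D s" unfolding s_def by (intro continuous_intros cg)
    show "norm (s y) = 1" if "y \<in> ?D" for y using ios[OF that] g(2)[of "(1, y)"] that by (metis (no_types, lifting) norm_iota SigmaI atLeastAtMost_iff order_refl zero_le_one)
    show "s y = (1, 0)" if "norm y = 1" for y
      using gb[of 1 y] that by (simp add: s_def vec_eq_iff)
  qed
  have "ehom (\<lambda>y. stab (f (dm y))) (\<lambda>_. e0) (\<lambda>_. Q0) (\<lambda>y. iota (s y))"
    unfolding ehom_def
    by (intro exI[of _ H] exI[of _ g] conjI ballI allI impI) (use H g ios gb in simp_all)
  then have "ehom (\<lambda>y. stab (f (dm y))) (\<lambda>_. e0) (\<lambda>y. stab (cap_kink (s y))) (\<lambda>_. e0)"
    using ehom_trans ehom_cap_swell[OF s] ehom_cap_kink[OF s] by blast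
  then obtain Q where Q: "lagc ({0..1::real} \<times> ?D) Q" "\<And>y. y \<in> ?D \<Longrightarrow> Q (0, y) = f (dm y)"
    "\<And>y. y \<in> ?D \<Longrightarrow> Q (1, y) = cap_kink (s y)" "\<And>t y. t \<in> {0..1} \<Longrightarrow> norm y = 1 \<Longrightarrow> Q (t, y) = iR"
    by (rule ehom_destabilize) (rule that)
  have "homotopic_with (\<lambda>h. h None = iR) sphere_top Lag (\<lambda>p. Q (0, dinv p)) (\<lambda>p. Q (1, dinv p))"
    using Q(1) unfolding lagc_iff by (rule homotopic_of_disc) (rule Q(4))
  moreover have "(\<lambda>p. Q (0, dinv p)) = f" by (simp add: Q(2) norm_dinv_le dm_dinv)
  moreover have "(\<lambda>p. Q (1, dinv p)) = extend (\<lambda>q. cap_kink (s (dinv (Some q))))"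
  proof
    fix p show "Q (1, dinv p) = extend (\<lambda>q. cap_kink (s (dinv (Some q)))) p"
      using Q(3)[of "dinv p"] norm_dinv_le[of p]
      by (cases p) (simp_all add: extend_def s(3) norm_dinv_None cap_kink_def)
  qed
  ultimately have "c = htpy_class Lag iR (extend (\<lambda>q. cap_kink (s (dinv (Some q)))))"
    using htpy_class_eq f(1) by metis
  moreover have cd: "continuous_on UNIV (\<lambda>q::real^'n. dinv (Some q))"
    unfolding dinv_simps by (intro continuous_intros) (simp add: add_nonneg_eq_0_iff)
  moreover have nd: "dinv (Some q) \<in> ?D" for q using norm_dinv_le[of "Some q"] by simp
  moreover have "compact {q. fst (s (dinv (Some q))) \<le> - 1/2}"
  proof -
    have "closed {y \<in> ?D. fst (s y) \<le> - 1/2}"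
      by (intro continuous_on_closed_Collect_le continuous_intros s) auto
    then have "compact {y \<in> ?D. fst (s y) \<le> - 1/2}"
      by (rule compact_Int_closed[OF compact_cball[of 0 1], THEN back_subst[of compact]]) auto
    \<comment> \<open>On the boundary of the disc s equals (1, 0), so the preimage of the cap is a
      compact subset of the open disc and stays compact after stretching.\<close>
    moreover have lt: "norm y < 1" if "y \<in> {y \<in> ?D. fst (s y) \<le> - 1/2}" for y
      using that s(3)[of y] by (cases "norm y = 1") auto
    ultimately have "compact ((\<lambda>y. y /\<^sub>R (1 - norm y)) ` {y \<in> ?D. fst (s y) \<le> - 1/2})"
      by (intro compact_continuous_image continuous_intros) force+
    moreover have "{q. fst (s (dinv (Some q))) \<le> - 1/2} = (\<lambda>y. y /\<^sub>R (1 - norm y)) ` {y \<in> ?D. fst (s y) \<le> - 1/2}"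
    proof (intro equalityI subsetI)
      fix q assume q: "q \<in> {q. fst (s (dinv (Some q))) \<le> - 1/2}"
      have "dm (dinv (Some q)) = Some (dinv (Some q) /\<^sub>R (1 - norm (dinv (Some q))))"
        using norm_dinv_Some[of q] by (simp add: dm_def)
      then have "q = dinv (Some q) /\<^sub>R (1 - norm (dinv (Some q)))" by (simp add: dm_dinv)
      then show "q \<in> (\<lambda>y. y /\<^sub>R (1 - norm y)) ` {y \<in> ?D. fst (s y) \<le> - 1/2}"
        using q nd by blast
    next
      fix q assume "q \<in> (\<lambda>y. y /\<^sub>R (1 - norm y)) ` {y \<in> ?D. fst (s y) \<le> - 1/2}"
      then obtain y where y: "q = y /\<^sub>R (1 - norm y)" "y \<in> {y \<in> ?D. fst (s y) \<le> - 1/2}" by blast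
      then have "dm y = Some q" using lt[OF y(2)] by (simp add: dm_def)
      then have "dinv (Some q) = y" using dinv_dm[OF lt[OF y(2)]] by simp
      then show "q \<in> {q. fst (s (dinv (Some q))) \<le> - 1/2}" using y by simp
    qed
    ultimately show ?thesis by simp
  qed
  moreover have "continuous_on UNIV (\<lambda>q. s (dinv (Some q)))"
    by (rule continuous_on_compose2[OF s(1) cd]) (use nd in blast)
  ultimately show ?thesis using that[of "\<lambda>q. s (dinv (Some q))"] s(2) by blast
qed

text \<open>Sard's theorem in the library needs a well-ordered index type.\<close>

typedef 'a ordered_copy = "UNIV :: 'a set" ..

instance ordered_copy :: (finite) finite
proof
  have "(UNIV :: 'a ordered_copy set) = range Abs_ordered_copy"
    by (metis Rep_ordered_copy_inverse surj_def)
  then show "finite (UNIV :: 'a ordered_copy set)" by (metis finite finite_imageI)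
qed

instantiation ordered_copy :: (finite) wellorder
begin

definition rank_ordered_copy :: "'a ordered_copy \<Rightarrow> nat" where
  "rank_ordered_copy = (SOME f. inj f)"

lemma inj_rank_ordered_copy: "inj rank_ordered_copy"
proof -
  have "\<exists>f :: 'a ordered_copy \<Rightarrow> nat. inj f"
    using finite_imp_inj_to_nat_seg[of "UNIV :: 'a ordered_copy set"] by auto
  then show ?thesis unfolding rank_ordered_copy_def by (rule someI_ex)
qed

definition less_eq_ordered_copy :: "'a ordered_copy \<Rightarrow> 'a ordered_copy \<Rightarrow> bool" where
  "x \<le> y \<longleftrightarrow> rank_ordered_copy x \<le> rank_ordered_copy y"

definition less_ordered_copy :: "'a ordered_copy \<Rightarrow> 'a ordered_copy \<Rightarrow> bool" where
  "x < y \<longleftrightarrow> rank_ordered_copy x < rank_ordered_copy y"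

instance
proof
  fix x y z :: "'a ordered_copy" and P :: "'a ordered_copy \<Rightarrow> bool"
  show "x < y \<longleftrightarrow> x \<le> y \<and> \<not> y \<le> x" "x \<le> x" "x \<le> y \<Longrightarrow> y \<le> z \<Longrightarrow> x \<le> z" "x \<le> y \<or> y \<le> x"
    by (auto simp: less_eq_ordered_copy_def less_ordered_copy_def)
  show "x \<le> y \<Longrightarrow> y \<le> x \<Longrightarrow> x = y"
    using inj_rank_ordered_copy by (auto simp: less_eq_ordered_copy_def inj_def)
  assume *: "\<And>x. (\<And>y. y < x \<Longrightarrow> P y) \<Longrightarrow> P x"
  show "P x"
    by (rule measure_induct_rule[of rank_ordered_copy]) (rule *, simp add: less_ordered_copy_def)
qed

end

text \<open>By Sard the critical values are negligible, while a ball about 0 is not. The relabelling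
  of coordinates is linear and carries both statements over.\<close>

lemma regular_value:
  fixes p :: "real^'n \<Rightarrow> real^'n"
  assumes p: "\<And>x. (p has_derivative p' x) (at x)" and "e > 0"
  obtains b where "norm b < e" "\<And>x. p x = b \<Longrightarrow> inj (p' x)"
proof -
  let ?to = "\<lambda>x::real^'n. \<chi> i. x $ Rep_ordered_copy i"
  let ?from = "\<lambda>x::real^'n ordered_copy. \<chi> i. x $ Abs_ordered_copy i"
  have ft: "?from (?to x) = x" "?to (?from y) = y" for x y
    by (simp_all add: vec_eq_iff Abs_ordered_copy_inverse Rep_ordered_copy_inverse)
  have lin: "linear ?to" "linear ?from" by (auto intro!: linearI simp: vec_eq_iff)
  let ?q = "\<lambda>x. ?to (p (?from x))"
  let ?q' = "\<lambda>x v. ?to (p' (?from x) (?from v))"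
  have q: "(?q has_derivative ?q' x) (at x within S)" for x S
  proof -
    have "(?from has_derivative ?from) (at x within S)" by (rule linear_imp_has_derivative[OF lin(2)])
    from has_derivative_compose[OF this p] have "((\<lambda>x. p (?from x)) has_derivative (\<lambda>v. p' (?from x) (?from v))) (at x within S)" .
    from has_derivative_compose[OF this linear_imp_has_derivative[OF lin(1)]] show ?thesis .
  qed
  have linp: "linear (p' x)" for x using p[of x] has_derivative_linear by blast
  have linq: "linear (?q' x)" for x using q[of x UNIV] has_derivative_linear by blast
  define C where "C = {x. \<not> inj (?q' x)}"
  have "rank (matrix (?q' x)) < CARD('n ordered_copy)" if "x \<in> C" for x
    using that det_nz_iff_inj[OF linq[of x]] by (simp add: C_def flip: det_eq_0_rank)
  then have N1: "negligible (?q ` C)" using q by (intro baby_Sard) auto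
  have N2: "\<not> negligible (?to ` ball 0 e)"
  proof -
    have "?to ` ball 0 e = ?from -` ball 0 e" using ft by (auto simp: image_iff) (metis ft(2) dist_0_norm mem_ball)
    moreover have "open (?from -` ball 0 e)"
      using lin(2) by (intro open_vimage linear_continuous_on) (auto simp: linear_conv_bounded_linear)
    moreover have "?to ` ball 0 e \<noteq> {}" using \<open>e > 0\<close> by auto
    ultimately show ?thesis using open_not_negligible by metis
  qed
  have "\<not> ?to ` ball 0 e \<subseteq> ?q ` C"
    using N2 negligible_subset[OF N1] by (rule contrapos_nn)
  then obtain b where b: "b \<in> ball 0 e" "?to b \<notin> ?q ` C" by (meson image_subsetI)
  have "inj (p' x)" if "p x = b" for x
  proof -
    have "?q (?to x) = ?to b" using that ft by simp
    then have "?to x \<notin> C" using b(2) imageI[of "?to x" C ?q] by (simp only:) blast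
    then have "inj (?q' (?to x))" by (simp add: C_def)
    then have i: "inj (\<lambda>v. ?to (p' x (?from v)))" using ft by simp
    show ?thesis
    proof (rule injI)
      fix v w assume "p' x v = p' x w"
      then have "?to (p' x (?from (?to v))) = ?to (p' x (?from (?to w)))" by (simp only: ft)
      then have "?to v = ?to w" using i by (meson injD)
      then show "v = w" by (metis ft(1))
    qed
  qed
  then show ?thesis using that b by simp
qed

section \<open>Localized homotopies and linear kinks\<close>

text \<open>The support is recorded for all times, so that homotopies with disjoint supports can run
  side by side. For bounded A they extend over the point at infinity.\<close>

definition localhom :: "(real^'n) set \<Rightarrow> (real^'n \<Rightarrow> (complex^'n) set) \<Rightarrow> (real^'n \<Rightarrow> (complex^'n) set) \<Rightarrow> bool" where
  "localhom A f g \<longleftrightarrow> (\<exists>h. lagc ({0..1::real} \<times> UNIV) h \<and> (\<forall>q. h (0, q) = f q \<and> h (1, q) = g q) \<and>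
     (\<forall>t\<in>{0..1}. \<forall>q. q \<notin> A \<longrightarrow> h (t, q) = iR))"

lemma localhomI:
  assumes "lagc ({0..1::real} \<times> UNIV) h" "\<And>q. h (0, q) = f q" "\<And>q. h (1, q) = g q"
    "\<And>t q. t \<in> {0..1} \<Longrightarrow> q \<notin> A \<Longrightarrow> h (t, q) = iR"
  shows "localhom A f g"
  unfolding localhom_def using assms by blast

lemma localhomE:
  assumes "localhom A f g"
  obtains h where "lagc ({0..1::real} \<times> UNIV) h" "\<And>q. h (0, q) = f q" "\<And>q. h (1, q) = g q"
    "\<And>t q. t \<in> {0..1} \<Longrightarrow> q \<notin> A \<Longrightarrow> h (t, q) = iR"
  using assms unfolding localhom_def by blast

lemma localhom_mono: "localhom A f g \<Longrightarrow> A \<subseteq> B \<Longrightarrow> localhom B f g"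
  unfolding localhom_def by (meson subsetD)

lemma localhom_trans: assumes "localhom A f g" "localhom A g k" shows "localhom A f k"
proof -
  obtain h where h: "lagc ({0..1::real} \<times> UNIV) h" "\<And>q. h (0, q) = f q" "\<And>q. h (1, q) = g q"
    "\<And>t q. t \<in> {0..1} \<Longrightarrow> q \<notin> A \<Longrightarrow> h (t, q) = iR" using localhomE[OF assms(1)] by blast
  obtain h' where h': "lagc ({0..1::real} \<times> UNIV) h'" "\<And>q. h' (0, q) = g q" "\<And>q. h' (1, q) = k q"
    "\<And>t q. t \<in> {0..1} \<Longrightarrow> q \<notin> A \<Longrightarrow> h' (t, q) = iR" using localhomE[OF assms(2)] by blast
  define H where "H = (\<lambda>x. if fst x \<le> 1/2 then h (2 * fst x, snd x) else h' (2 * fst x - 1, snd x))"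
  let ?A = "{0..1/2::real} \<times> (UNIV :: (real^'a) set)" and ?B = "{1/2..1::real} \<times> (UNIV :: (real^'a) set)"
  have U: "{0..1::real} \<times> UNIV = ?A \<union> ?B" by auto
  have "lagc ?A (\<lambda>x. h (2 * fst x, snd x))"
    by (rule lagc_compose[OF h(1)]) (auto intro!: continuous_intros)
  then have 1: "lagc ?A H" by (rule iffD2[OF lagc_cong, rotated]) (auto simp: H_def)
  have "lagc ?B (\<lambda>x. h' (2 * fst x - 1, snd x))"
    by (rule lagc_compose[OF h'(1)]) (auto intro!: continuous_intros)
  then have 2: "lagc ?B H"
  proof (rule iffD2[OF lagc_cong, rotated])
    fix x assume x: "x \<in> ?B"
    show "H x = h' (2 * fst x - 1, snd x)"
    proof (cases "fst x = 1/2")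
      case True
      then have t: "2 * fst x = 1" by simp
      show ?thesis unfolding H_def t using True by (simp add: h h')
    qed (use x in \<open>auto simp: H_def\<close>)
  qed
  have "lagc (?A \<union> ?B) H"
    by (rule lagc_closed_Un[OF 1 2]) (intro closed_subset closed_Times Un_upper1 Un_upper2 closed_atLeastAtMost closed_UNIV)+
  then have "lagc ({0..1} \<times> UNIV) H" by (subst U)
  then show ?thesis by (rule localhomI) (auto simp: H_def h h')
qed

lemma localhom_homotopic:
  assumes "localhom A f g" "bounded A"
  shows "homotopic_with (\<lambda>h. h None = iR) sphere_top Lag (extend f) (extend g)"
proof -
  obtain h where h: "lagc ({0..1::real} \<times> UNIV) h" "\<And>q. h (0, q) = f q" "\<And>q. h (1, q) = g q"
    "\<And>t q. t \<in> {0..1} \<Longrightarrow> q \<notin> A \<Longrightarrow> h (t, q) = iR" using localhomE[OF assms(1)] by blast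
  obtain r where r: "\<And>q. q \<in> A \<Longrightarrow> norm q < r"
    using assms(2) unfolding bounded_pos_less by blast
  have "homotopic_with (\<lambda>h. h None = iR) sphere_top Lag
    (\<lambda>p. case p of None \<Rightarrow> iR | Some q \<Rightarrow> h (0, q)) (\<lambda>p. case p of None \<Rightarrow> iR | Some q \<Rightarrow> h (1, q))"
  proof (rule homotopic_of_compact_support[OF h(1)])
    show "h (t, q) = iR" if "t \<in> {0..1}" "r \<le> norm q" for t q
      using h(4)[OF that(1)] r[of q] that(2) by force
  qed
  moreover have "(\<lambda>p. case p of None \<Rightarrow> iR | Some q \<Rightarrow> h (0, q)) = extend f"
    "(\<lambda>p. case p of None \<Rightarrow> iR | Some q \<Rightarrow> h (1, q)) = extend g"
    by (rule ext, simp add: extend_def h split: option.split)+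
  ultimately show ?thesis by simp
qed

text \<open>Meant for disjoint sets, where \<open>SOME\<close> returns the unique index; outside all
  of them the value is the base plane.\<close>

definition glue :: "'i set \<Rightarrow> ('i \<Rightarrow> 'a set) \<Rightarrow> ('i \<Rightarrow> 'a \<Rightarrow> (complex^'n) set) \<Rightarrow> 'a \<Rightarrow> (complex^'n) set" where
  "glue J A h q = (if \<exists>j\<in>J. q \<in> A j then h (SOME j. j \<in> J \<and> q \<in> A j) q else iR)"

lemma glue_eq:
  assumes "disjoint_family_on A J" "j \<in> J" "q \<in> A j" shows "glue J A h q = h j q"
proof -
  have "(SOME j. j \<in> J \<and> q \<in> A j) = j"
    by (rule some_equality) (use assms in \<open>auto simp: disjoint_family_on_def\<close>)
  then show ?thesis using assms by (auto simp: glue_def)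
qed

lemma glue_outside: "q \<notin> (\<Union>j\<in>J. A j) \<Longrightarrow> glue J A h q = iR"
  by (auto simp: glue_def)

lemma glue_cong:
  assumes "disjoint_family_on A J" "\<And>j q. j \<in> J \<Longrightarrow> q \<in> A j \<Longrightarrow> f j q = g j q"
  shows "glue J A f = glue J A g"
proof
  fix q show "glue J A f q = glue J A g q"
    using assms glue_eq[OF assms(1)] glue_outside by (metis UN_E)
qed

text \<open>Removing the other finitely many closed supports leaves an open neighbourhood on which
  the glued homotopy is a single one of the given homotopies.\<close>

lemma glue_localhom:
  assumes J: "finite J" and A: "\<And>j. j \<in> J \<Longrightarrow> closed (A j)" "disjoint_family_on A J"
    and fg: "\<And>j. j \<in> J \<Longrightarrow> localhom (A j) (f j) (g j)"
  shows "localhom (\<Union>j\<in>J. A j) (glue J A f) (glue J A g)"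
proof -
  have "\<forall>j\<in>J. \<exists>h. lagc ({0..1::real} \<times> UNIV) h \<and> (\<forall>q. h (0, q) = f j q \<and> h (1, q) = g j q) \<and>
     (\<forall>t\<in>{0..1}. \<forall>q. q \<notin> A j \<longrightarrow> h (t, q) = iR)" using fg by (simp add: localhom_def)
  then obtain h where h: "\<And>j. j \<in> J \<Longrightarrow> lagc ({0..1::real} \<times> UNIV) (h j)"
    "\<And>j q. j \<in> J \<Longrightarrow> h j (0, q) = f j q" "\<And>j q. j \<in> J \<Longrightarrow> h j (1, q) = g j q"
    "\<And>j t q. j \<in> J \<Longrightarrow> t \<in> {0..1} \<Longrightarrow> q \<notin> A j \<Longrightarrow> h j (t, q) = iR" by metis
  define H where "H = (\<lambda>x. glue J A (\<lambda>j q. h j (fst x, q)) (snd x))"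
  note ge = glue_eq[OF A(2)]
  show ?thesis
  proof (rule localhomI[of H])
    show "lagc ({0..1::real} \<times> UNIV) H"
    proof (rule lagc_open_local)
      fix x assume x: "x \<in> {0..1::real} \<times> (UNIV :: (real^'b) set)"
      show "\<exists>U Q. open U \<and> x \<in> U \<and> lagc ({0..1} \<times> UNIV \<inter> U) Q \<and> (\<forall>y\<in>{0..1} \<times> UNIV \<inter> U. H y = Q y)"
      proof (cases "\<exists>j\<in>J. snd x \<in> A j")
        case True
        then obtain j where j: "j \<in> J" "snd x \<in> A j" by blast
        let ?U = "UNIV \<times> (- (\<Union>i\<in>J - {j}. A i))"
        have "open ?U" using J A(1) by (intro open_Times open_UNIV open_Compl closed_UN) auto
        moreover have "x \<in> ?U" using j A(2) by (cases x) (auto simp: disjoint_family_on_def)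
        moreover have "lagc ({0..1} \<times> UNIV \<inter> ?U) (h j)" by (rule lagc_subset[OF h(1)[OF j(1)]]) auto
        moreover have "H y = h j y" if y: "y \<in> {0..1} \<times> UNIV \<inter> ?U" for y
        proof (cases "snd y \<in> A j")
          case True
          show ?thesis unfolding H_def ge[OF j(1) True] by simp
        next
          case False
          then have "snd y \<notin> (\<Union>i\<in>J. A i)" using y by auto
          then have "H y = iR" unfolding H_def by (rule glue_outside)
          then show ?thesis using h(4)[OF j(1), of "fst y" "snd y"] False y by auto
        qed
        ultimately show ?thesis by blast
      next
        case False
        let ?U = "UNIV \<times> (- (\<Union>i\<in>J. A i))"
        have "open ?U" using J A(1) by (intro open_Times open_UNIV open_Compl closed_UN) auto
        moreover have "x \<in> ?U" using False by (cases x) auto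
        moreover have "H y = iR" if "y \<in> {0..1} \<times> UNIV \<inter> ?U" for y
          using that unfolding H_def by (intro glue_outside) auto
        ultimately show ?thesis using lagc_const[OF lagrangian_iR] by blast
      qed
    qed
    show "H (0, q) = glue J A f q" for q
      unfolding H_def fst_conv snd_conv using glue_cong[OF A(2), of "\<lambda>j q. h j (0, q)" f] h by metis
    show "H (1, q) = glue J A g q" for q
      unfolding H_def fst_conv snd_conv using glue_cong[OF A(2), of "\<lambda>j q. h j (1, q)" g] h by metis
    show "H (t, q) = iR" if "q \<notin> (\<Union>j\<in>J. A j)" for t q
      unfolding H_def using that by (simp add: glue_outside)
  qed
qed

text \<open>The final pair of the kink homotopy is the stabilized kink with vector
  \<open>e0\<close>; cutting it down by \<open>unstab\<close> gives continuity without a second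
  pasting.\<close>

lemma kink_lagc: "lagc UNIV kink"
proof -
  have "lagc UNIV (\<lambda>y. kinkP (1, y))"
    by (rule lagc_compose[OF kinkP_lagc]) (auto intro!: continuous_intros)
  then have "lagc UNIV (\<lambda>y::real^'n. unstab (kinkP (1, y)))"
    by (rule lagc_unstab) (metis kinkv_mem(1) kink_end(2))
  then show ?thesis by (simp add: kink_end unstab_stab)
qed

text \<open>Where the two closed sets meet, m has left the open unit ball, so the kink is already
  \<open>iR\<close> and matches the constant outside K.\<close>

lemma lagc_kink_patch:
  fixes m :: "real \<times> (real^'n) \<Rightarrow> real^'n"
  assumes "closed K" "closed B" "K \<union> B = UNIV" and m: "continuous_on ({0..1} \<times> K) m"
    and edge: "\<And>t q. t \<in> {0..1} \<Longrightarrow> q \<in> K \<Longrightarrow> q \<in> B \<Longrightarrow> norm (m (t, q)) \<ge> 1"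
  shows "lagc ({0..1} \<times> UNIV) (\<lambda>x. if snd x \<in> K then kink (m x) else iR)"
proof -
  let ?f = "\<lambda>x. if snd x \<in> K then kink (m x) else iR"
  have U: "{0..1::real} \<times> (UNIV :: (real^'n) set) = {0..1} \<times> K \<union> {0..1} \<times> B" using assms(3) by blast
  have 1: "lagc ({0..1} \<times> K) ?f"
    by (rule iffD2[OF lagc_cong lagc_compose[OF kink_lagc m]]) auto
  have 2: "lagc ({0..1} \<times> B) ?f"
  proof (rule iffD2[OF lagc_cong lagc_const[OF lagrangian_iR]])
    fix x assume "x \<in> {0..1::real} \<times> B"
    then show "?f x = iR" using kink_outside[OF edge[of "fst x" "snd x"]] by (cases "snd x \<in> K") auto
  qed
  have "lagc ({0..1} \<times> K \<union> {0..1} \<times> B) ?f"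
    by (rule lagc_closed_Un[OF 1 2]) (intro closed_subset closed_Times Un_upper1 Un_upper2 closed_atLeastAtMost assms)+
  then show ?thesis by (subst U)
qed

lemma localhom_kink_patch:
  fixes m :: "real \<times> (real^'n) \<Rightarrow> real^'n"
  assumes "closed K" "closed B" "K \<union> B = UNIV" and m: "continuous_on ({0..1} \<times> K) m"
    and edge: "\<And>t q. t \<in> {0..1} \<Longrightarrow> q \<in> K \<Longrightarrow> q \<in> B \<Longrightarrow> norm (m (t, q)) \<ge> 1"
  shows "localhom K (\<lambda>q. if q \<in> K then kink (m (0, q)) else iR) (\<lambda>q. if q \<in> K then kink (m (1, q)) else iR)"
  by (rule localhomI[OF lagc_kink_patch[OF assms]]) auto

lemma eventually_less_at_right: "0 < d \<Longrightarrow> eventually (\<lambda>e. e < d) (at_right (0::real))"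
  unfolding eventually_at_right_field by blast

text \<open>A large factor pushes the support of the kink into small balls around the zeros of m,
  which are isolated and, K being compact, finite in number. In each ball m is joined to its
  derivative by a segment that stays bounded away from 0 on the boundary sphere.\<close>

lemma linearize_kinks:
  fixes m :: "real^'n \<Rightarrow> real^'n"
  assumes K: "compact K" and U: "open U" "U \<subseteq> K"
    and der: "\<And>x. (m has_derivative m' x) (at x)"
    and zeros: "\<And>x. x \<in> K \<Longrightarrow> m x = 0 \<Longrightarrow> x \<in> U \<and> inj (m' x)"
    and edge: "\<And>q. q \<in> K \<Longrightarrow> q \<notin> U \<Longrightarrow> norm (m q) \<ge> 1/2"
  obtains Z \<delta> D where "finite Z" "\<delta> > 0" "disjoint_family_on (\<lambda>z. cball z \<delta>) Z"
    "\<And>z. z \<in> Z \<Longrightarrow> linear (D z)" "\<And>z v. z \<in> Z \<Longrightarrow> norm v \<ge> \<delta> \<Longrightarrow> norm (D z v) \<ge> 1"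
    "localhom K (\<lambda>q. if q \<in> K then kink (2 *\<^sub>R m q) else iR)
       (glue Z (\<lambda>z. cball z \<delta>) (\<lambda>z q. kink (D z (q - z))))"
proof -
  have cm: "continuous_on S m" for S
    using der by (meson continuous_at_imp_continuous_on has_derivative_continuous)
  have linm: "linear (m' x)" for x using der[of x] has_derivative_linear by blast
  define Z where "Z = {q \<in> K. m q = 0}"
  have "\<exists>c>0. \<forall>v. c * norm v \<le> norm (m' z v)" if "z \<in> Z" for z
    using linear_inj_bounded_below_pos[OF linm, of z] zeros[of z] that unfolding Z_def by blast
  then obtain c where c: "\<And>z. z \<in> Z \<Longrightarrow> c z > 0" "\<And>z v. z \<in> Z \<Longrightarrow> c z * norm v \<le> norm (m' z v)"
    by metis
  have "\<exists>d>0. \<forall>q. norm (q - z) < d \<longrightarrow> norm (m q - m' z (q - z)) \<le> c z / 2 * norm (q - z)" if "z \<in> Z" for z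
  proof -
    have "m z = 0" using that by (simp add: Z_def)
    moreover have "\<exists>d>0. \<forall>q. norm (q - z) < d \<longrightarrow> norm (m q - m z - m' z (q - z)) \<le> c z / 2 * norm (q - z)"
      using der[of z] c(1)[OF that] unfolding has_derivative_at_alt by (metis half_gt_zero)
    ultimately show ?thesis by simp
  qed
  then obtain d where d: "\<And>z. z \<in> Z \<Longrightarrow> d z > 0"
    "\<And>z q. z \<in> Z \<Longrightarrow> norm (q - z) < d z \<Longrightarrow> norm (m q - m' z (q - z)) \<le> c z / 2 * norm (q - z)"
    by metis
  \<comment> \<open>The remainder is at most half of the expansion of the derivative, so the other
    half survives along the whole segment.\<close>
  have lower: "norm ((1 - t) *\<^sub>R m q + t *\<^sub>R m' z (q - z)) \<ge> c z / 2 * norm (q - z)"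
    if "z \<in> Z" "norm (q - z) < d z" "t \<in> {0..1}" for z q t
  proof -
    have "(1 - t) *\<^sub>R m q + t *\<^sub>R m' z (q - z) = m' z (q - z) + (1 - t) *\<^sub>R (m q - m' z (q - z))"
      by (simp add: algebra_simps)
    moreover have "norm ((1 - t) *\<^sub>R (m q - m' z (q - z))) \<le> 1 * (c z / 2 * norm (q - z))"
      unfolding norm_scaleR using that d(2)[OF that(1,2)] by (intro mult_mono) auto
    moreover have "norm (m' z (q - z)) \<ge> c z * norm (q - z)" by (rule c(2)[OF that(1)])
    moreover have "norm (m' z (q - z)) - norm ((1 - t) *\<^sub>R (m q - m' z (q - z)))
      \<le> norm (m' z (q - z) + (1 - t) *\<^sub>R (m q - m' z (q - z)))" by (rule norm_diff_ineq)
    ultimately show ?thesis by simp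
  qed
  have iso: "q = z" if "z \<in> Z" "q \<in> Z" "norm (q - z) < d z" for z q
  proof -
    have "c z / 2 * norm (q - z) \<le> 0"
      using lower[OF that(1,3), of 0] that(2) by (simp add: Z_def)
    then have "norm (q - z) \<le> 0" using c(1)[OF that(1)] by (simp add: mult_le_0_iff)
    then show ?thesis by simp
  qed
  have "closed {q. m q = 0}" by (intro closed_Collect_eq cm continuous_on_const)
  then have "compact (K \<inter> {q. m q = 0})" using K by (rule compact_Int_closed[rotated])
  moreover have "K \<inter> {q. m q = 0} = Z" by (auto simp: Z_def)
  ultimately have "compact Z" by simp
  moreover have "\<not> z islimpt Z" if z: "z \<in> Z" for z
  proof
    assume "z islimpt Z"
    then obtain q where "q \<in> Z" "q \<noteq> z" "dist q z < d z"
      using d(1)[OF z] unfolding islimpt_approachable by blast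
    then show False using iso[OF z] by (simp add: dist_norm)
  qed
  ultimately have finZ: "finite Z" using finite_not_islimpt_in_compact[of Z Z] by simp
  \<comment> \<open>All conditions on the common radius are collected as it tends to 0. Staying
    below half the distance of two zeros makes the closed balls disjoint.\<close>
  have "eventually (\<lambda>e. e < d z \<and> cball z e \<subseteq> U \<and> (\<forall>w\<in>Z. w \<noteq> z \<longrightarrow> e < dist z w / 2)) (at_right 0)"
    if z: "z \<in> Z" for z
  proof -
    have "eventually (\<lambda>e. e < d z) (at_right 0)" using d(1)[OF z] by (rule eventually_less_at_right)
    moreover have "\<exists>e>0. cball z e \<subseteq> U" using zeros[of z] z U(1) by (auto simp: Z_def open_contains_cball)
    then obtain e0 where "e0 > 0" "cball z e0 \<subseteq> U" by blast
    then have "eventually (\<lambda>e. cball z e \<subseteq> U) (at_right 0)"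
      by (intro eventually_mono[OF eventually_less_at_right[of e0]]) force+
    moreover have "eventually (\<lambda>e. \<forall>w\<in>Z. w \<noteq> z \<longrightarrow> e < dist z w / 2) (at_right 0)"
    proof (rule eventually_ball_finite[OF finZ], intro ballI)
      fix w assume "w \<in> Z"
      show "eventually (\<lambda>e. w \<noteq> z \<longrightarrow> e < dist z w / 2) (at_right 0)"
      proof (cases "w = z")
        case False
        then have "eventually (\<lambda>e. e < dist z w / 2) (at_right 0)"
          by (intro eventually_less_at_right) simp
        then show ?thesis by eventually_elim simp
      qed simp
    qed
    ultimately show ?thesis by eventually_elim blast
  qed
  then have "eventually (\<lambda>e. \<forall>z\<in>Z. e < d z \<and> cball z e \<subseteq> U \<and> (\<forall>w\<in>Z. w \<noteq> z \<longrightarrow> e < dist z w / 2)) (at_right 0)"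
    by (intro eventually_ball_finite[OF finZ]) blast
  then have "eventually (\<lambda>e. e > 0 \<and> (\<forall>z\<in>Z. e < d z \<and> cball z e \<subseteq> U \<and> (\<forall>w\<in>Z. w \<noteq> z \<longrightarrow> e < dist z w / 2))) (at_right (0::real))"
    using eventually_at_right_less[of "0::real"] by eventually_elim blast
  then obtain \<delta> where \<delta>: "\<delta> > 0" "\<And>z. z \<in> Z \<Longrightarrow> \<delta> < d z" "\<And>z. z \<in> Z \<Longrightarrow> cball z \<delta> \<subseteq> U"
    "\<And>z w. z \<in> Z \<Longrightarrow> w \<in> Z \<Longrightarrow> w \<noteq> z \<Longrightarrow> \<delta> < dist z w / 2"
    using eventually_happens'[OF trivial_limit_at_right_real] by blast
  let ?A = "\<lambda>z. cball z \<delta>"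
  have disj: "disjoint_family_on ?A Z"
    unfolding disjoint_family_on_def
  proof (intro ballI impI)
    fix z w assume "z \<in> Z" "w \<in> Z" "z \<noteq> w"
    then have "\<delta> + \<delta> < dist z w" using \<delta>(4)[of z w] by simp
    then show "?A z \<inter> ?A w = {}" by (intro disjoint_cballI)
  qed
  let ?K' = "K - (\<Union>z\<in>Z. ball z \<delta>)"
  have cK: "compact ?K'" using K by (intro compact_diff open_UN) auto
  have nz: "m q \<noteq> 0" if "q \<in> ?K'" for q using that \<delta>(1) by (auto simp: Z_def)
  have "\<exists>\<mu>>0. \<forall>q\<in>?K'. \<mu> \<le> norm (m q)"
  proof (cases "?K' = {}")
    case True
    show ?thesis unfolding True by (intro exI[of _ 1]) simp
  next
    case False
    obtain q0 where q0: "q0 \<in> ?K'" "\<forall>q\<in>?K'. norm (m q0) \<le> norm (m q)"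
      using continuous_attains_inf[OF cK False continuous_on_norm[OF cm]] by blast
    have "norm (m q0) > 0" using nz[OF q0(1)] by simp
    then show ?thesis using q0(2) by blast
  qed
  then obtain \<mu> where \<mu>: "\<mu> > 0" "\<And>q. q \<in> ?K' \<Longrightarrow> \<mu> \<le> norm (m q)" by blast
  \<comment> \<open>Dominates three bounds at once: the initial factor 2, the value 1/\<mu> that
    makes the kink trivial off the balls, and for each zero the value needed on the sphere around
    it.\<close>
  define M where "M = 2 + 1 / \<mu> + (\<Sum>z\<in>Z. 2 / (c z * \<delta>))"
  have sumnn: "(\<Sum>z\<in>Z. 2 / (c z * \<delta>)) \<ge> 0"
    using c(1) \<delta>(1) by (intro sum_nonneg) (simp add: less_imp_le)
  have M2: "M \<ge> 2" using sumnn \<mu>(1) by (simp add: M_def)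
  have M\<mu>: "M * \<mu> \<ge> 1"
  proof -
    have "1 / \<mu> \<le> M" using sumnn by (simp add: M_def)
    then show ?thesis using \<mu>(1) by (simp add: pos_divide_le_eq)
  qed
  have Mc: "M * (c z / 2 * \<delta>) \<ge> 1" if "z \<in> Z" for z
  proof -
    have "2 / (c z * \<delta>) \<le> (\<Sum>z\<in>Z. 2 / (c z * \<delta>))"
      using c(1) \<delta>(1) by (intro member_le_sum that finZ) (auto simp: less_imp_le)
    moreover have "1 / \<mu> > 0" using \<mu>(1) by simp
    ultimately have "2 / (c z * \<delta>) \<le> M" unfolding M_def by linarith
    then show ?thesis using c(1)[OF that] \<delta>(1) by (simp add: pos_divide_le_eq mult.assoc)
  qed
  define D where "D = (\<lambda>z v. M *\<^sub>R m' z v)"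
  have D: "linear (D z)" for z unfolding D_def using linm[of z] by (intro linear_compose_scale_right)
  have Dbig: "norm (D z v) \<ge> 1" if "z \<in> Z" "norm v \<ge> \<delta>" for z v
  proof -
    have "c z / 2 * \<delta> \<le> c z * norm v" using c(1)[OF that(1)] that(2) \<delta>(1) by (intro mult_mono) auto
    also have "\<dots> \<le> norm (m' z v)" by (rule c(2)[OF that(1)])
    finally have "M * (c z / 2 * \<delta>) \<le> M * norm (m' z v)" using M2 by (intro mult_left_mono) auto
    then have "1 \<le> M * norm (m' z v)" using Mc[OF that(1)] by linarith
    then show ?thesis using M2 by (simp add: D_def)
  qed
  have "localhom K (\<lambda>q. if q \<in> K then kink (((1 - 0) * 2 + 0 * M) *\<^sub>R m q) else iR)
          (\<lambda>q. if q \<in> K then kink (((1 - 1) * 2 + 1 * M) *\<^sub>R m q) else iR)"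
  proof (rule localhom_kink_patch[where B = "- U" and m = "\<lambda>x. ((1 - fst x) * 2 + fst x * M) *\<^sub>R m (snd x)", unfolded fst_conv snd_conv])
    show "closed K" "closed (- U)" "K \<union> - U = UNIV" using K U by (auto intro: compact_imp_closed)
    show "continuous_on ({0..1} \<times> K) (\<lambda>x. ((1 - fst x) * 2 + fst x * M) *\<^sub>R m (snd x))"
      by (intro continuous_intros continuous_on_compose2[OF cm[of UNIV]]) auto
    fix t q assume t: "t \<in> {0..1::real}" and q: "q \<in> K" "q \<in> - U"
    have "t * 2 \<le> t * M" using M2 t by (intro mult_left_mono) auto
    then have "(1 - t) * 2 + t * M \<ge> 2" by (simp add: algebra_simps)
    then have "((1 - t) * 2 + t * M) * norm (m q) \<ge> 2 * (1/2)" using edge[of q] q by (intro mult_mono) auto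
    then show "norm (((1 - t) * 2 + t * M) *\<^sub>R m q) \<ge> 1" unfolding norm_scaleR using \<open>(1 - t) * 2 + t * M \<ge> 2\<close> by simp
  qed
  then have 1: "localhom K (\<lambda>q. if q \<in> K then kink (2 *\<^sub>R m q) else iR) (\<lambda>q. if q \<in> K then kink (M *\<^sub>R m q) else iR)"
    by (simp cong: if_cong)
  let ?g0 = "\<lambda>z q. if q \<in> ?A z then kink (M *\<^sub>R m q) else iR"
  have 2: "(\<lambda>q. if q \<in> K then kink (M *\<^sub>R m q) else iR) = glue Z ?A ?g0"
  proof
    fix q
    show "(if q \<in> K then kink (M *\<^sub>R m q) else iR) = glue Z ?A ?g0 q"
    proof (cases "\<exists>z\<in>Z. q \<in> ?A z")
      case True
      then obtain z where z: "z \<in> Z" "q \<in> ?A z" by blast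
      then have "q \<in> K" using \<delta>(3) U(2) by blast
      then show ?thesis unfolding glue_eq[OF disj z] using z by simp
    next
      case False
      then have "glue Z ?A ?g0 q = iR" by (intro glue_outside) blast
      moreover have "kink (M *\<^sub>R m q) = iR" if "q \<in> K"
      proof (rule kink_outside)
        have "q \<in> ?K'" using False that by (auto simp: dist_commute less_imp_le) 
        then have "M * \<mu> \<le> M * norm (m q)" using \<mu>(2) M2 by (intro mult_left_mono) auto
        then have "1 \<le> M * norm (m q)" using M\<mu> by linarith
        then show "norm (M *\<^sub>R m q) \<ge> 1" using M2 by simp
      qed
      ultimately show ?thesis by simp
    qed
  qed
  have "localhom (?A z) (?g0 z) (\<lambda>q. kink (D z (q - z)))" if z: "z \<in> Z" for z
  proof -
    have "localhom (?A z) (\<lambda>q. if q \<in> ?A z then kink (M *\<^sub>R ((1 - 0) *\<^sub>R m q + 0 *\<^sub>R m' z (q - z))) else iR)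
       (\<lambda>q. if q \<in> ?A z then kink (M *\<^sub>R ((1 - 1) *\<^sub>R m q + 1 *\<^sub>R m' z (q - z))) else iR)"
    proof (rule localhom_kink_patch[where B = "- ball z \<delta>" and m = "\<lambda>x. M *\<^sub>R ((1 - fst x) *\<^sub>R m (snd x) + fst x *\<^sub>R m' z (snd x - z))", unfolded fst_conv snd_conv])
      show "closed (?A z)" "closed (- ball z \<delta>)" "?A z \<union> - ball z \<delta> = UNIV" by auto
      show "continuous_on ({0..1} \<times> ?A z) (\<lambda>x. M *\<^sub>R ((1 - fst x) *\<^sub>R m (snd x) + fst x *\<^sub>R m' z (snd x - z)))"
        by (intro continuous_intros continuous_on_compose2[OF cm[of UNIV]]
            linear_continuous_on_compose[OF _ linm]) auto
      fix t q assume t: "t \<in> {0..1::real}" and q: "q \<in> ?A z" "q \<in> - ball z \<delta>"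
      then have nq: "norm (q - z) = \<delta>" by (auto simp: dist_norm norm_minus_commute)
      have "M * (c z / 2 * \<delta>) \<le> M * norm ((1 - t) *\<^sub>R m q + t *\<^sub>R m' z (q - z))"
        using lower[OF z _ t, of q] nq \<delta>(2)[OF z] M2 by (intro mult_left_mono) auto
      then have "1 \<le> M * norm ((1 - t) *\<^sub>R m q + t *\<^sub>R m' z (q - z))" using Mc[OF z] by linarith
      then show "norm (M *\<^sub>R ((1 - t) *\<^sub>R m q + t *\<^sub>R m' z (q - z))) \<ge> 1"
        unfolding norm_scaleR using M2 by simp
    qed
    moreover have "(\<lambda>q. if q \<in> ?A z then kink (M *\<^sub>R ((1 - 1) *\<^sub>R m q + 1 *\<^sub>R m' z (q - z))) else iR) = (\<lambda>q. kink (D z (q - z)))"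
    proof
      fix q show "(if q \<in> ?A z then kink (M *\<^sub>R ((1 - 1) *\<^sub>R m q + 1 *\<^sub>R m' z (q - z))) else iR) = kink (D z (q - z))"
        using kink_outside[OF Dbig[OF z, of "q - z"]] by (auto simp: D_def dist_norm norm_minus_commute)
    qed
    ultimately show ?thesis by (simp cong: if_cong)
  qed
  then have "localhom (\<Union>z\<in>Z. ?A z) (glue Z ?A ?g0) (glue Z ?A (\<lambda>z q. kink (D z (q - z))))"
    by (intro glue_localhom finZ disj closed_cball)
  then have "localhom K (glue Z ?A ?g0) (glue Z ?A (\<lambda>z q. kink (D z (q - z))))"
    by (rule localhom_mono) (use \<delta>(3) U(2) in blast)
  from localhom_trans[OF 1[unfolded 2] this]
  have "localhom K (\<lambda>q. if q \<in> K then kink (2 *\<^sub>R m q) else iR) (glue Z ?A (\<lambda>z q. kink (D z (q - z))))" .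
  with finZ \<delta>(1) disj D Dbig show ?thesis by (rule that[of Z \<delta> D])
qed

text \<open>The last component of s is merely continuous; near the cap it is replaced by a
  polynomial minus a regular value, whose zeros are nondegenerate.\<close>

lemma cap_kink_linearized:
  fixes s :: "real^'n \<Rightarrow> real \<times> (real^'n)"
  assumes s: "continuous_on UNIV s" "\<And>q. norm (s q) = 1" and K: "compact {q. fst (s q) \<le> - 1/2}"
  obtains Z \<delta> D where "finite Z" "\<delta> > 0" "disjoint_family_on (\<lambda>z. cball z \<delta>) Z"
    "\<And>z. z \<in> Z \<Longrightarrow> linear (D z)" "\<And>z v. z \<in> Z \<Longrightarrow> norm v \<ge> \<delta> \<Longrightarrow> norm (D z v) \<ge> 1"
    "homotopic_with (\<lambda>h. h None = iR) sphere_top Lag (extend (\<lambda>q. cap_kink (s q)))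
       (extend (glue Z (\<lambda>z. cball z \<delta>) (\<lambda>z q. kink (D z (q - z)))))"
proof -
  let ?K = "{q. fst (s q) \<le> - 1/2}" and ?U = "{q. fst (s q) < - 1/2}"
  have cs: "continuous_on S (\<lambda>q. snd (s q))" for S
    by (intro continuous_intros continuous_on_subset[OF s(1)]) auto
  obtain p where p: "polynomial_function p" "\<And>q. q \<in> ?K \<Longrightarrow> norm (snd (s q) - p q) < 1/10"
    using Stone_Weierstrass_polynomial_function[OF K cs, of "1/10"] by auto
  have "\<forall>x. \<exists>D. (p has_derivative D) (at x)"
    using differentiable_at_polynomial_function[OF p(1)] unfolding differentiable_def by blast
  then obtain p' where p': "\<And>x. (p has_derivative p' x) (at x)" by metis
  obtain b where b: "norm b < 1/10" "\<And>x. p x = b \<Longrightarrow> inj (p' x)"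
    using regular_value[of p p' "1/10", OF p'] by auto
  have cp: "continuous_on S p" for S by (rule continuous_on_polymonial_function[OF p(1)])
  \<comment> \<open>On the edge of the cap the last component has length sqrt 3 / 2, which is at
    least 4/5. Approximation and regular value cost at most 1/10 each.\<close>
  have edge: "norm ((1 - t) *\<^sub>R snd (s q) + t *\<^sub>R (p q - b)) \<ge> 1/2" if "fst (s q) = - 1/2" "t \<in> {0..1}" for q t
  proof -
    have "(norm (snd (s q)))\<^sup>2 = 3/4" using norm_pair1[OF s(2)[of q]] that(1) by (simp add: power2_eq_square)
    then have "(4/5)\<^sup>2 \<le> (norm (snd (s q)))\<^sup>2" by (simp add: power2_eq_square)
    then have 1: "4/5 \<le> norm (snd (s q))" by (rule power2_le_imp_le) auto
    have "norm (snd (s q) - (p q - b)) \<le> norm (snd (s q) - p q) + norm b"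
      using norm_triangle_ineq[of "snd (s q) - p q" b] by (simp add: algebra_simps)
    also have "\<dots> \<le> 1/5" using p(2)[of q] b(1) that(1) by simp
    finally have "t * norm (snd (s q) - (p q - b)) \<le> 1 * (1/5)" using that(2) by (intro mult_mono) auto
    then have 2: "norm (t *\<^sub>R (snd (s q) - (p q - b))) \<le> 1/5" using that(2) by simp
    have "(1 - t) *\<^sub>R snd (s q) + t *\<^sub>R (p q - b) = snd (s q) - t *\<^sub>R (snd (s q) - (p q - b))"
      by (simp add: algebra_simps)
    then show ?thesis using 1 2 norm_triangle_ineq2[of "snd (s q)" "t *\<^sub>R (snd (s q) - (p q - b))"] by simp
  qed
  have clo: "closed {q. - 1/2 \<le> fst (s q)}" by (intro closed_Collect_le continuous_intros s)
  have opU: "open ?U" by (intro open_Collect_less continuous_intros s)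
  have "localhom ?K (\<lambda>q. if q \<in> ?K then kink (2 *\<^sub>R ((1 - 0) *\<^sub>R snd (s q) + 0 *\<^sub>R (p q - b))) else iR)
     (\<lambda>q. if q \<in> ?K then kink (2 *\<^sub>R ((1 - 1) *\<^sub>R snd (s q) + 1 *\<^sub>R (p q - b))) else iR)"
  proof (rule localhom_kink_patch[where B = "{q. - 1/2 \<le> fst (s q)}" and
      m = "\<lambda>x. 2 *\<^sub>R ((1 - fst x) *\<^sub>R snd (s (snd x)) + fst x *\<^sub>R (p (snd x) - b))", unfolded fst_conv snd_conv])
    show "closed ?K" using K by (rule compact_imp_closed)
    show "?K \<union> {q. - 1/2 \<le> fst (s q)} = UNIV" by auto
    show "continuous_on ({0..1} \<times> ?K) (\<lambda>x. 2 *\<^sub>R ((1 - fst x) *\<^sub>R snd (s (snd x)) + fst x *\<^sub>R (p (snd x) - b)))"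
      by (intro continuous_intros continuous_on_compose2[OF cp[of UNIV]] continuous_on_compose2[OF cs[of UNIV]]) auto
    fix t q assume t: "t \<in> {0..1::real}" and q: "q \<in> ?K" "q \<in> {q. - 1/2 \<le> fst (s q)}"
    have "fst (s q) = - 1/2" using q by auto
    then show "norm (2 *\<^sub>R ((1 - t) *\<^sub>R snd (s q) + t *\<^sub>R (p q - b))) \<ge> 1"
      using edge[of q t] t unfolding norm_scaleR by simp
  qed (rule clo)
  then have 1: "localhom ?K (\<lambda>q. cap_kink (s q)) (\<lambda>q. if q \<in> ?K then kink (2 *\<^sub>R (p q - b)) else iR)"
    by (simp add: cap_kink_def cong: if_cong)
  have U': "?U \<subseteq> ?K" by auto
  have edge': "norm (p q - b) \<ge> 1/2" if "q \<in> ?K" "q \<notin> ?U" for q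
    using edge[of q 1] that by auto
  have zer: "x \<in> ?U \<and> inj (p' x)" if "x \<in> ?K" "p x - b = 0" for x
    using edge'[OF that(1)] that(2) b(2)[of x] by auto
  have der: "((\<lambda>q. p q - b) has_derivative p' x) (at x)" for x
    using has_derivative_diff[OF p'[of x] has_derivative_const[of b]] by simp
  show ?thesis
  proof (rule linearize_kinks[OF K opU U' der zer edge'])
    fix Z \<delta> D
    assume "localhom ?K (\<lambda>q. if q \<in> ?K then kink (2 *\<^sub>R (p q - b)) else iR)
       (glue Z (\<lambda>z. cball z \<delta>) (\<lambda>z q. kink (D z (q - z))))"
    from localhom_homotopic[OF localhom_trans[OF 1 this] compact_imp_bounded[OF K]]
    have h: "homotopic_with (\<lambda>h. h None = iR) sphere_top Lag (extend (\<lambda>q. cap_kink (s q)))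
       (extend (glue Z (\<lambda>z. cball z \<delta>) (\<lambda>z q. kink (D z (q - z)))))" .
    assume "finite Z" "\<delta> > 0" "disjoint_family_on (\<lambda>z. cball z \<delta>) Z"
       "\<And>z. z \<in> Z \<Longrightarrow> linear (D z)" "\<And>z v. z \<in> Z \<Longrightarrow> norm v \<ge> \<delta> \<Longrightarrow> norm (D z v) \<ge> 1"
    from this h show thesis by (rule that[of Z \<delta> D])
  qed
qed

section \<open>Reflections and spherical shells\<close>

text \<open>For a unit vector u, the reflection in the hyperplane orthogonal to u.\<close>

definition mirror :: "real^'n \<Rightarrow> real^'n^'n" where
  "mirror u = (\<chi> i j. of_bool (i = j) - 2 * u $ i * u $ j)"

lemma mirror_mult: "mirror u *v x = x - (2 * (u \<bullet> x)) *\<^sub>R u"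
proof -
  have "(mirror u *v x) $ i = x $ i - 2 * (u \<bullet> x) * u $ i" for i
  proof -
    have "(\<Sum>j\<in>UNIV. (of_bool (i = j) - 2 * u $ i * u $ j) * x $ j) =
      (\<Sum>j\<in>UNIV. (if i = j then x $ j else 0) - 2 * u $ i * (u $ j * x $ j))"
      by (rule sum.cong) (auto simp: algebra_simps)
    also have "\<dots> = x $ i - 2 * u $ i * (\<Sum>j\<in>UNIV. u $ j * x $ j)"
      by (simp add: sum_subtractf sum_distrib_left)
    finally show ?thesis by (simp add: matrix_vector_mult_def mirror_def inner_vec_def)
  qed
  then show ?thesis by (simp add: vec_eq_iff)
qed

lemma mirror_mirror: assumes "norm u = 1" shows "mirror u *v (mirror u *v x) = x"
proof -
  have "u \<bullet> u = 1" using assms by (simp add: dot_square_norm)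
  then show ?thesis by (simp add: mirror_mult inner_diff_right)
qed

lemma mirror_squared: "norm u = 1 \<Longrightarrow> mirror u ** mirror u = mat 1"
  by (simp add: matrix_eq mirror_mirror flip: matrix_vector_mul_assoc)

lemma det_mirror: assumes "norm u = 1" shows "det (mirror u) \<noteq> 0"
proof
  assume "det (mirror u) = 0"
  then have "det (mirror u ** mirror u) = 0" by (simp add: det_mul)
  then show False using assms by (simp add: mirror_squared)
qed

section \<open>The two path components of the general linear group\<close>

abbreviation gl :: "(real^'n^'n) set" where "gl \<equiv> {A. det A \<noteq> 0}"

lemma path_component_glI:
  assumes "continuous_on {0..1} f" "\<And>t. t \<in> {0..1} \<Longrightarrow> det (f t) \<noteq> 0"
  shows "path_component gl (f (0::real)) (f 1)"
  unfolding path_component_def path_def path_image_def pathstart_def pathfinish_def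
  using assms by (intro exI[of _ f]) auto

lemma continuous_on_matrix_mult [continuous_intros]:
  fixes f g :: "'a::topological_space \<Rightarrow> real^'n^'n"
  assumes "continuous_on S f" "continuous_on S g"
  shows "continuous_on S (\<lambda>x. f x ** g x)"
  unfolding matrix_matrix_mult_def by (intro continuous_intros assms)

lemma path_component_gl_mult:
  assumes "path_component gl A A'" "path_component gl B B'"
  shows "path_component gl (A ** B) (A' ** B')"
proof -
  obtain g where g: "continuous_on {0..1::real} g" "\<And>t. t \<in> {0..1} \<Longrightarrow> det (g t) \<noteq> 0" "g 0 = A" "g 1 = A'"
    using assms(1) unfolding path_component_def path_def path_image_def pathstart_def pathfinish_def by blast
  obtain k where k: "continuous_on {0..1::real} k" "\<And>t. t \<in> {0..1} \<Longrightarrow> det (k t) \<noteq> 0" "k 0 = B" "k 1 = B'"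
    using assms(2) unfolding path_component_def path_def path_image_def pathstart_def pathfinish_def by blast
  have "path_component gl (g 0 ** k 0) (g 1 ** k 1)"
    by (rule path_component_glI[of "\<lambda>t. g t ** k t"]) (auto intro!: continuous_intros g(1) k(1) simp: det_mul g k)
  then show ?thesis by (simp add: g k)
qed

text \<open>Turning the normal inside a coordinate plane passes through reflections only, and these
  are invertible.\<close>

lemma mirror_path:
  assumes "m \<noteq> n"
  shows "path_component gl (mirror (cos a *\<^sub>R axis m 1 + sin a *\<^sub>R axis n 1)) (mirror (cos b *\<^sub>R axis m 1 + sin b *\<^sub>R axis n 1 :: real^'n))"
proof -
  let ?u = "\<lambda>t. cos ((1 - t) * a + t * b) *\<^sub>R axis m 1 + sin ((1 - t) * a + t * b) *\<^sub>R axis n 1 :: real^'n"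
  have o: "axis m 1 \<bullet> (axis n 1 :: real^'n) = 0" "axis n 1 \<bullet> (axis m 1 :: real^'n) = 0"
    using assms by (simp_all add: inner_axis_axis)
  have s: "axis m 1 \<bullet> (axis m 1 :: real^'n) = 1" for m by (simp add: inner_axis_axis)
  have n: "norm (cos x *\<^sub>R axis m 1 + sin x *\<^sub>R axis n 1 :: real^'n) = 1" for x
  proof -
    have "cos x * cos x + sin x * sin x = 1" using sin_cos_squared_add3[of x] by (simp add: power2_eq_square)
    then show ?thesis by (simp add: norm_eq_1 inner_add_left inner_add_right o s)
  qed
  have "path_component gl (mirror (?u 0)) (mirror (?u 1))"
  proof (rule path_component_glI[of "\<lambda>t. mirror (?u t)"])
    show "continuous_on {0..1} (\<lambda>t. mirror (?u t))" unfolding mirror_def by (intro continuous_intros)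
    show "det (mirror (?u t)) \<noteq> 0" for t by (rule det_mirror[OF n])
  qed
  then show ?thesis by simp
qed

lemma mirror_axis_path: "path_component gl (mirror (axis m 1)) (mirror (axis n 1 :: real^'n))"
proof (cases "m = n")
  case True
  then show ?thesis by (simp add: path_component_refl_eq det_mirror norm_axis_1)
next
  case False
  then show ?thesis using mirror_path[OF False, of 0 "pi/2"] by simp
qed

text \<open>Elementary matrices generate, and the claim is stable under products because the
  representatives are the identity and an involution. Diagonal matrices deform to signs, a
  transposition is a reflection itself, and a shear is scaled down to the identity.\<close>

lemma gl_components:
  fixes A :: "real^'n^'n"
  assumes "det A \<noteq> 0"
  shows "path_component gl A (mat 1) \<or> path_component gl A (mirror (axis k 1))"
proof -
  let ?P = "\<lambda>A. path_component gl A (mat 1) \<or> path_component gl A (mirror (axis k 1 :: real^'n))"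
  have rk: "mirror (axis k 1 :: real^'n) ** mirror (axis k 1) = mat 1" by (simp add: mirror_squared norm_axis_1)
  have mult: "?P (A ** B)" if "?P A" "?P B" for A B
    using that path_component_gl_mult[of A "mat 1" B "mat 1"] path_component_gl_mult[of A "mat 1" B "mirror (axis k 1)"]
      path_component_gl_mult[of A "mirror (axis k 1)" B "mat 1"] path_component_gl_mult[of A "mirror (axis k 1)" B "mirror (axis k 1)"]
    by (auto simp: rk)
  have pt: "?P B" if "path_component gl A B" "?P A" for A B
    using that path_component_trans path_component_sym by blast
  have P1: "?P (mat 1)" by (simp add: path_component_refl_eq)
  have Pr: "?P (mirror (axis m 1))" for m using mirror_axis_path by blast
  \<comment> \<open>Each minus sign is split off as a coordinate reflection, all of which are
    connected to the one along k.\<close>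
  have signs: "?P (\<chi> i j. if i = j then (if i \<in> N then -1 else 1) else 0)" if "finite N" for N
    using that
  proof (induction N rule: finite_induct)
    case empty
    have "(\<chi> i j. if i = j then (if i \<in> {} then -1 else 1) else 0) = (mat 1 :: real^'n^'n)"
      by (simp add: mat_def vec_eq_iff)
    then show ?case using P1 by simp
  next
    case (insert m N)
    let ?D = "(\<chi> i j. if i = j then (if i \<in> N then -1 else 1) else 0) :: real^'n^'n"
    have "(mirror (axis m 1) ** ?D) $ i $ j = (if i = j then (if i \<in> insert m N then -1 else 1) else 0)" for i j
    proof -
      have "(mirror (axis m 1) ** ?D) $ i $ j = (\<Sum>l\<in>UNIV. (of_bool (i = l) - 2 * axis m 1 $ i * axis m 1 $ l) *
          (if l = j then (if l \<in> N then -1 else 1) else 0))"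
        by (simp only: matrix_matrix_mult_def mirror_def vec_lambda_beta)
      also have "\<dots> = (\<Sum>l\<in>UNIV. if l = j then (of_bool (i = j) - 2 * axis m 1 $ i * axis m 1 $ j) * (if j \<in> N then -1 else 1) else 0)"
        by (rule sum.cong) auto
      also have "\<dots> = (of_bool (i = j) - 2 * axis m 1 $ i * axis m 1 $ j) * (if j \<in> N then -1 else 1)"
        by simp
      also have "\<dots> = (if i = j then (if i \<in> insert m N then -1 else 1) else 0)"
        using insert.hyps by (auto simp: axis_def)
      finally show ?thesis .
    qed
    then have "mirror (axis m 1) ** ?D = (\<chi> i j. if i = j then (if i \<in> insert m N then -1 else 1) else 0)"
      by (simp add: vec_eq_iff)
    then show ?case using mult[OF Pr insert.IH, of m] by simp
  qed
  have "det A \<noteq> 0 \<longrightarrow> ?P A"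
  proof (rule induct_matrix_elementary_alt[of "\<lambda>A. det A \<noteq> 0 \<longrightarrow> ?P A"])
    fix A B :: "real^'n^'n"
    assume "det A \<noteq> 0 \<longrightarrow> ?P A" "det B \<noteq> 0 \<longrightarrow> ?P B"
    then show "det (A ** B) \<noteq> 0 \<longrightarrow> ?P (A ** B)" using mult by (auto simp: det_mul)
  next
    fix A :: "real^'n^'n" and i assume "row i A = 0"
    then show "det A \<noteq> 0 \<longrightarrow> ?P A" using det_zero_row(2) by blast
  next
    fix A :: "real^'n^'n" assume A: "\<And>i j. i \<noteq> j \<Longrightarrow> A $ i $ j = 0"
    show "det A \<noteq> 0 \<longrightarrow> ?P A"
    proof
      assume "det A \<noteq> 0"
      then have nz: "A $ i $ i \<noteq> 0" for i using det_diagonal[of A] A by auto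
      define N where "N = {i. A $ i $ i < 0}"
      let ?f = "\<lambda>t. (\<chi> i j. if i = j then (1 - t) * (if i \<in> N then -1 else 1) + t * A $ i $ i else 0) :: real^'n^'n"
      have "path_component gl (?f 0) (?f 1)"
      proof (rule path_component_glI)
        show "continuous_on {0..1} ?f"
        proof (intro continuous_on_vec_lambda)
          fix i j show "continuous_on {0..1} (\<lambda>t. if i = j then (1 - t) * (if i \<in> N then -1 else 1) + t * A $ i $ i else 0)"
            by (cases "i = j") (auto intro!: continuous_intros)
        qed
        fix t assume t: "t \<in> {0..1::real}"
        have "(1 - t) * (if i \<in> N then -1 else 1) + t * A $ i $ i \<noteq> 0" for i
        proof (cases "i \<in> N")
          case True
          have "t * A $ i $ i < 0 \<or> t = 0" using t True by (auto simp: N_def mult_pos_neg)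
          then show ?thesis using True t by auto
        next
          case False
          then have "A $ i $ i > 0" using nz[of i] by (simp add: N_def)
          then have "t * A $ i $ i > 0 \<or> t = 0" using t by auto
          then show ?thesis using False t by auto
        qed
        then show "det (?f t) \<noteq> 0" by (subst det_diagonal) auto
      qed
      moreover have "?f 0 = (\<chi> i j. if i = j then (if i \<in> N then -1 else 1) else 0)" by (simp cong: if_cong)
      moreover have "?f 1 = A" using A by (simp add: vec_eq_iff)
      ultimately show "?P A" using pt signs[of N] by simp
    qed
  next
    fix m n :: 'n assume mn: "m \<noteq> n"
    \<comment> \<open>Exchanging two coordinates is the reflection whose normal bisects the one axis
      and the negative of the other, at angle -pi/4.\<close>
    have "(\<chi> i j. mat 1 $ i $ Transposition.transpose m n j) = mirror (cos (- pi/4) *\<^sub>R axis m 1 + sin (- pi/4) *\<^sub>R axis n 1 :: real^'n)"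
      using mn by (auto simp: vec_eq_iff mirror_def axis_def mat_def Transposition.transpose_def cos_45 sin_45)
    moreover have "?P (mirror (cos (- pi/4) *\<^sub>R axis m 1 + sin (- pi/4) *\<^sub>R axis n 1))"
      using pt[OF mirror_path[OF mn, of 0 "- pi/4"]] Pr[of m] by simp
    ultimately show "det ((\<chi> i j. mat 1 $ i $ Transposition.transpose m n j) :: real^'n^'n) \<noteq> 0 \<longrightarrow>
      ?P (\<chi> i j. mat 1 $ i $ Transposition.transpose m n j)" by simp
  next
    fix m n :: 'n assume mn: "m \<noteq> n"
    let ?f = "\<lambda>t. (\<chi> i j. if i = m \<and> j = n then t else of_bool (i = j)) :: real^'n^'n"
    have d: "det (?f t) = 1" for t
    proof -
      have "?f t = (\<chi> k. if k = m then row m (mat 1) + t *s row n (mat 1) else row k (mat 1))"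
        using mn by (auto simp: vec_eq_iff row_def mat_def)
      then show ?thesis using det_row_operation[OF mn, of "mat 1" t] by simp
    qed
    have "path_component gl (?f 0) (?f 1)"
    proof (rule path_component_glI)
      show "continuous_on {0..1} ?f"
      proof (intro continuous_on_vec_lambda)
        fix i j show "continuous_on {0..1} (\<lambda>t. if i = m \<and> j = n then t else of_bool (i = j))"
          by (cases "i = m \<and> j = n") (auto intro!: continuous_intros)
      qed
    qed (simp add: d)
    moreover have "?f 0 = mat 1" using mn by (auto simp: vec_eq_iff mat_def)
    moreover have "?f 1 = (\<chi> i j. of_bool (i = m \<and> j = n \<or> i = j))" by (auto simp: vec_eq_iff)
    ultimately show "det ((\<chi> i j. of_bool (i = m \<and> j = n \<or> i = j)) :: real^'n^'n) \<noteq> 0 \<longrightarrow> ?P (\<chi> i j. of_bool (i = m \<and> j = n \<or> i = j))"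
      using pt P1 by simp
  qed
  then show ?thesis using assms by blast
qed

lemma localhom_kink_ball:
  fixes m :: "real \<times> (real^'n) \<Rightarrow> real^'n"
  assumes m: "continuous_on ({0..1} \<times> UNIV) m"
    and out: "\<And>t q. t \<in> {0..1} \<Longrightarrow> q \<notin> cball z \<delta> \<Longrightarrow> norm (m (t, q)) \<ge> 1"
  shows "localhom (cball z \<delta>) (\<lambda>q. kink (m (0, q))) (\<lambda>q. kink (m (1, q)))"
  by (rule localhomI[OF lagc_compose[OF kink_lagc m]]) (auto intro!: kink_outside out)

text \<open>D is enlarged by the factor M and afterwards deformed along a path of invertible
  matrices; compactness gives the path a positive least expansion. Every M from some bound on is
  allowed because the kink must later be small compared with the spheres placed next to it.\<close>

lemma kink_normalize:
  fixes D :: "real^'n \<Rightarrow> real^'n"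
  assumes D: "linear D" and big: "\<And>v. norm v \<ge> \<delta> \<Longrightarrow> norm (D v) \<ge> 1" and \<delta>: "\<delta> > 0"
  obtains M0 X where "M0 > 0" "X = mat 1 \<or> X = mirror (axis k 1)"
    "\<And>M. M \<ge> M0 \<Longrightarrow> localhom (cball z \<delta>) (\<lambda>q. kink (D (q - z))) (\<lambda>q. kink (M *\<^sub>R (X *v (q - z))))"
proof -
  have "inj D"
  proof (subst linear_injective_0[OF D], intro allI impI)
    fix v assume v: "D v = 0"
    show "v = 0"
    proof (rule ccontr)
      assume "v \<noteq> 0"
      then have "norm ((\<delta> / norm v) *\<^sub>R v) \<ge> \<delta>" using \<delta> by simp
      then have "norm (D ((\<delta> / norm v) *\<^sub>R v)) \<ge> 1" by (rule big)
      then show False by (simp add: linear_scale[OF D] v)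
    qed
  qed
  then have "det (matrix D) \<noteq> 0" using det_nz_iff_inj[OF D] by simp
  then obtain X where X: "X = mat 1 \<or> X = mirror (axis k 1)" "path_component gl (matrix D) X"
    using gl_components by blast
  obtain g where g: "continuous_on {0..1::real} g" "\<And>t. t \<in> {0..1::real} \<Longrightarrow> det (g t) \<noteq> 0" "g 0 = matrix D" "g 1 = X"
    using X(2) unfolding path_component_def path_def path_image_def pathstart_def pathfinish_def by blast
  have cg: "continuous_on ({0..1} \<times> S) (\<lambda>x. g (fst x) *v (f (snd x)))" if "continuous_on S f" for S :: "(real^'n) set" and f
    unfolding matrix_vector_mult_def
    by (intro continuous_intros continuous_on_compose2[OF g(1)] continuous_on_compose2[OF that]) auto
  let ?S = "{0..1::real} \<times> sphere (0::real^'n) 1"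
  have nz: "g t *v v \<noteq> 0" if "t \<in> {0..1}" "v \<noteq> 0" for t v
    using g(2)[OF that(1)] that(2) by (metis det_nz_iff_inj inj_matrix_vector_mult invertible_det_nz matrix_vector_mult_0_right injD)
  have ne: "?S \<noteq> {}" using norm_axis_1 by (auto intro: exI[of _ "axis undefined 1"])
  have "\<exists>c>0. \<forall>x\<in>?S. c \<le> norm (g (fst x) *v snd x)"
  proof -
    obtain x0 where x0: "x0 \<in> ?S" "\<And>x. x \<in> ?S \<Longrightarrow> norm (g (fst x0) *v snd x0) \<le> norm (g (fst x) *v snd x)"
      using continuous_attains_inf[OF _ ne continuous_on_norm[OF cg[OF continuous_on_id]]]
      by (auto simp: compact_Times)
    have "norm (snd x0) = 1" "fst x0 \<in> {0..1}" using x0(1) by (auto simp: mem_Times_iff)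
    then have "norm (g (fst x0) *v snd x0) > 0" using nz[of "fst x0" "snd x0"] by fastforce
    then show ?thesis using x0(2) by blast
  qed
  then obtain c where c: "c > 0" "\<And>x. x \<in> ?S \<Longrightarrow> c \<le> norm (g (fst x) *v snd x)" by blast
  have low: "norm (g t *v v) \<ge> c * norm v" if "t \<in> {0..1}" for t v
  proof (cases "v = 0")
    case False
    then have "c \<le> norm (g t *v (v /\<^sub>R norm v))" using c(2)[of "(t, v /\<^sub>R norm v)"] that by simp
    then show ?thesis using False by (simp add: matrix_vector_mult_scaleR field_simps)
  qed simp
  \<comment> \<open>The bound 1 keeps the scaling of D from shrinking values outside the ball; the
    bound 1/(c * \<delta>) keeps the whole matrix path at norm at least 1 there.\<close>
  define M0 where "M0 = max 1 (1 / (c * \<delta>))"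
  have "localhom (cball z \<delta>) (\<lambda>q. kink (D (q - z))) (\<lambda>q. kink (M *\<^sub>R (X *v (q - z))))" if M: "M \<ge> M0" for M
  proof -
    have M1: "M \<ge> 1" and Mc: "M * (c * \<delta>) \<ge> 1"
    proof -
      show "M \<ge> 1" using M by (simp add: M0_def)
      have "1 / (c * \<delta>) \<le> M" using M by (simp add: M0_def)
      then show "M * (c * \<delta>) \<ge> 1" using c(1) \<delta> by (simp add: pos_divide_le_eq)
    qed
    have "localhom (cball z \<delta>) (\<lambda>q. kink (((1 - 0) + 0 * M) *\<^sub>R D (q - z))) (\<lambda>q. kink (((1 - 1) + 1 * M) *\<^sub>R D (q - z)))"
    proof (rule localhom_kink_ball[of "\<lambda>x. ((1 - fst x) + fst x * M) *\<^sub>R D (snd x - z)", unfolded fst_conv snd_conv])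
      show "continuous_on ({0..1} \<times> UNIV) (\<lambda>x. ((1 - fst x) + fst x * M) *\<^sub>R D (snd x - z))"
        by (intro continuous_intros linear_continuous_on_compose[OF _ D])
      fix t q assume t: "t \<in> {0..1::real}" and q: "q \<notin> cball z \<delta>"
      have "t * 1 \<le> t * M" using t M1 by (intro mult_left_mono) auto
      then have "(1 - t) + t * M \<ge> 1" by simp
      moreover have "norm (D (q - z)) \<ge> 1" using q by (intro big) (simp add: dist_norm norm_minus_commute)
      ultimately have "((1 - t) + t * M) * norm (D (q - z)) \<ge> 1 * 1" by (intro mult_mono) auto
      then show "norm (((1 - t) + t * M) *\<^sub>R D (q - z)) \<ge> 1"
        unfolding norm_scaleR using \<open>(1 - t) + t * M \<ge> 1\<close> by simp
    qed
    then have 1: "localhom (cball z \<delta>) (\<lambda>q. kink (D (q - z))) (\<lambda>q. kink (M *\<^sub>R D (q - z)))" by simp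
    have "localhom (cball z \<delta>) (\<lambda>q. kink (M *\<^sub>R (g 0 *v (q - z)))) (\<lambda>q. kink (M *\<^sub>R (g 1 *v (q - z))))"
    proof (rule localhom_kink_ball[of "\<lambda>x. M *\<^sub>R (g (fst x) *v (snd x - z))", unfolded fst_conv snd_conv])
      show "continuous_on ({0..1} \<times> UNIV) (\<lambda>x. M *\<^sub>R (g (fst x) *v (snd x - z)))"
        by (intro continuous_on_scaleR continuous_on_const cg continuous_intros)
      fix t q assume t: "t \<in> {0..1::real}" and q: "q \<notin> cball z \<delta>"
      have "c * \<delta> \<le> c * norm (q - z)" using q c(1) by (simp add: dist_norm norm_minus_commute)
      also have "\<dots> \<le> norm (g t *v (q - z))" by (rule low[OF t])
      finally have "M * (c * \<delta>) \<le> M * norm (g t *v (q - z))" using M1 by (intro mult_left_mono) auto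
      then have "1 \<le> M * norm (g t *v (q - z))" using Mc by linarith
      then show "norm (M *\<^sub>R (g t *v (q - z))) \<ge> 1" using M1 by simp
    qed
    moreover have "g 0 *v v = D v" for v by (simp add: g(3) matrix_works D)
    ultimately show ?thesis using localhom_trans[OF 1] by (simp add: g(4))
  qed
  moreover have "M0 > 0" by (simp add: M0_def)
  ultimately show ?thesis using that X(1) by blast
qed

text \<open>A tuple \<open>(c, R, h, e)\<close> stands for the sphere of centre \<open>c\<close> and radius \<open>R\<close> with tubular neighbourhood
  of half-width \<open>h\<close>, co-oriented outwards if \<open>e = 1\<close> and inwards if \<open>e = - 1\<close>.\<close>

fun shell :: "(real^'n) \<times> real \<times> real \<times> real \<Rightarrow> (real^'n) set" where
  "shell (c, R, h, e) = {q. \<bar>norm (q - c) - R\<bar> \<le> h}"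

text \<open>Going outwards across the shell, the angle runs from -pi to 0 for e = 1 and from 0 to
  -pi for e = - 1. Both end values give \<open>iR\<close>.\<close>

fun shell_map :: "(real^'n) \<times> real \<times> real \<times> real \<Rightarrow> real^'n \<Rightarrow> (complex^'n) set" where
  "shell_map (c, R, h, e) q = (if \<bar>norm (q - c) - R\<bar> \<le> h
     then phase (cvec (sgn (q - c)) 0) (pi / 2 * (e * (norm (q - c) - R) / h) - pi / 2) ` iR else iR)"

definition shells_ok :: "((real^'n) \<times> real \<times> real \<times> real) set \<Rightarrow> bool" where
  "shells_ok J \<longleftrightarrow> finite J \<and> (\<forall>c R h e. (c, R, h, e) \<in> J \<longrightarrow> 0 < h \<and> h < R \<and> (e = 1 \<or> e = - 1)) \<and>
     disjoint_family_on shell J"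

lemma shell_map_outside: "q \<notin> shell s \<Longrightarrow> shell_map s q = iR"
  by (cases s) auto

lemma closed_shell: "closed (shell s)"
  by (cases s) (auto intro!: closed_Collect_le continuous_intros)

lemma bounded_shell: "bounded (shell s)"
proof -
  obtain c R h e where s: "s = (c, R, h, e)" by (cases s) auto
  have "shell s \<subseteq> cball c (R + h)" by (auto simp: s dist_norm norm_minus_commute)
  then show ?thesis using bounded_cball bounded_subset by blast
qed

lemma phase_add:
  assumes "norm u = 1" shows "phase u (a + b) v = phase u a (phase u b v)"
  by (simp add: phase_def herm_simps herm_norm1[OF assms] cis_mult[symmetric] vec_eq_iff algebra_simps)

lemma phase_pi_iR: assumes "norm x = 1" shows "phase (cvec x 0) pi ` iR = iR"
proof (rule lagrangian_image_eq[OF phase_uni lagrangian_iR lagrangian_iR])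
  show "norm (cvec x 0) = 1" using assms by simp
  fix z :: "complex^'a" assume "z \<in> iR"
  then obtain b where "z = cvec 0 b" by (auto simp: iR_def)
  then show "phase (cvec x 0) pi z \<in> iR" by (simp add: phase_def herm_rv iR_iff)
qed

lemma phase_add_pi_iR: assumes "norm x = 1" shows "phase (cvec x 0) (a + pi) ` iR = phase (cvec x 0) a ` iR"
proof -
  have "phase (cvec x 0) (a + pi) ` iR = phase (cvec x 0) a ` (phase (cvec x 0) pi ` iR)"
    unfolding image_image by (rule image_cong) (use assms in \<open>auto intro!: phase_add\<close>)
  then show ?thesis by (simp add: phase_pi_iR assms)
qed

lemma phase_minus_pi_iR: "norm x = 1 \<Longrightarrow> phase (cvec x 0) (- pi) ` iR = iR"
  using phase_add_pi_iR[of x "- pi"] by simp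

lemma uni_phase: assumes "uni P" shows "P (phase w \<theta> v) = phase (P w) \<theta> (P v)"
  by (simp add: phase_def uniD[OF assms])

lemma phase_pi_cvec: "phase (cvec u 0) pi (cvec x 0) = cvec (mirror u *v x) 0"
  by (simp add: phase_def herm_rv mirror_mult vec_eq_iff complex_eq_iff)

lemma norm_mirror: assumes "norm u = 1" shows "norm (mirror u *v y) = norm y"
  using uni_norm[OF phase_uni[of "cvec u 0" pi], of "cvec y 0"] assms by (simp add: phase_pi_cvec)

text \<open>\<open>phase (cvec u 0) pi\<close> is the complexified reflection. It preserves
  \<open>iR\<close> and conjugates the phase along x into the phase along the reflected x.\<close>

lemma kink_mirror: assumes u: "norm u = 1" shows "phase (cvec u 0) pi ` kink y = kink (mirror u *v y)"
proof (cases "norm y \<le> 1/3")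
  case True
  then show ?thesis using u by (simp add: kink_def norm_mirror phase_pi_iR)
next
  case False
  let ?P = "phase (cvec u 0) pi" and ?x = "y /\<^sub>R norm y"
  have U: "uni ?P" using u by (intro phase_uni) simp
  have x: "?P (cvec ?x 0) = cvec (mirror u *v y /\<^sub>R norm y) 0"
    by (simp add: phase_pi_cvec matrix_vector_mult_scaleR)
  have "?P ` kink y = ?P ` phase (cvec ?x 0) (- ang (norm y)) ` iR" using False by (simp add: kink_def)
  also have "\<dots> = phase (?P (cvec ?x 0)) (- ang (norm y)) ` (?P ` iR)"
    unfolding image_image by (rule image_cong) (auto simp: uni_phase[OF U])
  also have "\<dots> = kink (mirror u *v y)"
    unfolding x phase_pi_iR[OF u] using False by (simp add: kink_def norm_mirror[OF u])
  finally show ?thesis .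
qed

text \<open>The turning zone 1/3 <= M |q - z| <= 1 has mean radius 2/(3 M) and half-width 1/(3 M),
  and \<open>ang\<close> is linear there.\<close>

lemma kink_eq_shell_map:
  assumes M: "M > 0"
  shows "kink (M *\<^sub>R (q - z)) = shell_map (z, 2 / (3 * M), 1 / (3 * M), 1) q"
proof -
  define r where "r = M * norm (q - z)"
  have nr: "norm (M *\<^sub>R (q - z)) = r" using M by (simp add: r_def)
  have eq: "norm (q - z) = r / M" using M by (simp add: r_def)
  have in_iff: "\<bar>norm (q - z) - 2 / (3 * M)\<bar> \<le> 1 / (3 * M) \<longleftrightarrow> 1/3 \<le> r \<and> r \<le> 1"
    unfolding eq using M by (auto simp: abs_le_iff field_simps)
  have ang: "pi / 2 * (1 * (norm (q - z) - 2 / (3 * M)) / (1 / (3 * M))) - pi / 2 = pi / 2 * (3 * r - 2) - pi / 2"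
    unfolding eq using M by (simp add: field_simps)
  have dir: "sgn (q - z) = (M *\<^sub>R (q - z)) /\<^sub>R norm (M *\<^sub>R (q - z))"
    using M by (simp add: sgn_div_norm)
  consider "r < 1/3" | "r = 1/3" | "1/3 < r" "r \<le> 1" | "r > 1" by linarith
  then show ?thesis
  proof cases
    case 2
    then have "q \<noteq> z" using M by (auto simp: r_def)
    then have "norm (sgn (q - z)) = 1" by (simp add: norm_sgn)
    then show ?thesis using 2 nr in_iff by (simp only: shell_map.simps ang) (simp add: kink_def phase_minus_pi_iR)
  next
    case 3
    have "max 0 (min 1 ((1 - r) * 3 / 2)) = (1 - r) * 3 / 2" using 3 by auto
    then have a: "- ang r = pi / 2 * (3 * r - 2) - pi / 2" by (simp add: ang_def field_simps)
    show ?thesis using 3 in_iff unfolding kink_def nr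
      by (simp only: shell_map.simps ang a dir nr) simp
  next
    case 4
    then show ?thesis using in_iff kink_outside[of "M *\<^sub>R (q - z)"] nr by (simp only: shell_map.simps) simp
  qed (use nr in_iff in \<open>simp add: kink_def\<close>)
qed

text \<open>Everything is turned by \<open>phase\<close> along N through the angle t \<psi>. Near z
  the direction is constantly x0 and \<psi> is pi, so at t = 1 the reflection is undone. Away from
  z, N is radial about a, and the rise and fall of \<psi> leave an outward and an inward sphere
  about a. As a lies at distance d from z in direction -x0, the radial direction at z is x0, so the
  two choices of N can be interpolated.\<close>

lemma reflected_kink:
  fixes z x0 :: "real^'n"
  assumes d: "d > 0" and x0: "norm x0 = 1" and M: "M \<ge> 8 / d"
  defines "a \<equiv> z - d *\<^sub>R x0"
  defines "J \<equiv> {(z, 2 / (3 * M), 1 / (3 * M), 1), (a, 3 * d / 8, d / 8, 1), (a, 13 * d / 8, d / 8, - 1)}"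
  shows "localhom (cball z (3 * d)) (\<lambda>q. kink (M *\<^sub>R (mirror x0 *v (q - z)))) (glue J shell shell_map)"
    and "shells_ok J" and "\<And>s. s \<in> J \<Longrightarrow> shell s \<subseteq> cball z (3 * d)"
proof -
  have M0: "M > 0" using d M by (meson divide_pos_pos less_le_trans zero_less_numeral)
  have Md: "M * d \<ge> 8" using M d by (simp add: pos_divide_le_eq)
  have M1: "1 / M \<le> d / 8" using Md M0 by (simp add: field_simps)
  let ?s1 = "(z, 2 / (3 * M), 1 / (3 * M), 1::real)" and ?s2 = "(a, 3 * d / 8, d / 8, 1::real)"
    and ?s3 = "(a, 13 * d / 8, d / 8, - 1::real)"
  define r s where "r = (\<lambda>q. norm (q - a))" and "s = (\<lambda>q. norm (q - z))"
  have za: "z - a = d *\<^sub>R x0" by (simp add: a_def)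
  have nza: "norm (z - a) = d" using x0 d by (simp add: za)
  have tri: "r q \<le> s q + d" "d \<le> s q + r q" "s q \<le> r q + d" for q
    using norm_triangle_ineq[of "q - z" "z - a"] norm_triangle_ineq4[of "q - a" "q - z"] norm_triangle_ineq4[of "q - a" "z - a"] nza
    by (simp_all add: r_def s_def)
  have sh1: "q \<in> shell ?s1 \<longleftrightarrow> 1 / (3 * M) \<le> s q \<and> s q \<le> 1 / M" for q
    using M0 by (auto simp: s_def abs_le_iff field_simps)
  have sh2: "q \<in> shell ?s2 \<longleftrightarrow> d / 4 \<le> r q \<and> r q \<le> d / 2" for q
    by (auto simp: r_def abs_le_iff field_simps)
  have sh3: "q \<in> shell ?s3 \<longleftrightarrow> 3 * d / 2 \<le> r q \<and> r q \<le> 7 * d / 4" for q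
    by (auto simp: r_def abs_le_iff field_simps)
  have near: "7 * d / 8 \<le> r q" "r q \<le> 9 * d / 8" if "s q \<le> d / 8" for q
    using tri[of q] that by (auto simp: field_simps)
  have not23: "q \<notin> shell ?s2" "q \<notin> shell ?s3" if "s q \<le> d / 8" for q
    unfolding sh2 sh3 using near[OF that] d by auto
  have disj: "disjoint_family_on shell J"
  proof -
    have "shell ?s1 \<inter> shell ?s2 = {}" "shell ?s1 \<inter> shell ?s3 = {}"
      using not23 sh1 M1 by (meson disjoint_iff order_trans)+
    moreover have "shell ?s2 \<inter> shell ?s3 = {}"
      unfolding disjoint_iff sh2 sh3 using d by auto
    ultimately show ?thesis unfolding disjoint_family_on_def J_def by (auto simp del: shell.simps)
  qed
  have "1 / (3 * M) < 2 / (3 * M)" using M0 by (intro divide_strict_right_mono) auto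
  then have "h < R" if "(c, R, h, e) \<in> J" for c R h e
    using that d unfolding J_def by auto
  moreover have "0 < h \<and> (e = 1 \<or> e = - 1)" if "(c, R, h, e) \<in> J" for c R h e
    using that d M0 unfolding J_def by auto
  moreover have "finite J" by (simp add: J_def)
  ultimately show "shells_ok J" unfolding shells_ok_def using disj by blast
  show "shell t \<subseteq> cball z (3 * d)" if t: "t \<in> J" for t
  proof
    fix q assume q: "q \<in> shell t"
    have "s q \<le> 3 * d"
    proof -
      consider "t = ?s1" | "t = ?s2" | "t = ?s3" using t unfolding J_def by blast
      then show ?thesis
      proof cases
        case 1
        then show ?thesis using q sh1[of q] M1 d by auto
      next
        case 2
        then show ?thesis using q sh2[of q] tri(3)[of q] d by auto
      next
        case 3
        then show ?thesis using q sh3[of q] tri(3)[of q] d by auto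
      qed
    qed
    then show "q \<in> cball z (3 * d)" by (simp add: s_def dist_norm norm_minus_commute)
  qed
  \<comment> \<open>0 within d/8 of z, a ball that contains the support of the kink, and 1 beyond
    d/4.\<close>
  define \<kappa> where "\<kappa> = (\<lambda>q. max 0 (min 1 (8 * s q / d - 1)))"
  define N where "N = (\<lambda>q. \<kappa> q *\<^sub>R (q - z) + (z - a))"
  \<comment> \<open>Rises from 0 to pi on the radii d/4 to d/2 about a and falls back on 3d/2 to
    7d/4, which are the second and the third shell.\<close>
  define \<psi> where "\<psi> = (\<lambda>q. pi * max 0 (min 1 (min (4 * r q / d - 1) (7 - 4 * r q / d))))"
  let ?L = "\<lambda>q. kink (M *\<^sub>R (mirror x0 *v (q - z)))"
  define H where "H = (\<lambda>x. if r (snd x) \<le> d / 4 then iR else phase (cvec (sgn (N (snd x))) 0) (fst x * \<psi> (snd x)) ` ?L (snd x))"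
  have \<kappa>1: "\<kappa> q = 1" if "s q \<ge> d / 4" for q
  proof -
    have "8 * s q / d \<ge> 2" using that d by (simp add: pos_le_divide_eq)
    then show ?thesis by (simp add: \<kappa>_def)
  qed
  have \<kappa>0: "\<kappa> q = 0" if "s q \<le> d / 8" for q
  proof -
    have "8 * s q / d \<le> 1" using that d by (simp add: pos_divide_le_eq)
    then show ?thesis by (simp add: \<kappa>_def)
  qed
  have N1: "N q = q - a" if "s q \<ge> d / 4" for q using \<kappa>1[OF that] by (simp add: N_def)
  \<comment> \<open>A zero of N would be at distance at least d from z; there N is q - a, which
    vanishes only at the excluded point a.\<close>
  have N0: "N q \<noteq> 0" if "r q \<ge> d / 4" for q
  proof
    assume "N q = 0"
    then have "\<kappa> q *\<^sub>R (q - z) = - (z - a)" unfolding N_def by (rule eq_neg_iff_add_eq_0[THEN iffD2])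
    then have "norm (\<kappa> q *\<^sub>R (q - z)) = d" using nza by (simp only: norm_minus_cancel)
    moreover have "0 \<le> \<kappa> q" "\<kappa> q \<le> 1" by (auto simp: \<kappa>_def)
    ultimately have "d \<le> s q" by (simp add: s_def) (metis mult_left_le_one_le norm_ge_zero)
    then have "N q = q - a" using d by (intro N1) auto
    then show False using \<open>N q = 0\<close> that d by (simp add: r_def)
  qed
  have Lout: "?L q = iR" if "s q \<ge> d / 8" for q
  proof (rule kink_outside)
    have "M * (d / 8) \<le> M * s q" using that M0 by (intro mult_left_mono) auto
    then have "1 \<le> M * s q" using Md by linarith
    then show "1 \<le> norm (M *\<^sub>R (mirror x0 *v (q - z)))" using M0 by (simp add: norm_mirror[OF x0] s_def)
  qed
  have \<psi>eq: "\<psi> q = pi" if "d / 2 \<le> r q" "r q \<le> 3 * d / 2" for q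
  proof -
    have "4 * r q / d \<ge> 2" "4 * r q / d \<le> 6" using that d by (simp_all add: pos_le_divide_eq pos_divide_le_eq)
    then show ?thesis by (simp add: \<psi>_def)
  qed
  have \<psi>0: "\<psi> q = 0" if "r q = d / 4 \<or> 7 * d / 4 \<le> r q" for q
  proof -
    have "4 * r q / d = 1 \<or> 4 * r q / d \<ge> 7" using that d by (auto simp: pos_le_divide_eq)
    then show ?thesis by (auto simp: \<psi>_def)
  qed
  have Hfar: "H x = phase (cvec (sgn (N (snd x))) 0) (fst x * \<psi> (snd x)) ` ?L (snd x)" if "r (snd x) \<ge> d / 4" for x
  proof (cases "r (snd x) = d / 4")
    case True
    have "s (snd x) \<ge> d / 8" using tri(2)[of "snd x"] True d by simp
    then show ?thesis using True \<psi>0[of "snd x"] Lout[of "snd x"] by (simp add: H_def)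
  qed (use that in \<open>simp add: H_def\<close>)
  show "localhom (cball z (3 * d)) ?L (glue J shell shell_map)"
  proof (rule localhomI[of H])
    let ?A = "{0..1::real} \<times> {q. r q \<le> d / 4}" and ?B = "{0..1::real} \<times> {q. d / 4 \<le> r q}"
    have U: "{0..1::real} \<times> UNIV = ?A \<union> ?B" by auto
    have "continuous_on UNIV r" "continuous_on UNIV s" unfolding r_def s_def by (intro continuous_intros)+
    then have cr: "continuous_on S r" and cs: "continuous_on S s" for S by (auto intro: continuous_on_subset)
    have cN: "continuous_on S N" for S
      unfolding N_def \<kappa>_def by (intro continuous_intros cs) (use d in auto)
    have c\<psi>: "continuous_on S \<psi>" for S
      unfolding \<psi>_def by (intro continuous_intros cr) (use d in auto)
    have clA: "closed ?A" "closed ?B"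
      by (intro closed_Times closed_atLeastAtMost closed_Collect_le continuous_intros cr)+
    have A: "lagc ?A H"
      by (rule iffD2[OF lagc_cong lagc_const[OF lagrangian_iR]]) (auto simp: H_def)
    have "unic ?B (\<lambda>x. phase (cvec (sgn (N (snd x))) 0) (fst x * \<psi> (snd x)))"
    proof (rule phase_unic)
      show "continuous_on ?B (\<lambda>x. cvec (sgn (N (snd x))) 0)"
        unfolding sgn_div_norm
        by (intro continuous_intros continuous_on_compose2[OF cN[of UNIV]]) (use N0 in auto)
      show "continuous_on ?B (\<lambda>x. fst x * \<psi> (snd x))"
        by (intro continuous_intros continuous_on_compose2[OF c\<psi>[of UNIV]]) auto
      show "norm (cvec (sgn (N (snd x))) 0) = 1" if "x \<in> ?B" for x using N0 that by (auto simp: norm_sgn)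
    qed
    moreover have "lagc ?B (\<lambda>x. ?L (snd x))"
    proof (rule lagc_compose[OF kink_lagc])
      show "continuous_on ?B (\<lambda>x. M *\<^sub>R (mirror x0 *v (snd x - z)))"
        by (intro continuous_on_scaleR continuous_on_const linear_continuous_on_compose[OF _ matrix_vector_mul_linear]
            continuous_on_diff continuous_on_snd continuous_on_id)
    qed simp
    ultimately have "lagc ?B (\<lambda>x. phase (cvec (sgn (N (snd x))) 0) (fst x * \<psi> (snd x)) ` ?L (snd x))"
      by (rule lagc_unic)
    then have B: "lagc ?B H" by (rule iffD2[OF lagc_cong, rotated]) (use Hfar in auto)
    have "lagc (?A \<union> ?B) H" by (rule lagc_closed_Un[OF A B]) (intro closed_subset clA Un_upper1 Un_upper2)+
    then show "lagc ({0..1} \<times> UNIV) H" by (subst U)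
    show "H (0, q) = ?L q" for q
      using Lout[of q] tri(2)[of q] d by (cases "r q \<le> d / 4") (auto simp: H_def)
    show "H (t, q) = iR" if "q \<notin> cball z (3 * d)" for t q
    proof -
      have sq: "s q > 3 * d" using that by (simp add: s_def dist_norm norm_minus_commute)
      then have "r q \<ge> 7 * d / 4" using tri(3)[of q] d by simp
      then show ?thesis using \<psi>0[of q] Lout[of q] sq d by (simp add: H_def)
    qed
    show "H (1, q) = glue J shell shell_map q" for q
    proof -
      have gl: "glue J shell shell_map q = shell_map t q" if "t \<in> J" "q \<in> shell t" for t
        by (rule glue_eq[OF disj that])
      have gl0: "glue J shell shell_map q = iR" if "q \<notin> shell ?s1" "q \<notin> shell ?s2" "q \<notin> shell ?s3"
        by (rule glue_outside) (use that in \<open>auto simp: J_def simp del: shell.simps\<close>)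
      show ?thesis
      proof (cases "s q \<le> d / 8")
        case True
        note nr = near[OF True]
        have "\<psi> q = pi" using nr d by (intro \<psi>eq) auto
        moreover have "sgn (N q) = x0" using \<kappa>0[OF True] d x0 by (simp add: N_def za sgn_div_norm)
        ultimately have "H (1, q) = phase (cvec x0 0) pi ` ?L q"
          using nr d by (subst Hfar) auto
        also have "\<dots> = kink (M *\<^sub>R (q - z))"
          unfolding kink_mirror[OF x0] by (simp add: matrix_vector_mult_scaleR mirror_mirror[OF x0])
        also have "\<dots> = shell_map ?s1 q" by (rule kink_eq_shell_map[OF M0])
        also have "\<dots> = glue J shell shell_map q"
        proof (cases "q \<in> shell ?s1")
          case in1: True
          then show ?thesis using gl[of ?s1] by (simp add: J_def)
        next
          case False
          then show ?thesis using gl0 not23[OF True] shell_map_outside by metis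
        qed
        finally show ?thesis .
      next
        case False
        then have LiR: "?L q = iR" by (intro Lout) simp
        have no1: "q \<notin> shell ?s1" using sh1[of q] False M1 by auto
        consider "r q < d / 4" | "d / 4 \<le> r q" "r q \<le> d / 2" | "d / 2 < r q" "r q < 3 * d / 2"
          | "3 * d / 2 \<le> r q" "r q \<le> 7 * d / 4" | "7 * d / 4 < r q" by linarith
        then show ?thesis
        proof cases
          case 1
          then show ?thesis using gl0[OF no1] d unfolding sh2 sh3 by (simp add: H_def)
        next
          case 2
          then have "s q \<ge> d / 4" using tri(2)[of q] d by simp
          then have N: "N q = q - a" by (rule N1)
          have u: "norm (sgn (q - a)) = 1" using N0[of q] 2 N by (simp add: norm_sgn)
          have "1 \<le> 4 * r q / d" "4 * r q / d \<le> 2" using 2 d by (simp_all add: pos_le_divide_eq pos_divide_le_eq)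
          then have "\<psi> q = pi * (4 * r q / d - 1)" by (simp add: \<psi>_def)
          also have "\<dots> = pi / 2 * (1 * (norm (q - a) - 3 * d / 8) / (d / 8)) - pi / 2 + pi"
            using d by (simp add: r_def field_simps)
          finally have e: "\<psi> q = pi / 2 * (1 * (norm (q - a) - 3 * d / 8) / (d / 8)) - pi / 2 + pi" .
          have "H (1, q) = phase (cvec (sgn (q - a)) 0) (\<psi> q) ` iR"
            using 2 d by (subst Hfar) (simp_all add: LiR N)
          also have "\<dots> = phase (cvec (sgn (q - a)) 0) (pi / 2 * (1 * (norm (q - a) - 3 * d / 8) / (d / 8)) - pi / 2) ` iR"
            unfolding e by (rule phase_add_pi_iR[OF u])
          also have "\<dots> = shell_map ?s2 q" using sh2[of q] 2 by simp
          finally show ?thesis using gl[of ?s2] sh2[of q] 2 by (simp add: J_def del: shell.simps shell_map.simps)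
        next
          case 3
          then have "\<psi> q = pi" by (intro \<psi>eq) auto
          moreover have "norm (sgn (N q)) = 1" using N0[of q] 3 d by (simp add: norm_sgn)
          ultimately have "H (1, q) = iR" using 3 d phase_pi_iR by (subst Hfar) (simp_all add: LiR)
          moreover have "q \<notin> shell ?s2" "q \<notin> shell ?s3" unfolding sh2 sh3 using 3 by auto
          ultimately show ?thesis using gl0[OF no1] by simp
        next
          case 4
          then have "s q \<ge> d / 4" using tri(1)[of q] d by simp
          then have N: "N q = q - a" by (rule N1)
          have u: "norm (sgn (q - a)) = 1" using N0[of q] 4 N d by (simp add: norm_sgn)
          have "6 \<le> 4 * r q / d" "4 * r q / d \<le> 7" using 4 d by (simp_all add: pos_le_divide_eq pos_divide_le_eq)
          then have "\<psi> q = pi * (7 - 4 * r q / d)" by (simp add: \<psi>_def)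
          also have "\<dots> = pi / 2 * (- 1 * (norm (q - a) - 13 * d / 8) / (d / 8)) - pi / 2 + pi"
            using d by (simp add: r_def field_simps)
          finally have e: "\<psi> q = pi / 2 * (- 1 * (norm (q - a) - 13 * d / 8) / (d / 8)) - pi / 2 + pi" .
          have "H (1, q) = phase (cvec (sgn (q - a)) 0) (\<psi> q) ` iR"
            using 4 d by (subst Hfar) (simp_all add: LiR N)
          also have "\<dots> = phase (cvec (sgn (q - a)) 0) (pi / 2 * (- 1 * (norm (q - a) - 13 * d / 8) / (d / 8)) - pi / 2) ` iR"
            unfolding e by (rule phase_add_pi_iR[OF u])
          also have "\<dots> = shell_map ?s3 q" using sh3[of q] 4 by simp
          finally show ?thesis using gl[of ?s3] sh3[of q] 4 by (simp add: J_def del: shell.simps shell_map.simps)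
        next
          case 5
          then have "H (1, q) = iR" using \<psi>0[of q] d by (simp add: H_def LiR)
          moreover have "q \<notin> shell ?s2" "q \<notin> shell ?s3" unfolding sh2 sh3 using 5 d by auto
          ultimately show ?thesis using gl0[OF no1] by simp
        qed
      qed
    qed
  qed
qed

lemma stab_kernel_shells:
  fixes c :: "((real^'n) option \<Rightarrow> (complex^'n) set) set"
  assumes "c \<in> stab_kernel"
  obtains J where "shells_ok J" "c = htpy_class Lag iR (extend (glue J shell shell_map))"
proof -
  obtain s :: "real^'n \<Rightarrow> real \<times> (real^'n)" where s: "continuous_on UNIV s" "\<And>q. norm (s q) = 1"
    "compact {q. fst (s q) \<le> - 1/2}" "c = htpy_class Lag iR (extend (\<lambda>q. cap_kink (s q)))"
    using stab_kernel_cap_kink[OF assms] by blast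
  obtain Z \<delta> D where Z: "finite Z" "\<delta> > 0" "disjoint_family_on (\<lambda>z. cball z \<delta>) Z"
    "\<And>z. z \<in> Z \<Longrightarrow> linear (D z)" "\<And>z v. z \<in> Z \<Longrightarrow> norm v \<ge> \<delta> \<Longrightarrow> norm (D z v) \<ge> 1"
    "homotopic_with (\<lambda>h. h None = iR) sphere_top Lag (extend (\<lambda>q. cap_kink (s q)))
       (extend (glue Z (\<lambda>z. cball z \<delta>) (\<lambda>z q. kink (D z (q - z)))))"
    using cap_kink_linearized[OF s(1-3)] by blast
  have "\<exists>J. localhom (cball z \<delta>) (\<lambda>q. kink (D z (q - z))) (glue J shell shell_map) \<and> shells_ok J \<and>
      (\<forall>t\<in>J. shell t \<subseteq> cball z \<delta>)" if z: "z \<in> Z" for z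
  proof -
    \<comment> \<open>Any coordinate axis serves as normal of the reflection.\<close>
    define k :: 'n where "k = undefined"
    obtain M0 X where MX: "M0 > 0" "X = mat 1 \<or> X = mirror (axis k 1)"
      "\<And>M. M \<ge> M0 \<Longrightarrow> localhom (cball z \<delta>) (\<lambda>q. kink (D z (q - z))) (\<lambda>q. kink (M *\<^sub>R (X *v (q - z))))"
      by (rule kink_normalize[where \<delta> = \<delta> and k = k and z = z, OF Z(4)[OF z] _ Z(2)], rule Z(5)[OF z], assumption, rule that)
    \<comment> \<open>The three shells of a reflected kink occupy a ball of radius 3d, which has to
      be the given ball of radius \<delta>.\<close>
    define d where "d = \<delta> / 3"
    have d: "d > 0" "3 * d = \<delta>" using Z(2) by (simp_all add: d_def)
    define M where "M = max M0 (8 / d)"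
    have M: "M \<ge> M0" "M \<ge> 8 / d" by (simp_all add: M_def)
    have Mp: "M > 0" using M(1) MX(1) by simp
    from MX(2) show ?thesis
    proof
      assume X: "X = mat 1"
      let ?s = "(z, 2 / (3 * M), 1 / (3 * M), 1::real)"
      have M1: "1 / M \<le> \<delta>"
      proof -
        have "8 \<le> M * d" using M(2) d by (simp add: pos_divide_le_eq)
        then have "1 \<le> M * \<delta>" using d by (simp flip: d(2))
        then show ?thesis using Mp by (simp add: pos_divide_le_eq mult.commute)
      qed
      have dj: "disjoint_family_on shell {?s}" by (simp add: disjoint_family_on_def)
      have "1 / (3 * M) < 2 / (3 * M)" using Mp by (intro divide_strict_right_mono) auto
      then have "shells_ok {?s}" unfolding shells_ok_def using Mp dj by simp
      moreover have "shell ?s \<subseteq> cball z \<delta>"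
      proof
        fix q assume "q \<in> shell ?s"
        then have "norm (q - z) \<le> 2 / (3 * M) + 1 / (3 * M)" by simp
        also have "\<dots> = 1 / M" using Mp by (simp add: field_simps)
        finally show "q \<in> cball z \<delta>" using M1 by (simp add: dist_norm norm_minus_commute)
      qed
      moreover have "(\<lambda>q. kink (M *\<^sub>R (X *v (q - z)))) = glue {?s} shell shell_map"
      proof
        fix q
        have "kink (M *\<^sub>R (X *v (q - z))) = shell_map ?s q"
          unfolding X matrix_vector_mul_lid by (rule kink_eq_shell_map[OF Mp])
        also have "\<dots> = glue {?s} shell shell_map q"
        proof (cases "q \<in> shell ?s")
          case True
          then show ?thesis using glue_eq[OF dj _ True, of shell_map] by (simp del: shell_map.simps)
        next
          case False
          then show ?thesis using shell_map_outside[OF False] glue_outside[of q shell "{?s}" shell_map] by (simp del: shell_map.simps shell.simps)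
        qed
        finally show "kink (M *\<^sub>R (X *v (q - z))) = glue {?s} shell shell_map q" .
      qed
      ultimately show ?thesis using MX(3)[OF M(1)] by (intro exI[of _ "{?s}"]) simp
    next
      assume X: "X = mirror (axis k 1)"
      have n: "norm (axis k (1::real)) = 1" by (simp add: norm_axis_1)
      note R = reflected_kink[OF d(1) n M(2), where z = z, unfolded d(2)]
      from localhom_trans[OF MX(3)[OF M(1), unfolded X] R(1)] R(2,3) show ?thesis by blast
    qed
  qed
  then obtain J where J: "\<And>z. z \<in> Z \<Longrightarrow> localhom (cball z \<delta>) (\<lambda>q. kink (D z (q - z))) (glue (J z) shell shell_map)"
    "\<And>z. z \<in> Z \<Longrightarrow> shells_ok (J z)" "\<And>z t. z \<in> Z \<Longrightarrow> t \<in> J z \<Longrightarrow> shell t \<subseteq> cball z \<delta>" by metis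
  let ?J = "\<Union>z\<in>Z. J z"
  have dj: "disjoint_family_on shell (J z)" if "z \<in> Z" for z using J(2)[OF that] by (simp add: shells_ok_def)
  have disj: "disjoint_family_on shell ?J"
    unfolding disjoint_family_on_def
  proof (intro ballI impI)
    fix t u assume "t \<in> ?J" "u \<in> ?J" and tu: "t \<noteq> u"
    then obtain z w where zw: "z \<in> Z" "t \<in> J z" "w \<in> Z" "u \<in> J w" by blast
    show "shell t \<inter> shell u = {}"
    proof (cases "z = w")
      case True
      then show ?thesis using dj[OF zw(1)] zw tu unfolding disjoint_family_on_def by blast
    next
      case False
      then have "cball z \<delta> \<inter> cball w \<delta> = {}" using Z(3) zw unfolding disjoint_family_on_def by blast
      then show ?thesis using J(3)[OF zw(1,2)] J(3)[OF zw(3,4)] by blast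
    qed
  qed
  have ok: "shells_ok ?J"
    unfolding shells_ok_def
  proof (intro conjI disj allI impI)
    show "finite ?J" using Z(1) J(2) by (auto simp: shells_ok_def)
    fix c R h e assume "(c, R, h, e) \<in> ?J"
    then show "0 < h" "h < R" "e = 1 \<or> e = - 1" using J(2) unfolding shells_ok_def by blast+
  qed
  have eq: "glue Z (\<lambda>z. cball z \<delta>) (\<lambda>z. glue (J z) shell shell_map) = glue ?J shell shell_map"
  proof
    fix q
    show "glue Z (\<lambda>z. cball z \<delta>) (\<lambda>z. glue (J z) shell shell_map) q = glue ?J shell shell_map q"
    proof (cases "\<exists>z\<in>Z. q \<in> cball z \<delta>")
      case True
      then obtain z where z: "z \<in> Z" "q \<in> cball z \<delta>" by blast
      have 1: "glue Z (\<lambda>z. cball z \<delta>) (\<lambda>z. glue (J z) shell shell_map) q = glue (J z) shell shell_map q"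
        by (rule glue_eq[OF Z(3) z])
      show ?thesis
      proof (cases "\<exists>t\<in>J z. q \<in> shell t")
        case in_shell: True
        then obtain t where t: "t \<in> J z" "q \<in> shell t" by blast
        then have "t \<in> ?J" using z by blast
        then show ?thesis unfolding 1 using glue_eq[OF dj[OF z(1)] t, of shell_map] glue_eq[OF disj _ t(2), of shell_map] by simp
      next
        case False
        have "q \<notin> shell t" if tJ: "t \<in> ?J" for t
        proof
          assume q: "q \<in> shell t"
          obtain w where w: "w \<in> Z" "t \<in> J w" using tJ by blast
          then have "q \<in> cball w \<delta>" using J(3) q by blast
          then have "w = z" using Z(3) z w unfolding disjoint_family_on_def by blast
          then show False using False w q by blast
        qed
        then have n: "q \<notin> \<Union> (shell ` ?J)" "q \<notin> \<Union> (shell ` J z)" using z(1) by blast+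
        show ?thesis unfolding 1 by (simp only: n[THEN glue_outside])
      qed
    next
      case False
      then have n: "q \<notin> \<Union> (shell ` ?J)" "q \<notin> (\<Union>z\<in>Z. cball z \<delta>)" using J(3) by blast+
      show ?thesis by (simp only: n[THEN glue_outside])
    qed
  qed
  have lh: "localhom (\<Union>z\<in>Z. cball z \<delta>) (glue Z (\<lambda>z. cball z \<delta>) (\<lambda>z q. kink (D z (q - z))))
      (glue Z (\<lambda>z. cball z \<delta>) (\<lambda>z. glue (J z) shell shell_map))"
    by (intro glue_localhom Z closed_cball J)
  have "bounded (\<Union>z\<in>Z. cball z \<delta>)" using Z(1) by auto
  from htpy_class_eq[OF homotopic_with_trans[OF Z(6) localhom_homotopic[OF lh this, unfolded eq]]]
  have "c = htpy_class Lag iR (extend (glue ?J shell shell_map))" unfolding s(4) .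
  from that[OF ok this] show ?thesis .
qed

section \<open>Collars of round spheres\<close>

definition spheres :: "((real^'n) \<times> real \<times> real \<times> real) set \<Rightarrow> (real^'n) set" where
  "spheres J = (\<Union>(c, R, h, e)\<in>J. sphere c R)"

definition region :: "((real^'n) \<times> real \<times> real \<times> real) set \<Rightarrow> (real^'n) set" where
  "region J = (\<Union>s\<in>J. shell s)"

definition the_shell :: "((real^'n) \<times> real \<times> real \<times> real) set \<Rightarrow> real^'n \<Rightarrow> (real^'n) \<times> real \<times> real \<times> real" where
  "the_shell J y = (SOME s. s \<in> J \<and> y \<in> shell s)"

definition normal_at :: "((real^'n) \<times> real \<times> real \<times> real) set \<Rightarrow> real^'n \<Rightarrow> real^'n" where
  "normal_at J y = (case the_shell J y of (c, R, h, e) \<Rightarrow> e *\<^sub>R sgn (y - c))"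

text \<open>Signed distance from the sphere, positive on the side to which the co-orientation
  points.\<close>

definition height :: "((real^'n) \<times> real \<times> real \<times> real) set \<Rightarrow> real^'n \<Rightarrow> real" where
  "height J y = (case the_shell J y of (c, R, h, e) \<Rightarrow> e * (norm (y - c) - R))"

definition width :: "((real^'n) \<times> real \<times> real \<times> real) set \<Rightarrow> real^'n \<Rightarrow> real" where
  "width J y = (case the_shell J y of (c, R, h, e) \<Rightarrow> h)"

context
  fixes J :: "((real^'n) \<times> real \<times> real \<times> real) set"
  assumes J: "shells_ok J"
begin

lemma the_shell_eq: "s \<in> J \<Longrightarrow> y \<in> shell s \<Longrightarrow> the_shell J y = s"
  unfolding the_shell_def by (rule some_equality) (use J in \<open>unfold shells_ok_def disjoint_family_on_def, blast\<close>)+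

lemma shell_params: "(c, R, h, e) \<in> J \<Longrightarrow> 0 < h" "(c, R, h, e) \<in> J \<Longrightarrow> h < R"
  "(c, R, h, e) \<in> J \<Longrightarrow> e = 1 \<or> e = - 1"
  using J unfolding shells_ok_def by blast+

lemma regionE:
  assumes "y \<in> region J"
  obtains c R h e where "(c, R, h, e) \<in> J" "y \<in> shell (c, R, h, e)" "0 < h" "h < R" "e = 1 \<or> e = - 1"
    "normal_at J y = e *\<^sub>R sgn (y - c)" "height J y = e * (norm (y - c) - R)" "width J y = h" "norm (y - c) > 0"
proof -
  obtain s where "s \<in> J" "y \<in> shell s" using assms by (auto simp: region_def)
  then obtain c R h e where s: "(c, R, h, e) \<in> J" "y \<in> shell (c, R, h, e)" by (cases s) auto
  then have "norm (y - c) > 0" using shell_params[OF s(1)] by auto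
  then show ?thesis using that[OF s shell_params[OF s(1)]] the_shell_eq[OF s]
    by (simp add: normal_at_def height_def width_def)
qed

lemma in_shell_values:
  assumes "(c, R, h, e) \<in> J" "y \<in> shell (c, R, h, e)"
  shows "y \<in> region J" "normal_at J y = e *\<^sub>R sgn (y - c)" "height J y = e * (norm (y - c) - R)" "width J y = h"
  using assms(1,2) the_shell_eq[OF assms] unfolding normal_at_def height_def width_def region_def by (blast | simp)+

lemma norm_normal_at: "y \<in> region J \<Longrightarrow> norm (normal_at J y) = 1"
  by (erule regionE) (auto simp: norm_sgn)

lemma width_pos: "y \<in> region J \<Longrightarrow> width J y > 0"
  by (erule regionE) simp

lemma height_le_width: "y \<in> region J \<Longrightarrow> \<bar>height J y\<bar> \<le> width J y"
  by (erule regionE) (auto simp: abs_mult)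

lemma spheres_iff: "y \<in> spheres J \<longleftrightarrow> y \<in> region J \<and> height J y = 0"
proof
  assume "y \<in> spheres J"
  then obtain c R h e where s: "(c, R, h, e) \<in> J" "norm (y - c) = R"
    by (auto simp: spheres_def dist_norm norm_minus_commute)
  then have "y \<in> shell (c, R, h, e)" using shell_params[OF s(1)] by simp
  from in_shell_values[OF s(1) this] s(2) show "y \<in> region J \<and> height J y = 0" by simp
next
  assume y: "y \<in> region J \<and> height J y = 0"
  then obtain c R h e where s: "(c, R, h, e) \<in> J" "height J y = e * (norm (y - c) - R)" "e = 1 \<or> e = - 1"
    using regionE by metis
  then have "norm (y - c) = R" using y by auto
  then show "y \<in> spheres J" using s(1) by (force simp: spheres_def dist_norm norm_minus_commute)
qed

lemma spheres_region: "y \<in> spheres J \<Longrightarrow> y \<in> region J"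
  by (simp add: spheres_iff)

lemma compact_spheres: "compact (spheres J)"
  unfolding spheres_def using J by (intro compact_UN) (auto simp: shells_ok_def)

lemma closed_region: "closed (region J)" and bounded_region: "bounded (region J)"
  using J unfolding region_def shells_ok_def by (blast intro: closed_UN closed_shell bounded_shell bounded_UN)+

text \<open>Normal segments up to the half-width stay in one shell and, by h < R, do not reach the
  centre. So foot point and height are coordinates on the region; the next lemma recovers the foot
  point.\<close>

lemma collar_values:
  assumes x: "x \<in> spheres J" and r: "\<bar>r\<bar> \<le> width J x"
  shows "x + r *\<^sub>R normal_at J x \<in> region J" "normal_at J (x + r *\<^sub>R normal_at J x) = normal_at J x"
    "height J (x + r *\<^sub>R normal_at J x) = r" "width J (x + r *\<^sub>R normal_at J x) = width J x"
proof -
  obtain c R h e where s: "(c, R, h, e) \<in> J" "x \<in> shell (c, R, h, e)" "0 < h" "h < R" "e = 1 \<or> e = - 1"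
    "normal_at J x = e *\<^sub>R sgn (x - c)" "height J x = e * (norm (x - c) - R)" "width J x = h" "norm (x - c) > 0"
    using regionE[OF spheres_region[OF x]] by blast
  have n: "norm (x - c) = R" using x s(5,7) by (auto simp: spheres_iff)
  let ?y = "x + r *\<^sub>R normal_at J x"
  have pos: "R + r * e > 0" using r s by (auto simp: abs_le_iff)
  have "R *\<^sub>R sgn (x - c) = x - c" using n s(4,3) by (simp add: sgn_div_norm)
  then have yc: "?y - c = (R + r * e) *\<^sub>R sgn (x - c)"
    by (simp add: s(6) algebra_simps)
  have nu: "norm (sgn (x - c)) = 1" using s(9) by (simp add: norm_sgn)
  have ny: "norm (?y - c) = R + r * e" unfolding yc using pos nu by simp
  have "sgn (sgn (x - c)) = sgn (x - c)" using nu sgn_div_norm[of "sgn (x - c)"] by simp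
  then have sy: "sgn (?y - c) = sgn (x - c)" unfolding yc using pos by (simp add: sgn_scaleR)
  have "\<bar>r * e\<bar> \<le> h" using r s(5,8) by auto
  then have ysh: "?y \<in> shell (c, R, h, e)" using ny by simp
  note v = in_shell_values[OF s(1) ysh]
  show "?y \<in> region J" "normal_at J ?y = normal_at J x" "width J ?y = width J x"
    using v s(6,8) sy by simp_all
  show "height J ?y = r" using v(3) ny s(5) by auto
qed

lemma collar_projection:
  assumes y: "y \<in> region J"
  defines "x \<equiv> y - height J y *\<^sub>R normal_at J y"
  shows "x \<in> spheres J" "normal_at J x = normal_at J y" "width J x = width J y"
proof -
  obtain c R h e where s: "(c, R, h, e) \<in> J" "y \<in> shell (c, R, h, e)" "0 < h" "h < R" "e = 1 \<or> e = - 1"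
    "normal_at J y = e *\<^sub>R sgn (y - c)" "height J y = e * (norm (y - c) - R)" "width J y = h" "norm (y - c) > 0"
    using regionE[OF y] by blast
  have "height J y *\<^sub>R normal_at J y = (norm (y - c) - R) *\<^sub>R sgn (y - c)" using s(5) by (auto simp: s(6,7))
  then have "x - c = (y - c) - (norm (y - c) - R) *\<^sub>R sgn (y - c)" by (simp add: x_def)
  moreover have "y - c = norm (y - c) *\<^sub>R sgn (y - c)" using s(9) by (simp add: sgn_div_norm)
  ultimately have xc: "x - c = R *\<^sub>R sgn (y - c)" by (simp add: scaleR_diff_left)
  have nu: "norm (sgn (y - c)) = 1" using s(9) by (simp add: norm_sgn)
  have nx: "norm (x - c) = R" unfolding xc using s(3,4) nu by simp
  have "sgn (sgn (y - c)) = sgn (y - c)" using nu sgn_div_norm[of "sgn (y - c)"] by simp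
  then have sx: "sgn (x - c) = sgn (y - c)" unfolding xc using s(3,4) by (simp add: sgn_scaleR)
  have "x \<in> shell (c, R, h, e)" using nx s(3) by simp
  note v = in_shell_values[OF s(1) this]
  show "x \<in> spheres J" using v nx by (simp add: spheres_iff)
  show "normal_at J x = normal_at J y" "width J x = width J y" using v s(6,8) sx by simp_all
qed

lemma collar_continuous:
  shows "continuous_on (region J) (normal_at J)" "continuous_on (region J) (height J)" "continuous_on (region J) (width J)"
proof -
  have fin: "finite J" using J by (simp add: shells_ok_def)
  have "continuous_on (shell s) (normal_at J) \<and> continuous_on (shell s) (height J) \<and> continuous_on (shell s) (width J)"
    if sJ: "s \<in> J" for s
  proof -
    obtain c R h e where s: "s = (c, R, h, e)" by (cases s) auto
    note p = shell_params[OF sJ[unfolded s]]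
    have nz: "norm (y - c) \<noteq> 0" if "y \<in> shell s" for y using that p(1,2) by (auto simp: s)
    have "continuous_on (shell s) (\<lambda>y. e *\<^sub>R sgn (y - c))"
      unfolding sgn_div_norm by (intro continuous_intros) (use nz in auto)
    then have "continuous_on (shell s) (normal_at J)"
      by (rule continuous_on_eq) (use in_shell_values(2)[OF sJ[unfolded s]] in \<open>simp add: s\<close>)
    moreover have "continuous_on (shell s) (\<lambda>y. e * (norm (y - c) - R))" by (intro continuous_intros)
    then have "continuous_on (shell s) (height J)"
      by (rule continuous_on_eq) (use in_shell_values(3)[OF sJ[unfolded s]] in \<open>simp add: s\<close>)
    moreover have "continuous_on (shell s) (\<lambda>y. h)" by (intro continuous_intros)
    then have "continuous_on (shell s) (width J)"
      by (rule continuous_on_eq) (use in_shell_values(4)[OF sJ[unfolded s]] in \<open>simp add: s\<close>)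
    ultimately show ?thesis by blast
  qed
  then show "continuous_on (region J) (normal_at J)" "continuous_on (region J) (height J)" "continuous_on (region J) (width J)"
    unfolding region_def by (intro continuous_on_closed_Union fin closed_shell; blast)+
qed

definition interior_region :: "(real^'n) set" where
  "interior_region = {y \<in> region J. \<bar>height J y\<bar> < width J y}"

lemma open_interior_region: "open interior_region"
proof -
  have "interior_region = (\<Union>(c, R, h, e)\<in>J. {y. \<bar>norm (y - c) - R\<bar> < h})"
  proof (intro equalityI subsetI)
    fix y assume "y \<in> interior_region"
    then have y: "y \<in> region J" "\<bar>height J y\<bar> < width J y" by (auto simp: interior_region_def)
    obtain c R h e where s: "(c, R, h, e) \<in> J" "e = 1 \<or> e = - 1" "height J y = e * (norm (y - c) - R)" "width J y = h"
      using regionE[OF y(1)] by metis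
    then have "\<bar>norm (y - c) - R\<bar> < h" using y(2) by auto
    then show "y \<in> (\<Union>(c, R, h, e)\<in>J. {y. \<bar>norm (y - c) - R\<bar> < h})" using s(1) by blast
  next
    fix y assume "y \<in> (\<Union>(c, R, h, e)\<in>J. {y. \<bar>norm (y - c) - R\<bar> < h})"
    then obtain c R h e where s: "(c, R, h, e) \<in> J" "\<bar>norm (y - c) - R\<bar> < h" by auto
    then have "y \<in> shell (c, R, h, e)" by simp
    note v = in_shell_values[OF s(1) this]
    show "y \<in> interior_region" using v s shell_params(3)[OF s(1)] by (auto simp: interior_region_def)
  qed
  moreover have "open {y. \<bar>norm (y - c) - R\<bar> < h}" for c :: "real^'n" and R h :: real
    by (intro open_Collect_less continuous_intros)
  ultimately show ?thesis by auto
qed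

lemma height_derivative:
  assumes "y \<in> interior_region"
  shows "(height J has_derivative (\<lambda>v. normal_at J y \<bullet> v)) (at y)"
proof -
  have y: "y \<in> region J" "\<bar>height J y\<bar> < width J y" using assms by (auto simp: interior_region_def)
  obtain c R h e where s: "(c, R, h, e) \<in> J" "y \<in> shell (c, R, h, e)" "0 < h" "h < R" "e = 1 \<or> e = - 1"
    "normal_at J y = e *\<^sub>R sgn (y - c)" "height J y = e * (norm (y - c) - R)" "width J y = h" "norm (y - c) > 0"
    using regionE[OF y(1)] by blast
  have o: "open {z. \<bar>norm (z - c) - R\<bar> < h}" by (intro open_Collect_less continuous_intros)
  have "((\<lambda>z. z - c) has_derivative (\<lambda>v. v)) (at y)" by (auto intro!: derivative_eq_intros)
  moreover have "(norm has_derivative (\<lambda>v. v \<bullet> sgn (y - c))) (at (y - c))"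
    using s(9) by (intro has_derivative_norm) simp
  ultimately have "((\<lambda>z. norm (z - c)) has_derivative (\<lambda>v. v \<bullet> sgn (y - c))) (at y)"
    by (rule has_derivative_compose)
  then have "((\<lambda>z. norm (z - c)) has_derivative (\<lambda>v. sgn (y - c) \<bullet> v)) (at y)" by (simp add: inner_commute)
  then have "((\<lambda>z. e * (norm (z - c) - R)) has_derivative (\<lambda>v. e * (sgn (y - c) \<bullet> v))) (at y)"
    by (auto intro!: derivative_eq_intros)
  then have "((\<lambda>z. e * (norm (z - c) - R)) has_derivative (\<lambda>v. normal_at J y \<bullet> v)) (at y)"
    by (simp add: s(6))
  then show ?thesis
  proof (rule has_derivative_transform_within_open[OF _ o])
    show "y \<in> {z. \<bar>norm (z - c) - R\<bar> < h}" using y(2) s(5,7,8) by auto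
    show "e * (norm (z - c) - R) = height J z" if "z \<in> {z. \<bar>norm (z - c) - R\<bar> < h}" for z
      using in_shell_values(3)[OF s(1), of z] that by simp
  qed
qed

end

section \<open>Independence of the tubular neighbourhood\<close>

text \<open>If d/dt has length r, then dt has component 1/r along it. In the complex line of d/dt
  the direction sin \<theta> dt + cos \<theta> d/dt is therefore proportional to i sin \<theta> +
  r^2 cos \<theta>, and the formula is the angle of this vector measured from the imaginary
  axis.\<close>

definition lean :: "real \<Rightarrow> real \<Rightarrow> real" where
  "lean r \<theta> = - arccos (sin \<theta> / sqrt ((sin \<theta>)\<^sup>2 + (r\<^sup>2 * cos \<theta>)\<^sup>2))"

definition lean_plane :: "real^'n \<Rightarrow> real \<Rightarrow> (complex^'n) set" where
  "lean_plane w \<theta> = phase (cvec (sgn w) 0) (lean (norm w) \<theta>) ` iR"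

lemma lean_pos: fixes r \<theta> :: real assumes "r \<noteq> 0" shows "(sin \<theta>)\<^sup>2 + (r\<^sup>2 * cos \<theta>)\<^sup>2 > 0"
proof (cases "sin \<theta> = 0")
  case True
  then have "cos \<theta> \<noteq> 0" using sin_cos_squared_add[of \<theta>] by auto
  then show ?thesis using assms True by simp
qed (simp add: add_pos_nonneg)

lemma lean_range: "\<bar>sin \<theta> / sqrt ((sin \<theta>)\<^sup>2 + (r\<^sup>2 * cos \<theta>)\<^sup>2)\<bar> \<le> 1"
proof (cases "sqrt ((sin \<theta>)\<^sup>2 + (r\<^sup>2 * cos \<theta>)\<^sup>2) = 0")
  case False
  have "\<bar>sin \<theta>\<bar> = sqrt ((sin \<theta>)\<^sup>2)" by simp
  also have "\<dots> \<le> sqrt ((sin \<theta>)\<^sup>2 + (r\<^sup>2 * cos \<theta>)\<^sup>2)" by (intro real_sqrt_le_mono) simp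
  finally have a: "\<bar>sin \<theta>\<bar> \<le> sqrt ((sin \<theta>)\<^sup>2 + (r\<^sup>2 * cos \<theta>)\<^sup>2)" .
  have "sqrt ((sin \<theta>)\<^sup>2 + (r\<^sup>2 * cos \<theta>)\<^sup>2) > 0" using False by (metis a abs_ge_zero order_le_less order_trans)
  then show ?thesis using a by (simp add: abs_divide)
qed simp

lemma lean_range':
  "- 1 \<le> sin \<theta> / sqrt ((sin \<theta>)\<^sup>2 + (r\<^sup>2 * cos \<theta>)\<^sup>2)"
  "sin \<theta> / sqrt ((sin \<theta>)\<^sup>2 + (r\<^sup>2 * cos \<theta>)\<^sup>2) \<le> 1"
  using lean_range[of \<theta> r] unfolding abs_le_iff by linarith+

text \<open>For cos \<theta> >= 0, the range that occurs for t in [-1, 1], the sine of the angle has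
  constant sign, so one branch of \<open>arccos\<close> suffices.\<close>

lemma cos_sin_lean:
  assumes "r \<noteq> 0" "cos \<theta> \<ge> 0"
  defines "S \<equiv> sqrt ((sin \<theta>)\<^sup>2 + (r\<^sup>2 * cos \<theta>)\<^sup>2)"
  shows "cos (lean r \<theta>) = sin \<theta> / S" "sin (lean r \<theta>) = - (r\<^sup>2 * cos \<theta> / S)" "S > 0"
proof -
  show S: "S > 0" using lean_pos[OF assms(1)] by (simp add: S_def)
  note g = lean_range'[of \<theta> r, folded S_def]
  show "cos (lean r \<theta>) = sin \<theta> / S" using g by (simp add: lean_def flip: S_def)
  have "S\<^sup>2 = (sin \<theta>)\<^sup>2 + (r\<^sup>2 * cos \<theta>)\<^sup>2" using lean_pos[OF assms(1), of \<theta>] by (simp add: S_def)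
  then have "(sin \<theta> / S)\<^sup>2 + (r\<^sup>2 * cos \<theta> / S)\<^sup>2 = S\<^sup>2 / S\<^sup>2"
    by (simp only: power_divide add_divide_distrib)
  then have "1 - (sin \<theta> / S)\<^sup>2 = (r\<^sup>2 * cos \<theta> / S)\<^sup>2" using S by simp
  then have "sqrt (1 - (sin \<theta> / S)\<^sup>2) = r\<^sup>2 * cos \<theta> / S"
    using S assms(2) by simp
  then show "sin (lean r \<theta>) = - (r\<^sup>2 * cos \<theta> / S)"
    using g sin_arccos_abs[of "sin \<theta> / S"] lean_range[of \<theta> r] by (simp add: lean_def flip: S_def)
qed

lemma phase_iR_eq: "phase (cvec u 0) \<psi> ` iR =
    {cvec (- (sin \<psi> * (u \<bullet> b)) *\<^sub>R u) (b + ((cos \<psi> - 1) * (u \<bullet> b)) *\<^sub>R u) | b. True}"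
proof -
  have ph: "phase (cvec u 0) \<psi> (cvec 0 b) = cvec (- (sin \<psi> * (u \<bullet> b)) *\<^sub>R u) (b + ((cos \<psi> - 1) * (u \<bullet> b)) *\<^sub>R u)" for b
    by (simp add: phase_def herm_rv vec_eq_iff complex_eq_iff)
  show ?thesis unfolding iR_def image_image ph by auto
qed

text \<open>The covector \<open>\<eta>\<close> enters only through \<open>\<eta>(w) = 1\<close>.\<close>

lemma fold_plane_eq:
  fixes w \<eta> :: "real^'n"
  assumes w: "\<eta> \<bullet> w = 1" and c: "cos \<theta> \<ge> 0"
  shows "{cvec 0 \<xi> + s *\<^sub>R (sin \<theta> *\<^sub>R cvec 0 \<eta> + cos \<theta> *\<^sub>R cvec w 0) | \<xi> s. \<xi> \<bullet> w = 0} = lean_plane w \<theta>"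
proof -
  define n u where "n = norm w" and "u = sgn w"
  have "w \<noteq> 0" using w by auto
  then have n: "n > 0" "w = n *\<^sub>R u" "norm u = 1" by (simp_all add: n_def u_def sgn_div_norm)
  have uu: "u \<bullet> u = 1" using n(3) by (simp add: dot_square_norm)
  define S where "S = sqrt ((sin \<theta>)\<^sup>2 + (n\<^sup>2 * cos \<theta>)\<^sup>2)"
  have nz: "n \<noteq> 0" using n by simp
  note L = cos_sin_lean[OF nz c, folded S_def]
  have \<eta>u: "\<eta> \<bullet> u = 1 / n" using w n by (simp add: field_simps)
  have lhs: "cvec 0 \<xi> + s *\<^sub>R (sin \<theta> *\<^sub>R cvec 0 \<eta> + cos \<theta> *\<^sub>R cvec w 0) =
      cvec ((s * cos \<theta>) *\<^sub>R w) (\<xi> + (s * sin \<theta>) *\<^sub>R \<eta>)" for \<xi> s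
    by (simp add: vec_eq_iff complex_eq_iff algebra_simps)
  have rhs: "lean_plane w \<theta> = {cvec ((n\<^sup>2 * cos \<theta> / S * (u \<bullet> b)) *\<^sub>R u) (b + ((sin \<theta> / S - 1) * (u \<bullet> b)) *\<^sub>R u) | b. True}"
    unfolding lean_plane_def u_def[symmetric] n_def[symmetric] phase_iR_eq L by simp
  show ?thesis
    unfolding lhs rhs
  proof (intro equalityI subsetI)
    fix z assume "z \<in> {cvec ((s * cos \<theta>) *\<^sub>R w) (\<xi> + (s * sin \<theta>) *\<^sub>R \<eta>) | \<xi> s. \<xi> \<bullet> w = 0}"
    then obtain \<xi> s where z: "z = cvec ((s * cos \<theta>) *\<^sub>R w) (\<xi> + (s * sin \<theta>) *\<^sub>R \<eta>)" "\<xi> \<bullet> w = 0" by blast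
    \<comment> \<open>The value that u \<bullet> b must have, found by comparing the real parts of
      the two descriptions.\<close>
    define m where "m = s * S / n"
    define b where "b = \<xi> + (s * sin \<theta>) *\<^sub>R \<eta> + (m - m / S * sin \<theta>) *\<^sub>R u"
    have "u \<bullet> \<xi> = 0" using z(2) n by (simp add: inner_commute)
    then have ub: "u \<bullet> b = m"
      using L(3) n(1) by (simp add: b_def inner_add_right uu inner_commute[of u \<eta>] \<eta>u m_def)
    have "n\<^sup>2 * cos \<theta> / S * m = s * cos \<theta> * n" using L(3) n(1) by (simp add: m_def power2_eq_square)
    then have 1: "(n\<^sup>2 * cos \<theta> / S * (u \<bullet> b)) *\<^sub>R u = (s * cos \<theta>) *\<^sub>R w" unfolding ub n(2) by simp
    have 2: "b + ((sin \<theta> / S - 1) * (u \<bullet> b)) *\<^sub>R u = \<xi> + (s * sin \<theta>) *\<^sub>R \<eta>"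
      unfolding ub by (simp add: b_def algebra_simps)
    have "z = cvec ((n\<^sup>2 * cos \<theta> / S * (u \<bullet> b)) *\<^sub>R u) (b + ((sin \<theta> / S - 1) * (u \<bullet> b)) *\<^sub>R u)"
      unfolding 1 2 by (rule z(1))
    then show "z \<in> {cvec ((n\<^sup>2 * cos \<theta> / S * (u \<bullet> b)) *\<^sub>R u) (b + ((sin \<theta> / S - 1) * (u \<bullet> b)) *\<^sub>R u) | b. True}"
      by blast
  next
    fix z assume "z \<in> {cvec ((n\<^sup>2 * cos \<theta> / S * (u \<bullet> b)) *\<^sub>R u) (b + ((sin \<theta> / S - 1) * (u \<bullet> b)) *\<^sub>R u) | b. True}"
    then obtain b where z: "z = cvec ((n\<^sup>2 * cos \<theta> / S * (u \<bullet> b)) *\<^sub>R u) (b + ((sin \<theta> / S - 1) * (u \<bullet> b)) *\<^sub>R u)" by blast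
    define m where "m = u \<bullet> b"
    define s where "s = m / S * n"
    define \<xi> where "\<xi> = b + ((sin \<theta> / S - 1) * m) *\<^sub>R u - (s * sin \<theta>) *\<^sub>R \<eta>"
    have "\<xi> \<bullet> u = 0"
      using L(3) n(1) by (simp add: \<xi>_def inner_diff_left inner_add_left uu \<eta>u inner_commute[of b u] s_def flip: m_def) (simp add: algebra_simps)
    then have "\<xi> \<bullet> w = 0" using n by simp
    moreover have "z = cvec ((s * cos \<theta>) *\<^sub>R w) (\<xi> + (s * sin \<theta>) *\<^sub>R \<eta>)"
      unfolding z m_def[symmetric] \<xi>_def s_def n(2) by (simp add: power2_eq_square mult_ac)
    ultimately show "z \<in> {cvec ((s * cos \<theta>) *\<^sub>R w) (\<xi> + (s * sin \<theta>) *\<^sub>R \<eta>) | \<xi> s. \<xi> \<bullet> w = 0}" by blast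
  qed
qed

lemma lean_plane_end: 
  assumes "w \<noteq> 0" "\<theta> = pi / 2 \<or> \<theta> = - (pi / 2)" shows "lean_plane w \<theta> = iR"
proof -
  have "norm (sgn w) = 1" using assms by (simp add: norm_sgn)
  moreover have "lean (norm w) \<theta> = 0 \<or> lean (norm w) \<theta> = - pi"
    using assms(2) by (elim disjE; hypsubst; simp add: lean_def)
  ultimately show ?thesis unfolding lean_plane_def using phase_minus_pi_iR[of "sgn w"] by auto
qed

text \<open>For a unit vector nothing is distorted and the angle is linear in \<theta>, which is the
  form used in \<open>shell_map\<close>.\<close>

lemma lean_plane_unit:
  assumes "norm w = 1" "\<bar>\<theta>\<bar> \<le> pi / 2"
  shows "lean_plane w \<theta> = phase (cvec w 0) (\<theta> - pi / 2) ` iR"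
proof -
  have "sin \<theta> = cos (pi / 2 - \<theta>)" by (simp add: cos_diff)
  then have "arccos (sin \<theta>) = arccos (cos (pi / 2 - \<theta>))" by simp
  also have "\<dots> = pi / 2 - \<theta>" using assms(2) by (intro arccos_cos) (auto simp: abs_le_iff)
  finally have "lean 1 \<theta> = \<theta> - pi / 2" by (simp add: lean_def)
  moreover have "sgn w = w" using assms(1) by (simp add: sgn_div_norm)
  ultimately show ?thesis using assms(1) by (simp add: lean_plane_def)
qed

lemma lagc_lean_plane:
  fixes w :: "'a::t2_space \<Rightarrow> real^'n"
  assumes "continuous_on S w" "continuous_on S \<theta>" "\<And>x. x \<in> S \<Longrightarrow> w x \<noteq> 0"
  shows "lagc S (\<lambda>x. lean_plane (w x) (\<theta> x))"
  unfolding lean_plane_def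
proof (rule lagc_unic[OF phase_unic lagc_const[OF lagrangian_iR]])
  show "continuous_on S (\<lambda>x. cvec (sgn (w x)) 0)"
    unfolding sgn_div_norm by (intro continuous_intros assms) (use assms in auto)
  have "sqrt ((sin (\<theta> x))\<^sup>2 + ((norm (w x))\<^sup>2 * cos (\<theta> x))\<^sup>2) > 0" if "x \<in> S" for x
    using lean_pos[of "norm (w x)" "\<theta> x"] assms(3)[OF that] by (intro real_sqrt_gt_zero) simp
  then have nz: "sqrt ((sin (\<theta> x))\<^sup>2 + ((norm (w x))\<^sup>2 * cos (\<theta> x))\<^sup>2) \<noteq> 0" if "x \<in> S" for x
    using that by (metis less_irrefl)
  show "continuous_on S (\<lambda>x. lean (norm (w x)) (\<theta> x))"
    unfolding lean_def by (intro continuous_intros assms ballI conjI lean_range') (use nz in blast)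
  show "norm (cvec (sgn (w x)) 0) = 1" if "x \<in> S" for x using assms(3)[OF that] by (simp add: norm_sgn)
qed

text \<open>On the overlap of the closed sets \<theta> is pi/2 or -pi/2, and there the plane is
  \<open>iR\<close> whatever the nonzero vector w is.\<close>

lemma localhom_lean_patch:
  fixes w :: "real \<times> (real^'n) \<Rightarrow> real^'n" and \<theta> :: "real \<times> (real^'n) \<Rightarrow> real"
  assumes "closed K" "closed B" "K \<union> B = UNIV"
    and w: "continuous_on ({0..1} \<times> K) w" "continuous_on ({0..1} \<times> K) \<theta>" "\<And>x. x \<in> {0..1} \<times> K \<Longrightarrow> w x \<noteq> 0"
    and edge: "\<And>t q. t \<in> {0..1} \<Longrightarrow> q \<in> K \<Longrightarrow> q \<in> B \<Longrightarrow> \<theta> (t, q) = pi / 2 \<or> \<theta> (t, q) = - (pi / 2)"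
  shows "localhom K (\<lambda>q. if q \<in> K then lean_plane (w (0, q)) (\<theta> (0, q)) else iR)
    (\<lambda>q. if q \<in> K then lean_plane (w (1, q)) (\<theta> (1, q)) else iR)"
proof (rule localhomI)
  let ?f = "\<lambda>x. if snd x \<in> K then lean_plane (w x) (\<theta> x) else iR"
  have U: "{0..1::real} \<times> (UNIV :: (real^'n) set) = {0..1} \<times> K \<union> {0..1} \<times> B" using assms(3) by blast
  have 1: "lagc ({0..1} \<times> K) ?f"
    by (rule iffD2[OF lagc_cong lagc_lean_plane[OF w]]) auto
  have 2: "lagc ({0..1} \<times> B) ?f"
  proof (rule iffD2[OF lagc_cong lagc_const[OF lagrangian_iR]])
    fix x assume x: "x \<in> {0..1::real} \<times> B"
    show "?f x = iR"
    proof (cases "snd x \<in> K")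
      case True
      then show ?thesis using lean_plane_end[OF w(3)[of x] edge[of "fst x" "snd x", unfolded prod.collapse]] x by auto
    qed simp
  qed
  have "lagc ({0..1} \<times> K \<union> {0..1} \<times> B) ?f"
    by (rule lagc_closed_Un[OF 1 2]) (intro closed_subset closed_Times Un_upper1 Un_upper2 closed_atLeastAtMost assms)+
  then show "lagc ({0..1} \<times> UNIV) ?f" by (subst U)
qed auto

text \<open>The sign e enters the height, where it orders the angles, and the normal, where it is
  harmless because a phase depends on its axis only up to sign.\<close>

lemma shell_map_lean_plane:
  assumes J: "shells_ok J" and s: "s \<in> J" "y \<in> shell s"
  shows "shell_map s y = lean_plane (normal_at J y) (pi / 2 * (height J y / width J y))"
proof -
  obtain c R h e where se: "s = (c, R, h, e)" by (cases s) auto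
  note v = in_shell_values[OF J s[unfolded se]] and p = shell_params[OF J s(1)[unfolded se]]
  have "\<bar>height J y / width J y\<bar> \<le> 1"
    using height_le_width[OF J v(1)] width_pos[OF J v(1)] by (simp add: abs_divide)
  then have "\<bar>pi / 2 * (height J y / width J y)\<bar> \<le> pi / 2 * 1" unfolding abs_mult by (intro mult_mono) auto
  then have "lean_plane (normal_at J y) (pi / 2 * (height J y / width J y)) =
      phase (cvec (normal_at J y) 0) (pi / 2 * (height J y / width J y) - pi / 2) ` iR"
    using norm_normal_at[OF J v(1)] by (intro lean_plane_unit) auto
  also have "\<dots> = phase (cvec (sgn (y - c)) 0) (pi / 2 * (height J y / width J y) - pi / 2) ` iR"
  proof -
    have m: "phase (cvec (- a) 0) \<psi> z = phase (cvec a 0) \<psi> z" for a :: "real^'a" and \<psi> z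
    proof -
      have "cvec (- a) 0 = - cvec a 0" by (simp add: vec_eq_iff complex_eq_iff)
      then show ?thesis unfolding phase_def by (simp only: herm_minus_left) (simp add: vec_eq_iff)
    qed
    show ?thesis using p(3) v(2) m by auto
  qed
  also have "\<dots> = shell_map s y" using s(2) by (simp add: se v)
  finally show ?thesis by simp
qed

lemma compact_lower_bound:
  fixes f :: "'a::topological_space \<Rightarrow> real"
  assumes "compact S" "continuous_on S f" "\<And>x. x \<in> S \<Longrightarrow> f x > 0"
  obtains k where "k > 0" "\<And>x. x \<in> S \<Longrightarrow> k \<le> f x"
proof (cases "S = {}")
  case True
  then show ?thesis using that[of 1] by simp
next
  case False
  obtain x0 where "x0 \<in> S" "\<forall>x\<in>S. f x0 \<le> f x"
    using continuous_attains_inf[OF assms(1) False assms(2)] by blast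
  then show ?thesis using that[of "f x0"] assms(3) by blast
qed

text \<open>With C the set of failures, this turns an open condition that holds along t = 0 into one
  that holds for all small t.\<close>

lemma thin_slice:
  fixes C :: "('a::metric_space \<times> real) set"
  assumes "compact C" "\<And>x t. (x, t) \<in> C \<Longrightarrow> t \<noteq> 0"
  obtains \<epsilon> where "\<epsilon> > 0" "\<And>x t. (x, t) \<in> C \<Longrightarrow> \<epsilon> < \<bar>t\<bar>"
proof -
  have "continuous_on C (\<lambda>x. \<bar>snd x\<bar>)" by (intro continuous_intros)
  then obtain k where "k > 0" "\<And>x. x \<in> C \<Longrightarrow> k \<le> \<bar>snd x\<bar>"
    using compact_lower_bound[OF assms(1)] assms(2) by (metis prod.collapse zero_less_abs_iff)
  then show ?thesis using that[of "k / 2"] by fastforce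
qed

text \<open>The height vanishes along curves in the spheres, so its gradient annihilates their
  velocities. Conversely, great circles realize every vector orthogonal to the normal.\<close>

lemma tangent_spheres:
  assumes J: "shells_ok J" and x: "x \<in> spheres J"
  shows "tangent (spheres J) x = {v. v \<bullet> normal_at J x = 0}"
proof (intro equalityI subsetI)
  have xr: "x \<in> region J" using spheres_region[OF J x] .
  have xi: "x \<in> interior_region J"
    using x width_pos[OF J xr] by (simp add: interior_region_def[OF J] spheres_iff[OF J])
  fix v assume "v \<in> tangent (spheres J) x"
  then obtain c e where c: "e > 0" "c 0 = x" "\<And>s. \<bar>s\<bar> < e \<Longrightarrow> c s \<in> spheres J" "(c has_vector_derivative v) (at (0::real))"
    unfolding tangent_def by blast
  have "(c has_derivative (\<lambda>t. t *\<^sub>R v)) (at 0)" using c(4) by (simp add: has_vector_derivative_def)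
  moreover have "(height J has_derivative (\<lambda>v. normal_at J x \<bullet> v)) (at (c 0))"
    using height_derivative[OF J xi] by (simp add: c(2))
  ultimately have d: "((\<lambda>s. height J (c s)) has_derivative (\<lambda>t. normal_at J x \<bullet> (t *\<^sub>R v))) (at 0)"
    by (rule has_derivative_compose)
  have o: "open {-e<..<e}" by simp
  have "((\<lambda>s::real. 0::real) has_derivative (\<lambda>t. 0)) (at 0)" by simp
  then have "((\<lambda>s. height J (c s)) has_derivative (\<lambda>t. 0)) (at 0)"
  proof (rule has_derivative_transform_within_open[OF _ o])
    show "0 = height J (c s)" if "s \<in> {-e<..<e}" for s
    proof -
      have "c s \<in> spheres J" using that by (intro c(3)) auto
      then show ?thesis using spheres_iff[OF J] by simp
    qed
  qed (use c(1) in auto)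
  then have "(\<lambda>t. normal_at J x \<bullet> (t *\<^sub>R v)) = (\<lambda>t. 0)" using d by (rule has_derivative_unique[rotated])
  from fun_cong[OF this, of 1] show "v \<in> {v. v \<bullet> normal_at J x = 0}" by (simp add: inner_commute)
next
  fix v assume "v \<in> {v. v \<bullet> normal_at J x = 0}"
  then have v: "v \<bullet> normal_at J x = 0" by simp
  have xr: "x \<in> region J" using spheres_region[OF J x] .
  obtain c R h e where s: "(c, R, h, e) \<in> J" "x \<in> shell (c, R, h, e)" "0 < h" "h < R" "e = 1 \<or> e = - 1"
    "normal_at J x = e *\<^sub>R sgn (x - c)" "height J x = e * (norm (x - c) - R)" "width J x = h" "norm (x - c) > 0"
    using regionE[OF J xr] by blast
  have n: "norm (x - c) = R" using x s(5,7) by (auto simp: spheres_iff[OF J])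
  have R: "R > 0" using s(3,4) by simp
  have "v \<bullet> (e *\<^sub>R sgn (x - c)) = 0" using v s(6) by simp
  then have vo: "v \<bullet> (x - c) = 0" using s(5) R n by (auto simp: sgn_div_norm)
  show "v \<in> tangent (spheres J) x"
  proof (cases "v = 0")
    case True
    then show ?thesis unfolding tangent_def
      by (intro CollectI exI[of _ "\<lambda>_. x"] exI[of _ 1]) (use x in auto)
  next
    case False
    \<comment> \<open>The angular speed at which the great circle through x has initial velocity
      v.\<close>
    define k where "k = norm v / R"
    have k: "k > 0" using False R by (simp add: k_def)
    define g where "g = (\<lambda>s. c + cos (k * s) *\<^sub>R (x - c) + (sin (k * s) / k) *\<^sub>R v)"
    have "norm (g s - c) = R" for s
    proof -
      have "(norm (g s - c))\<^sup>2 = (cos (k * s))\<^sup>2 * R\<^sup>2 + (sin (k * s) / k)\<^sup>2 * (norm v)\<^sup>2"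
      proof -
        have o: "orthogonal (cos (k * s) *\<^sub>R (x - c)) ((sin (k * s) / k) *\<^sub>R v)"
          using vo by (simp add: orthogonal_def inner_commute)
        have "g s - c = cos (k * s) *\<^sub>R (x - c) + (sin (k * s) / k) *\<^sub>R v" by (simp add: g_def)
        then show ?thesis using norm_add_Pythagorean[OF o] by (simp only: norm_scaleR power_mult_distrib power2_abs n)
      qed
      also have "(sin (k * s) / k)\<^sup>2 * (norm v)\<^sup>2 = (sin (k * s))\<^sup>2 * R\<^sup>2"
        using False R by (simp add: k_def power_divide power_mult_distrib)
      also have "(cos (k * s))\<^sup>2 * R\<^sup>2 + (sin (k * s))\<^sup>2 * R\<^sup>2 = R\<^sup>2"
        by (simp add: distrib_right[symmetric])
      finally show ?thesis using R by (simp add: power2_eq_iff_nonneg)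
    qed
    then have "g s \<in> spheres J" for s
      using s(1) by (force simp: spheres_def dist_norm norm_minus_commute)
    moreover have "(g has_vector_derivative v) (at 0)"
    proof -
      have "(g has_vector_derivative (- (sin (k * 0) * k)) *\<^sub>R (x - c) + (cos (k * 0) * k / k) *\<^sub>R v) (at 0)"
        unfolding g_def by (auto intro!: derivative_eq_intros simp: field_simps)
      then show ?thesis using k by simp
    qed
    moreover have "g 0 = x" by (simp add: g_def)
    ultimately show ?thesis unfolding tangent_def by (intro CollectI exI[of _ g] exI[of _ 1]) auto
  qed
qed

definition clamp1 :: "real \<Rightarrow> real" where
  "clamp1 r = max (- 1) (min 1 r)"

lemma clamp1_eq: "\<bar>r\<bar> \<le> 1 \<Longrightarrow> clamp1 r = r" "r \<ge> 1 \<Longrightarrow> clamp1 r = 1" "r \<le> - 1 \<Longrightarrow> clamp1 r = - 1"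
  by (auto simp: clamp1_def abs_le_iff)

lemma clamp1_far: "\<bar>r\<bar> \<ge> 1 \<Longrightarrow> pi / 2 * clamp1 r = pi / 2 \<or> pi / 2 * clamp1 r = - (pi / 2)"
  by (cases "r \<ge> 0") (auto simp: clamp1_eq)

lemma continuous_on_clamp1 [continuous_intros]: "continuous_on S f \<Longrightarrow> continuous_on S (\<lambda>x. clamp1 (f x))"
  unfolding clamp1_def by (intro continuous_intros)

section \<open>Arbitrary tubular neighbourhoods of round spheres\<close>

context
  fixes J :: "((real^'n) \<times> real \<times> real \<times> real) set" and \<Phi> :: "(real^'n) \<times> real \<Rightarrow> real^'n"
  assumes J: "shells_ok J" and \<Phi>: "tubular (spheres J) (normal_at J) \<Phi>"
begin

definition dirn :: "(real^'n) \<times> real \<Rightarrow> real^'n" where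
  "dirn p = frechet_derivative \<Phi> (at p) (0, 1)"

lemma tubeE:
  obtains W where "open W" "spheres J \<times> {-1..1} \<subseteq> W" "continuous_on W \<Phi>" "continuous_on W dirn"
    "\<And>p. p \<in> W \<Longrightarrow> (\<Phi> has_derivative frechet_derivative \<Phi> (at p)) (at p)"
proof -
  obtain W where W: "open W" "spheres J \<times> {-1..1} \<subseteq> W" "smooth_on W \<Phi>"
    using \<Phi> unfolding tubular_def by blast
  have "Ck_on (Suc 0) W \<Phi>" using W(3) unfolding smooth_on_def by blast
  then have 1: "\<And>p. p \<in> W \<Longrightarrow> \<Phi> differentiable (at p)" and 2: "continuous_on W (\<lambda>x. frechet_derivative \<Phi> (at x) (0, 1))"
    by simp_all
  have "continuous_on W \<Phi>"
    using 1 differentiable_imp_continuous_within by (intro continuous_at_imp_continuous_on) blast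
  then show ?thesis using that[OF W(1,2)] 1 2 frechet_derivative_works by (auto simp: dirn_def[abs_def])
qed

lemma tube_inj: "inj_on \<Phi> (spheres J \<times> {-1..1})"
  using \<Phi> unfolding tubular_def by blast

lemma tube_zero: "x \<in> spheres J \<Longrightarrow> \<Phi> (x, 0) = x"
  using \<Phi> unfolding tubular_def by blast

lemma dirn_zero: "x \<in> spheres J \<Longrightarrow> dirn (x, 0) \<bullet> normal_at J x > 0"
  using \<Phi> unfolding tubular_def dirn_def by blast

text \<open>The component of d/dt orthogonal to the tangent space of the leaf is nonzero since the
  differential is injective; rescaled, it is the covector dt.\<close>

lemma tube_dual:
  assumes x: "x \<in> spheres J" and t: "t \<in> {-1..1}"
  obtains \<eta> where "\<eta> \<bullet> dirn (x, t) = 1"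
    "\<And>h. h \<in> tangent (spheres J) x \<Longrightarrow> \<eta> \<bullet> frechet_derivative \<Phi> (at (x, t)) (h, 0) = 0"
proof -
  let ?D = "frechet_derivative \<Phi> (at (x, t))" and ?T = "tangent (spheres J) x"
  have "\<exists>W. open W \<and> spheres J \<times> {-1..1} \<subseteq> W \<and> (\<forall>p\<in>W. (\<Phi> has_derivative frechet_derivative \<Phi> (at p)) (at p))"
    using tubeE by metis
  then have lin: "linear ?D" using has_derivative_linear x t by blast
  have sT: "subspace ?T" unfolding tangent_spheres[OF J x] by (auto simp: subspace_def inner_add_left)
  define V where "V = (\<lambda>h. ?D (h, 0)) ` ?T"
  have "linear (\<lambda>h. ?D (h, 0))"
    by (rule linearI) (use linear_add[OF lin, of "(_, 0)" "(_, 0)"] linear_scale[OF lin, of _ "(_, 0)"] in auto)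
  then have sV: "subspace V" unfolding V_def using sT by (rule linear_subspace_image)
  define p where "p = closest_point V (dirn (x, t))"
  have inj: "inj_on ?D (?T \<times> UNIV)" using \<Phi> x t unfolding tubular_def by blast
  have "dirn (x, t) \<notin> V"
  proof
    assume "dirn (x, t) \<in> V"
    then obtain h where "h \<in> ?T" "?D (0, 1) = ?D (h, 0)" by (auto simp: V_def dirn_def)
    moreover have "0 \<in> ?T" using subspace_0[OF sT] .
    ultimately have "(0, 1) = (h, 0::real)" using inj unfolding inj_on_def by blast
    then show False by simp
  qed
  then have nz: "dirn (x, t) - p \<noteq> 0" using closest_point_mem[OF sV, of "dirn (x, t)"] by (auto simp: p_def)
  have perp: "(dirn (x, t) - p) \<bullet> w = 0" if "w \<in> V" for w
    unfolding p_def by (rule closest_point_perp[OF sV that])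
  have "(dirn (x, t) - p) \<bullet> p = 0" by (rule perp) (simp add: p_def closest_point_mem[OF sV])
  then have "(dirn (x, t) - p) \<bullet> dirn (x, t) = (dirn (x, t) - p) \<bullet> (dirn (x, t) - p)"
    by (simp add: inner_diff_right)
  then have pos: "(dirn (x, t) - p) \<bullet> dirn (x, t) \<noteq> 0" using nz by simp
  show ?thesis
  proof (rule that[of "(1 / ((dirn (x, t) - p) \<bullet> dirn (x, t))) *\<^sub>R (dirn (x, t) - p)"])
    show "(1 / ((dirn (x, t) - p) \<bullet> dirn (x, t))) *\<^sub>R (dirn (x, t) - p) \<bullet> dirn (x, t) = 1"
      unfolding inner_scaleR_left using pos by simp
    show "(1 / ((dirn (x, t) - p) \<bullet> dirn (x, t))) *\<^sub>R (dirn (x, t) - p) \<bullet> ?D (h, 0) = 0" if "h \<in> ?T" for h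
      unfolding inner_scaleR_left using perp[of "?D (h, 0)"] that by (simp add: V_def)
  qed
qed

text \<open>The defining set is a union over admissible \<eta>. All its members are the same plane,
  and \<open>tube_dual\<close> ensures that there is one.\<close>

lemma tube_plane_eq:
  assumes x: "x \<in> spheres J" and t: "t \<in> {-1..1}"
  shows "tube_plane (spheres J) \<Phi> (x, t) = lean_plane (dirn (x, t)) (pi * t / 2)"
    and "dirn (x, t) \<noteq> 0"
proof -
  obtain \<eta> where \<eta>: "\<eta> \<bullet> dirn (x, t) = 1"
    "\<And>h. h \<in> tangent (spheres J) x \<Longrightarrow> \<eta> \<bullet> frechet_derivative \<Phi> (at (x, t)) (h, 0) = 0"
    using tube_dual[OF x t] by blast
  show "dirn (x, t) \<noteq> 0" using \<eta>(1) by auto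
  have "\<bar>pi * t / 2\<bar> \<le> pi / 2" using t by (auto simp: abs_mult abs_le_iff)
  then have c: "cos (pi * t / 2) \<ge> 0" by (intro cos_ge_zero) (auto simp: abs_le_iff)
  let ?S = "\<lambda>\<eta>. {cvec 0 \<xi> + s *\<^sub>R (sin (pi * t / 2) *\<^sub>R cvec 0 \<eta> + cos (pi * t / 2) *\<^sub>R cvec (dirn (x, t)) 0) | \<xi> s. \<xi> \<bullet> dirn (x, t) = 0}"
  have "tube_plane (spheres J) \<Phi> (x, t) = (\<Union>\<eta>\<in>{\<eta>. \<eta> \<bullet> dirn (x, t) = 1 \<and>
      (\<forall>h\<in>tangent (spheres J) x. \<eta> \<bullet> frechet_derivative \<Phi> (at (x, t)) (h, 0) = 0)}. ?S \<eta>)"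
    unfolding tube_plane_def Let_def dirn_def[symmetric] case_prod_conv by blast
  also have "\<dots> = (\<Union>\<eta>\<in>{\<eta>. \<eta> \<bullet> dirn (x, t) = 1 \<and>
      (\<forall>h\<in>tangent (spheres J) x. \<eta> \<bullet> frechet_derivative \<Phi> (at (x, t)) (h, 0) = 0)}. lean_plane (dirn (x, t)) (pi * t / 2))"
    by (rule SUP_cong[OF refl]) (use fold_plane_eq[OF _ c] in blast)
  also have "\<dots> = lean_plane (dirn (x, t)) (pi * t / 2)" using \<eta> by blast
  finally show "tube_plane (spheres J) \<Phi> (x, t) = lean_plane (dirn (x, t)) (pi * t / 2)" .
qed

text \<open>Invariance of domain needs an open set of R^n, so the product of spheres and interval is
  parametrized through b by the interior of the round collar.\<close>

lemma open_tube:
  assumes \<delta>: "0 < \<delta>" "\<delta> \<le> 1"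
  shows "open (\<Phi> ` (spheres J \<times> {-\<delta><..<\<delta>}))"
proof -
  let ?I = "interior_region J"
  obtain W where W: "open W" "spheres J \<times> {-1..1} \<subseteq> W" "continuous_on W \<Phi>" by (rule tubeE) (rule that)
  have Ir: "?I \<subseteq> region J" by (auto simp: interior_region_def[OF J])
  define b where "b = (\<lambda>y. (y - height J y *\<^sub>R normal_at J y, height J y * \<delta> / width J y))"
  have bX: "b y \<in> spheres J \<times> {-\<delta><..<\<delta>}" if "y \<in> ?I" for y
  proof -
    have y: "y \<in> region J" "\<bar>height J y\<bar> < width J y" using that by (auto simp: interior_region_def[OF J])
    have w: "width J y > 0" by (rule width_pos[OF J y(1)])
    have "\<bar>height J y * \<delta> / width J y\<bar> < \<delta>"
    proof -
      have "\<bar>height J y\<bar> * \<delta> < width J y * \<delta>" using y(2) \<delta>(1) by (rule mult_strict_right_mono)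
      then show ?thesis using w \<delta>(1) by (simp add: abs_mult pos_divide_less_eq mult.commute)
    qed
    moreover have "r \<in> {-\<delta><..<\<delta>}" if "\<bar>r\<bar> < \<delta>" for r :: real using that by auto
    ultimately show ?thesis unfolding b_def by (intro SigmaI collar_projection(1)[OF J y(1)])
  qed
  have "continuous_on ?I b"
    unfolding b_def
    by (intro continuous_intros continuous_on_subset[OF collar_continuous(1)[OF J] Ir]
        continuous_on_subset[OF collar_continuous(2)[OF J] Ir] continuous_on_subset[OF collar_continuous(3)[OF J] Ir])
      (use width_pos[OF J] Ir in force)
  then have cont: "continuous_on ?I (\<lambda>y. \<Phi> (b y))"
    by (rule continuous_on_compose2[OF W(3)]) (use bX W(2) \<delta> in force)
  have inj: "inj_on (\<lambda>y. \<Phi> (b y)) ?I"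
  proof (rule inj_onI)
    fix y z assume y: "y \<in> ?I" and z: "z \<in> ?I" and eq: "\<Phi> (b y) = \<Phi> (b z)"
    have "b y \<in> spheres J \<times> {-1..1}" "b z \<in> spheres J \<times> {-1..1}" using bX[OF y] bX[OF z] \<delta> by auto
    then have byz: "b y = b z" using tube_inj eq by (meson inj_onD)
    have yr: "y \<in> region J" and zr: "z \<in> region J" using y z Ir by auto
    note py = collar_projection[OF J yr] and pz = collar_projection[OF J zr]
    have 1: "y - height J y *\<^sub>R normal_at J y = z - height J z *\<^sub>R normal_at J z"
      and 2: "height J y * \<delta> / width J y = height J z * \<delta> / width J z" using byz by (auto simp: b_def)
    have "normal_at J y = normal_at J z" "width J y = width J z" using py pz 1 by metis+
    moreover then have "height J y = height J z" using 2 \<delta>(1) width_pos[OF J yr] by (simp add: field_simps)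
    ultimately show "y = z" using 1 by simp
  qed
  have "open ((\<lambda>y. \<Phi> (b y)) ` ?I)"
    by (rule invariance_of_domain[OF cont open_interior_region[OF J] inj])
  moreover have "b ` ?I = spheres J \<times> {-\<delta><..<\<delta>}"
  proof (intro equalityI subsetI)
    fix p assume p: "p \<in> spheres J \<times> {-\<delta><..<\<delta>}"
    then obtain x t where xt: "p = (x, t)" "x \<in> spheres J" "\<bar>t\<bar> < \<delta>" by auto
    have w: "width J x > 0" using width_pos[OF J spheres_region[OF J xt(2)]] .
    define r where "r = t / \<delta> * width J x"
    have "\<bar>t / \<delta>\<bar> < 1" using xt(3) \<delta>(1) by (simp add: abs_divide)
    then have "\<bar>t / \<delta>\<bar> * width J x < 1 * width J x" using w by (rule mult_strict_right_mono)
    then have r: "\<bar>r\<bar> < width J x" using w by (simp only: r_def abs_mult abs_of_pos mult_1)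
    note v = collar_values[OF J xt(2) less_imp_le[OF r]]
    have "x + r *\<^sub>R normal_at J x \<in> ?I" using v r by (simp add: interior_region_def[OF J])
    moreover have "b (x + r *\<^sub>R normal_at J x) = p" using v w \<delta>(1) by (simp add: b_def xt(1) r_def)
    ultimately show "p \<in> b ` ?I" by (metis image_eqI)
  qed (use bX in blast)
  ultimately show ?thesis by (metis image_image)
qed

end

lemma localhom_cong:
  "localhom A f g \<Longrightarrow> (\<And>q. f q = f' q) \<Longrightarrow> (\<And>q. g q = g' q) \<Longrightarrow> localhom A f' g'"
  by (metis ext)

context
  fixes J :: "((real^'n) \<times> real \<times> real \<times> real) set" and \<Phi> :: "(real^'n) \<times> real \<Rightarrow> real^'n"
  assumes J: "shells_ok J" and \<Phi>: "tubular (spheres J) (normal_at J) \<Phi>"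
begin

definition tinv :: "real^'n \<Rightarrow> (real^'n) \<times> real" where
  "tinv = inv_into (spheres J \<times> {-1..1}) \<Phi>"

definition slab :: "real \<Rightarrow> (real^'n) set" where
  "slab \<delta> = \<Phi> ` (spheres J \<times> {-\<delta>..\<delta>})"

lemma tube_domain:
  obtains W where "spheres J \<times> {-1..1} \<subseteq> W" "continuous_on W \<Phi>" "continuous_on W (dirn \<Phi>)"
    "\<And>p. p \<in> W \<Longrightarrow> (\<Phi> has_derivative frechet_derivative \<Phi> (at p)) (at p)"
  by (rule tubeE[OF J \<Phi>]) (rule that)

lemma continuous_on_tube: "continuous_on (spheres J \<times> {-1..1}) \<Phi>"
  "continuous_on (spheres J \<times> {-1..1}) (dirn \<Phi>)"
proof -
  obtain W where W: "spheres J \<times> {-1..1} \<subseteq> W" "continuous_on W \<Phi>" "continuous_on W (dirn \<Phi>)"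
    by (rule tube_domain) (rule that)
  show "continuous_on (spheres J \<times> {-1..1}) \<Phi>" "continuous_on (spheres J \<times> {-1..1}) (dirn \<Phi>)"
    by (rule continuous_on_subset[OF W(2,1)], rule continuous_on_subset[OF W(3,1)])
qed

lemma tinv_tube: "x \<in> spheres J \<Longrightarrow> \<bar>t\<bar> \<le> 1 \<Longrightarrow> tinv (\<Phi> (x, t)) = (x, t)"
  unfolding tinv_def by (intro inv_into_f_f tube_inj[OF J \<Phi>]) (auto simp: abs_le_iff)

lemma slabE:
  assumes "q \<in> slab \<delta>" "\<delta> \<le> 1"
  obtains x t where "x \<in> spheres J" "\<bar>t\<bar> \<le> \<delta>" "q = \<Phi> (x, t)" "tinv q = (x, t)"
proof -
  obtain x t where xt: "x \<in> spheres J" "t \<in> {-\<delta>..\<delta>}" "q = \<Phi> (x, t)" using assms(1) by (auto simp: slab_def)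
  then have "\<bar>t\<bar> \<le> \<delta>" by auto
  then show ?thesis using that[OF xt(1) _ xt(3)] tinv_tube[OF xt(1)] assms(2) xt(3) by simp
qed

lemma slabI: "x \<in> spheres J \<Longrightarrow> \<bar>t\<bar> \<le> \<delta> \<Longrightarrow> \<Phi> (x, t) \<in> slab \<delta>"
  by (auto simp: slab_def abs_le_iff)

lemma compact_slab: "\<delta> \<le> 1 \<Longrightarrow> compact (slab \<delta>)"
  unfolding slab_def
  by (intro compact_continuous_image continuous_on_subset[OF continuous_on_tube(1)] compact_Times
      compact_spheres[OF J] compact_Icc) auto

lemma slab_mono: "\<delta> \<le> \<delta>' \<Longrightarrow> slab \<delta> \<subseteq> slab \<delta>'"
  unfolding slab_def by (intro image_mono Sigma_mono) auto

lemma continuous_on_tinv: "continuous_on (slab 1) tinv"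
  unfolding slab_def
  by (rule continuous_on_inv[OF continuous_on_tube(1)])
    (use tinv_tube in \<open>auto intro!: compact_Times compact_spheres[OF J] simp: abs_le_iff\<close>)

lemma continuous_on_coords:
  assumes "\<delta> \<le> 1"
  shows "continuous_on (slab \<delta>) (\<lambda>q. dirn \<Phi> (tinv q))" "continuous_on (slab \<delta>) (\<lambda>q. snd (tinv q))"
proof -
  have c: "continuous_on (slab \<delta>) tinv" by (rule continuous_on_subset[OF continuous_on_tinv slab_mono[OF assms]])
  have "tinv q \<in> spheres J \<times> {-1..1}" if "q \<in> slab \<delta>" for q
    using that assms by (rule slabE) (use assms in \<open>auto simp: abs_le_iff\<close>)
  then show "continuous_on (slab \<delta>) (\<lambda>q. dirn \<Phi> (tinv q))"
    by (intro continuous_on_compose2[OF continuous_on_tube(2) c]) blast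
  show "continuous_on (slab \<delta>) (\<lambda>q. snd (tinv q))" by (intro continuous_intros c)
qed

lemma dirn_nonzero: "q \<in> slab 1 \<Longrightarrow> dirn \<Phi> (tinv q) \<noteq> 0"
proof (erule slabE)
  show "dirn \<Phi> (tinv q) \<noteq> 0" if "x \<in> spheres J" "\<bar>t\<bar> \<le> 1" "tinv q = (x, t)" for x t
    unfolding that(3) using that(2) by (intro tube_plane_eq(2)[OF J \<Phi> that(1)]) (auto simp: abs_le_iff)
qed simp

lemma fold_map_extend:
  "fold_map (spheres J) \<Phi> = extend (\<lambda>q. if q \<in> slab 1 then lean_plane (dirn \<Phi> (tinv q)) (pi / 2 * snd (tinv q)) else iR)"
proof
  fix p
  have "tube_plane (spheres J) \<Phi> (tinv q) = lean_plane (dirn \<Phi> (tinv q)) (pi / 2 * snd (tinv q))" if "q \<in> slab 1" for q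
    using that
  proof (rule slabE)
    show "tube_plane (spheres J) \<Phi> (tinv q) = lean_plane (dirn \<Phi> (tinv q)) (pi / 2 * snd (tinv q))"
      if "x \<in> spheres J" "\<bar>t\<bar> \<le> 1" "tinv q = (x, t)" for x t
    proof -
      have "t \<in> {-1..1}" using that(2) by (auto simp: abs_le_iff)
      from tube_plane_eq(1)[OF J \<Phi> that(1) this] show ?thesis by (simp add: that(3))
    qed
  qed simp
  then show "fold_map (spheres J) \<Phi> p = extend (\<lambda>q. if q \<in> slab 1 then lean_plane (dirn \<Phi> (tinv q)) (pi / 2 * snd (tinv q)) else iR) p"
    by (simp add: fold_map_def extend_def slab_def tinv_def split: option.split)
qed

text \<open>For small t the tube lies in the round collar and d/dt points to the same side as the
  round normal: both hold at t = 0 and the failures form compact sets. The height then increases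
  along the fibres, and compactness supplies k, chosen below the widths as well.\<close>

lemma thin_collar:
  obtains \<epsilon> k where "0 < \<epsilon>" "\<epsilon> \<le> 1" "0 < k"
    "\<And>x t. x \<in> spheres J \<Longrightarrow> \<bar>t\<bar> \<le> \<epsilon> \<Longrightarrow> \<Phi> (x, t) \<in> region J"
    "\<And>x t. x \<in> spheres J \<Longrightarrow> \<bar>t\<bar> \<le> \<epsilon> \<Longrightarrow> dirn \<Phi> (x, t) \<bullet> normal_at J (\<Phi> (x, t)) > 0"
    "\<And>x. x \<in> spheres J \<Longrightarrow> height J (\<Phi> (x, \<epsilon>)) \<ge> k"
    "\<And>x. x \<in> spheres J \<Longrightarrow> height J (\<Phi> (x, - \<epsilon>)) \<le> - k"
    "\<And>y. y \<in> region J \<Longrightarrow> width J y \<ge> k"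
proof -
  let ?X = "spheres J \<times> {-1..1::real}" and ?I = "interior_region J"
  have cX: "compact ?X" by (intro compact_Times compact_spheres[OF J] compact_Icc)
  have Ir: "?I \<subseteq> region J" by (auto simp: interior_region_def[OF J])
  have SI: "x \<in> ?I" if "x \<in> spheres J" for x
    using that spheres_iff[OF J] width_pos[OF J] by (auto simp: interior_region_def[OF J])
  have "closed (?X \<inter> \<Phi> -` (- ?I))"
    by (intro continuous_closed_preimage[OF continuous_on_tube(1)] compact_imp_closed[OF cX])
      (use open_interior_region[OF J] in auto)
  from compact_Int_closed[OF cX this] have c1: "compact (?X \<inter> \<Phi> -` (- ?I))" by (simp add: Int_assoc[symmetric])
  have n1: "t \<noteq> 0" if "(x, t) \<in> ?X \<inter> \<Phi> -` (- ?I)" for x t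
    using that SI tube_zero[OF J \<Phi>] by auto
  have "\<exists>\<epsilon>1>0. \<forall>x t. (x, t) \<in> ?X \<inter> \<Phi> -` (- ?I) \<longrightarrow> \<epsilon>1 < \<bar>t\<bar>"
    by (rule thin_slice[OF c1]) (use n1 in blast)+
  then obtain \<epsilon>1 where e1: "\<epsilon>1 > 0" "\<And>x t. (x, t) \<in> ?X \<inter> \<Phi> -` (- ?I) \<Longrightarrow> \<epsilon>1 < \<bar>t\<bar>" by blast
  define \<delta> where "\<delta> = min 1 \<epsilon>1"
  have d: "0 < \<delta>" "\<delta> \<le> 1" "\<delta> \<le> \<epsilon>1" using e1(1) by (simp_all add: \<delta>_def)
  have inI: "\<Phi> (x, t) \<in> ?I" if "x \<in> spheres J" "\<bar>t\<bar> \<le> \<delta>" for x t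
  proof (rule ccontr)
    assume "\<Phi> (x, t) \<notin> ?I"
    moreover have "t \<in> {-1..1}" using that d by (auto simp: abs_le_iff)
    ultimately have "(x, t) \<in> ?X \<inter> \<Phi> -` (- ?I)" using that by simp
    from e1(2)[OF this] show False using that d by simp
  qed
  let ?Y = "spheres J \<times> {-\<delta>..\<delta>}"
  have YX: "?Y \<subseteq> ?X" using d by auto
  have YI: "\<Phi> p \<in> ?I" if "p \<in> ?Y" for p
    using inI[of "fst p" "snd p"] that by (auto simp: abs_le_iff)
  have cY: "compact ?Y" by (intro compact_Times compact_spheres[OF J] compact_Icc)
  have c\<Phi>: "continuous_on ?Y \<Phi>" "continuous_on ?Y (dirn \<Phi>)"
    using continuous_on_subset[OF _ YX] continuous_on_tube by blast+
  have cont: "continuous_on ?Y (\<lambda>p. g (\<Phi> p))" if "continuous_on (region J) g" for g :: "real^'n \<Rightarrow> 'c::topological_space"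
    using YI Ir by (intro continuous_on_compose2[OF that c\<Phi>(1)]) blast
  let ?D = "\<lambda>p. dirn \<Phi> p \<bullet> normal_at J (\<Phi> p)"
  have "continuous_on ?Y ?D" by (intro continuous_intros c\<Phi>(2) cont collar_continuous(1)[OF J])
  then have "closed (?Y \<inter> ?D -` {..0})"
    by (rule continuous_closed_preimage[OF _ compact_imp_closed[OF cY]]) simp
  from compact_Int_closed[OF cY this] have c2: "compact (?Y \<inter> ?D -` {..0})" by (simp add: Int_assoc[symmetric])
  have n2: "t \<noteq> 0" if xt: "(x, t) \<in> ?Y \<inter> ?D -` {..0}" for x t
  proof
    assume "t = 0"
    moreover have "x \<in> spheres J" "dirn \<Phi> (x, t) \<bullet> normal_at J (\<Phi> (x, t)) \<le> 0" using xt by auto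
    ultimately show False using dirn_zero[OF J \<Phi>, of x] tube_zero[OF J \<Phi>, of x] by simp
  qed
  have "\<exists>\<epsilon>2>0. \<forall>x t. (x, t) \<in> ?Y \<inter> ?D -` {..0} \<longrightarrow> \<epsilon>2 < \<bar>t\<bar>"
    by (rule thin_slice[OF c2]) (use n2 in blast)+
  then obtain \<epsilon>2 where e2: "\<epsilon>2 > 0" "\<And>x t. (x, t) \<in> ?Y \<inter> ?D -` {..0} \<Longrightarrow> \<epsilon>2 < \<bar>t\<bar>" by blast
  define \<epsilon> where "\<epsilon> = min \<delta> \<epsilon>2"
  have e: "0 < \<epsilon>" "\<epsilon> \<le> 1" "\<epsilon> \<le> \<epsilon>2" "\<epsilon> \<le> \<delta>" using d e2(1) by (simp_all add: \<epsilon>_def)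
  have pos: "?D (x, t) > 0" if "x \<in> spheres J" "\<bar>t\<bar> \<le> \<epsilon>" for x t
  proof (rule ccontr)
    assume "\<not> ?D (x, t) > 0"
    moreover have "t \<in> {-\<delta>..\<delta>}" using that e by (auto simp: abs_le_iff)
    ultimately have "(x, t) \<in> ?Y \<inter> ?D -` {..0}" using that by simp
    from e2(2)[OF this] show False using that e by simp
  qed
  \<comment> \<open>By the chain rule the t-derivative of the height is the product of
    \<open>dirn\<close> with the normal, which is positive here.\<close>
  have incr: "height J (\<Phi> (x, a)) < height J (\<Phi> (x, b))" if x: "x \<in> spheres J" and ab: "- \<epsilon> \<le> a" "a < b" "b \<le> \<epsilon>" for x a b
  proof (rule DERIV_pos_imp_increasing[OF ab(2)])
    fix t assume "a \<le> t" "t \<le> b"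
    then have t: "\<bar>t\<bar> \<le> \<epsilon>" using ab by auto
    obtain W where W: "?X \<subseteq> W" "\<And>p. p \<in> W \<Longrightarrow> (\<Phi> has_derivative frechet_derivative \<Phi> (at p)) (at p)"
      by (rule tube_domain) (rule that)
    have "t \<in> {-1..1}" using t e by (auto simp: abs_le_iff)
    then have "(x, t) \<in> W" using W(1) x by blast
    note D = W(2)[OF this]
    have "((\<lambda>t. (x, t)) has_derivative (\<lambda>s. (0, s))) (at t)" by (auto intro!: derivative_eq_intros)
    from has_derivative_compose[OF this D]
    have 1: "((\<lambda>t. \<Phi> (x, t)) has_derivative (\<lambda>s. frechet_derivative \<Phi> (at (x, t)) (0, s))) (at t)" .
    have "\<Phi> (x, t) \<in> ?I" using inI[OF x] t e by simp
    from has_derivative_compose[OF 1 height_derivative[OF J this]]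
    have 2: "((\<lambda>t. height J (\<Phi> (x, t))) has_derivative (\<lambda>s. normal_at J (\<Phi> (x, t)) \<bullet> frechet_derivative \<Phi> (at (x, t)) (0, s))) (at t)" .
    have "frechet_derivative \<Phi> (at (x, t)) (0, s) = s *\<^sub>R dirn \<Phi> (x, t)" for s
      using linear_scale[OF has_derivative_linear[OF D], of s "(0, 1)"] by (simp add: dirn_def[OF J \<Phi>])
    then have "((\<lambda>t. height J (\<Phi> (x, t))) has_derivative (\<lambda>s. ?D (x, t) * s)) (at t)"
      using 2 by (simp add: inner_commute mult.commute)
    then have "((\<lambda>t. height J (\<Phi> (x, t))) has_field_derivative ?D (x, t)) (at t)"
      by (simp add: has_field_derivative_def)
    then show "\<exists>y. ((\<lambda>t. height J (\<Phi> (x, t))) has_real_derivative y) (at t) \<and> 0 < y"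
      using pos[OF x t] by blast
  qed
  have zero: "height J (\<Phi> (x, 0)) = 0" if "x \<in> spheres J" for x
    using that tube_zero[OF J \<Phi> that] by (simp add: spheres_iff[OF J])
  have hc: "continuous_on (spheres J) (\<lambda>x. height J (\<Phi> (x, t)))" if "\<bar>t\<bar> \<le> \<epsilon>" for t
  proof (rule continuous_on_compose2[OF cont[OF collar_continuous(2)[OF J]], of _ "\<lambda>x. (x, t)"])
    show "(\<lambda>x. (x, t)) ` spheres J \<subseteq> ?Y" using that e by (auto simp: abs_le_iff)
  qed (intro continuous_intros)
  obtain k1 where k1: "k1 > 0" "\<And>x. x \<in> spheres J \<Longrightarrow> k1 \<le> height J (\<Phi> (x, \<epsilon>))"
  proof (rule compact_lower_bound[OF compact_spheres[OF J] hc[of \<epsilon>]])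
    show "height J (\<Phi> (x, \<epsilon>)) > 0" if "x \<in> spheres J" for x using incr[OF that, of 0 \<epsilon>] zero[OF that] e by simp
  qed (use e in auto)
  obtain k2 where k2: "k2 > 0" "\<And>x. x \<in> spheres J \<Longrightarrow> k2 \<le> - height J (\<Phi> (x, - \<epsilon>))"
  proof (rule compact_lower_bound[OF compact_spheres[OF J] continuous_on_minus[OF hc[of "- \<epsilon>"]]])
    show "- height J (\<Phi> (x, - \<epsilon>)) > 0" if "x \<in> spheres J" for x using incr[OF that, of "- \<epsilon>" 0] zero[OF that] e by simp
  qed (use e in auto)
  obtain k3 where k3: "k3 > 0" "\<And>x. x \<in> spheres J \<Longrightarrow> k3 \<le> width J x"
  proof (rule compact_lower_bound[OF compact_spheres[OF J]])
    show "continuous_on (spheres J) (width J)"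
      by (rule continuous_on_subset[OF collar_continuous(3)[OF J]]) (use spheres_region[OF J] in blast)
    show "width J x > 0" if "x \<in> spheres J" for x using width_pos[OF J spheres_region[OF J that]] .
  qed auto
  show ?thesis
  proof (rule that[of \<epsilon> "min k1 (min k2 k3)"])
    show "\<Phi> (x, t) \<in> region J" if "x \<in> spheres J" "\<bar>t\<bar> \<le> \<epsilon>" for x t using inI[OF that(1), of t] that(2) e Ir by force
    show "width J y \<ge> min k1 (min k2 k3)" if "y \<in> region J" for y
      using k3(2)[OF collar_projection(1)[OF J that]] collar_projection(3)[OF J that] by simp
    show "height J (\<Phi> (x, \<epsilon>)) \<ge> min k1 (min k2 k3)" if "x \<in> spheres J" for x using k1(2)[OF that] by simp
    show "height J (\<Phi> (x, - \<epsilon>)) \<le> - min k1 (min k2 k3)" if "x \<in> spheres J" for x using k2(2)[OF that] by simp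
  qed (use e pos k1(1) k2(1) k3(1) in auto)
qed

text \<open>The normal segment from the foot point to y is connected, starts in the slab and cannot
  meet the ends t = \<epsilon> and t = -\<epsilon>, where the height is at least k in absolute
  value. Hence it never leaves the slab.\<close>

lemma slab_swallows_collar:
  assumes e: "0 < \<epsilon>" "\<epsilon> \<le> 1" and k: "\<And>x. x \<in> spheres J \<Longrightarrow> height J (\<Phi> (x, \<epsilon>)) \<ge> k"
    "\<And>x. x \<in> spheres J \<Longrightarrow> height J (\<Phi> (x, - \<epsilon>)) \<le> - k"
    and y: "y \<in> region J" "\<bar>height J y\<bar> < k"
  shows "y \<in> slab \<epsilon>"
proof -
  define x n r where "x = y - height J y *\<^sub>R normal_at J y" and "n = normal_at J y" and "r = \<bar>height J y\<bar>"
  note p = collar_projection[OF J y(1), folded x_def]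
  have nx: "normal_at J x = n" using p(2) by (simp add: n_def)
  define A where "A = (\<lambda>s. x + s *\<^sub>R n) ` {-r..r}"
  define U where "U = \<Phi> ` (spheres J \<times> {-\<epsilon><..<\<epsilon>})"
  have hA: "\<bar>height J q\<bar> < k" if qA: "q \<in> A" for q
  proof -
    obtain s where sr: "s \<in> {-r..r}" and q: "q = x + s *\<^sub>R n" using qA unfolding A_def by blast
    have s: "\<bar>s\<bar> \<le> r" "q = x + s *\<^sub>R n" using sr q by auto
    have "\<bar>s\<bar> \<le> width J x" using s(1) height_le_width[OF J y(1)] p(3) by (simp add: r_def)
    from collar_values(3)[OF J p(1) this] have "height J q = s" by (simp add: s(2) nx)
    then show ?thesis using s(1) y(2) by (simp add: r_def)
  qed
  have "connected A" unfolding A_def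
    by (intro connected_continuous_image continuous_intros connected_Icc)
  moreover have "open U" unfolding U_def by (rule open_tube[OF J \<Phi> e])
  moreover have "open (- slab \<epsilon>)" using compact_imp_closed[OF compact_slab[OF e(2)]] by (rule open_Compl)
  moreover have "U \<subseteq> slab \<epsilon>" unfolding U_def slab_def by (intro image_mono Sigma_mono) auto
  moreover have "A \<subseteq> U \<union> - slab \<epsilon>"
  proof
    fix q assume q: "q \<in> A"
    show "q \<in> U \<union> - slab \<epsilon>"
    proof (cases "q \<in> slab \<epsilon>")
      case True
      then obtain z t where z: "z \<in> spheres J" "\<bar>t\<bar> \<le> \<epsilon>" "q = \<Phi> (z, t)" using e(2) by (rule slabE) (rule that)
      have "t \<noteq> \<epsilon>" "t \<noteq> - \<epsilon>" using hA[OF q] k[OF z(1)] z(3) by auto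
      then have "t \<in> {-\<epsilon><..<\<epsilon>}" using z(2) by auto
      then show ?thesis using z by (auto simp: U_def)
    qed simp
  qed
  ultimately have "U \<inter> A = {} \<or> - slab \<epsilon> \<inter> A = {}" using connectedD[of A U "- slab \<epsilon>"] by blast
  moreover have "x \<in> U \<inter> A"
  proof
    show "x \<in> U" unfolding U_def using tube_zero[OF J \<Phi> p(1)] p(1) e(1) by (intro image_eqI[of _ _ "(x, 0)"]) auto
    show "x \<in> A" unfolding A_def by (intro image_eqI[of _ _ 0]) (auto simp: r_def)
  qed
  moreover have "y \<in> A" unfolding A_def
    by (intro image_eqI[of _ _ "height J y"]) (auto simp: r_def x_def n_def)
  ultimately show ?thesis by blast
qed

text \<open>A tubular neighbourhood is first shrunk to the slab \<open>\<bar>t\<bar> \<le> \<epsilon>\<close>; there \<open>\<partial>/\<partial>t\<close> and \<open>t\<close> are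
  interpolated with the round normal and the height, and finally the height is rescaled to fill
  the shells.\<close>

lemma localhom_fold_map:
  "localhom (slab 1 \<union> region J) (\<lambda>q. if q \<in> slab 1 then lean_plane (dirn \<Phi> (tinv q)) (pi / 2 * snd (tinv q)) else iR)
    (glue J shell shell_map)"
proof -
  obtain \<epsilon> k where e: "0 < \<epsilon>" "\<epsilon> \<le> 1" and k: "0 < k"
    and inR: "\<And>x t. x \<in> spheres J \<Longrightarrow> \<bar>t\<bar> \<le> \<epsilon> \<Longrightarrow> \<Phi> (x, t) \<in> region J"
    and pos: "\<And>x t. x \<in> spheres J \<Longrightarrow> \<bar>t\<bar> \<le> \<epsilon> \<Longrightarrow> dirn \<Phi> (x, t) \<bullet> normal_at J (\<Phi> (x, t)) > 0"
    and up: "\<And>x. x \<in> spheres J \<Longrightarrow> height J (\<Phi> (x, \<epsilon>)) \<ge> k"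
    and down: "\<And>x. x \<in> spheres J \<Longrightarrow> height J (\<Phi> (x, - \<epsilon>)) \<le> - k"
    and wk: "\<And>y. y \<in> region J \<Longrightarrow> width J y \<ge> k"
    by (rule thin_collar) (rule that)
  let ?A = "slab 1 \<union> region J"
  define d \<tau> where "d = (\<lambda>q. dirn \<Phi> (tinv q))" and "\<tau> = (\<lambda>q. snd (tinv q))"
  define N H w where "N = normal_at J" and "H = height J" and "w = width J"
  have slabR: "slab \<epsilon> \<subseteq> region J" using inR e(2) by (auto elim!: slabE)
  have slab1: "slab \<epsilon> \<subseteq> slab 1" by (rule slab_mono[OF e(2)])
  have t1: "\<bar>\<tau> q\<bar> \<le> 1" if "q \<in> slab 1" for q using that by (rule slabE) (auto simp: \<tau>_def)
  have te: "\<bar>\<tau> q\<bar> \<le> \<epsilon>" if "q \<in> slab \<epsilon>" for q using that e(2) by (rule slabE) (auto simp: \<tau>_def)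
  have tgt: "\<bar>\<tau> q\<bar> > \<epsilon>" if "q \<in> slab 1" "q \<notin> slab \<epsilon>" for q
    using that(1)
  proof (rule slabE)
    fix x t assume "x \<in> spheres J" "q = \<Phi> (x, t)" "tinv q = (x, t)"
    then show ?thesis using slabI[of x t \<epsilon>] that(2) by (force simp: \<tau>_def)
  qed simp
  have cT: "continuous_on (slab 1) d" "continuous_on (slab 1) \<tau>" "continuous_on (slab \<epsilon>) d" "continuous_on (slab \<epsilon>) \<tau>"
    unfolding d_def \<tau>_def using continuous_on_coords e(2) by auto
  have cR: "continuous_on (region J) N" "continuous_on (region J) H" "continuous_on (region J) w"
    unfolding N_def H_def w_def by (rule collar_continuous[OF J])+
  have cR': "continuous_on (slab \<epsilon>) N" "continuous_on (slab \<epsilon>) H"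
    by (rule continuous_on_subset[OF cR(1) slabR], rule continuous_on_subset[OF cR(2) slabR])
  have sndc: "continuous_on ({0..1::real} \<times> S) (\<lambda>x. g (snd x))" if "continuous_on S g" for S :: "(real^'n) set" and g :: "real^'n \<Rightarrow> 'c::topological_space"
    by (rule continuous_on_compose2[OF that]) (auto intro: continuous_intros)
  have wp: "w q > 0" if "q \<in> region J" for q unfolding w_def by (rule width_pos[OF J that])
  have closedB: "closed (- (\<Phi> ` (spheres J \<times> {-\<delta><..<\<delta>})))" if "0 < \<delta>" "\<delta> \<le> 1" for \<delta>
    using open_tube[OF J \<Phi> that] by (rule closed_Compl)
  have cover: "slab \<delta> \<union> - (\<Phi> ` (spheres J \<times> {-\<delta><..<\<delta>})) = UNIV" for \<delta>
    unfolding slab_def by (auto intro!: image_eqI)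
  have edge: "\<bar>\<tau> q\<bar> = \<delta>" if "q \<in> slab \<delta>" "q \<in> - (\<Phi> ` (spheres J \<times> {-\<delta><..<\<delta>}))" "\<delta> \<le> 1" for q \<delta>
    using that(1,3)
  proof (rule slabE)
    fix x t assume x: "x \<in> spheres J" "\<bar>t\<bar> \<le> \<delta>" "q = \<Phi> (x, t)" "tinv q = (x, t)"
    have "t \<notin> {-\<delta><..<\<delta>}" using that(2) x by blast
    then show ?thesis using x(2,4) by (auto simp: \<tau>_def)
  qed
  have dN: "d q \<bullet> N q > 0" if "q \<in> slab \<epsilon>" for q
    using that e(2) by (rule slabE) (use pos in \<open>auto simp: d_def N_def\<close>)
  have NN: "N q \<bullet> N q = 1" if "q \<in> region J" for q
    using norm_normal_at[OF J that] by (simp add: N_def dot_square_norm)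
  define f0 f1 f2 where
    "f0 = (\<lambda>q. if q \<in> slab 1 then lean_plane (d q) (pi / 2 * \<tau> q) else iR)" and
    "f1 = (\<lambda>q. if q \<in> slab \<epsilon> then lean_plane (d q) (pi / 2 * (\<tau> q / \<epsilon>)) else iR)" and
    "f2 = (\<lambda>q. if q \<in> region J then lean_plane (N q) (pi / 2 * clamp1 (H q / k)) else iR)"
  have "localhom (slab 1) f0 f1"
  proof -
    \<comment> \<open>Only the parameter is stretched, from t to t/\<epsilon>. The clamp holds the
      angle at its end value, so at time 1 the plane is \<open>iR\<close> as soon as |t| reaches
      \<epsilon>.\<close>
    let ?\<theta> = "\<lambda>x. pi / 2 * clamp1 (((1 - fst x) + fst x / \<epsilon>) * \<tau> (snd x))"
    have big: "1 \<le> (1 - s) + s / \<epsilon>" if "s \<in> {0..1}" for s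
    proof -
      have "s * 1 \<le> s * (1 / \<epsilon>)" using that e by (intro mult_left_mono) auto
      then show ?thesis by simp
    qed
    have "localhom (slab 1) (\<lambda>q. if q \<in> slab 1 then lean_plane (d (snd (0::real, q))) (?\<theta> (0, q)) else iR)
      (\<lambda>q. if q \<in> slab 1 then lean_plane (d (snd (1::real, q))) (?\<theta> (1, q)) else iR)"
    proof (rule localhom_lean_patch[where w = "\<lambda>x. d (snd x)" and \<theta> = ?\<theta> and B = "- (\<Phi> ` (spheres J \<times> {-1<..<1}))"])
      show "closed (slab 1)" by (rule compact_imp_closed[OF compact_slab]) simp
      show "closed (- (\<Phi> ` (spheres J \<times> {-1<..<1})))" by (rule closedB) auto
      show "slab 1 \<union> - (\<Phi> ` (spheres J \<times> {-1<..<1})) = UNIV" by (rule cover)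
      show "continuous_on ({0..1::real} \<times> slab 1) (\<lambda>x. d (snd x))" by (rule sndc[OF cT(1)])
      show "continuous_on ({0..1::real} \<times> slab 1) ?\<theta>" using e(1) by (intro continuous_intros sndc[OF cT(2)]) auto
      show "d (snd x) \<noteq> 0" if "x \<in> {0..1::real} \<times> slab 1" for x
        using dirn_nonzero that by (auto simp: d_def)
      fix s q assume s: "s \<in> {0..1::real}" and q: "q \<in> slab 1" "q \<in> - (\<Phi> ` (spheres J \<times> {-1<..<1}))"
      have "1 \<le> \<bar>((1 - s) + s / \<epsilon>) * \<tau> q\<bar>" using big[OF s] edge[OF q] by (simp add: abs_mult)
      then show "?\<theta> (s, q) = pi / 2 \<or> ?\<theta> (s, q) = - (pi / 2)" by (simp only: clamp1_far fst_conv snd_conv)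
    qed
    moreover have "(if q \<in> slab 1 then lean_plane (d (snd (0::real, q))) (?\<theta> (0, q)) else iR) = f0 q" for q
      using t1[of q] by (simp add: f0_def clamp1_eq)
    moreover have "(if q \<in> slab 1 then lean_plane (d (snd (1::real, q))) (?\<theta> (1, q)) else iR) = f1 q" for q
    proof (cases "q \<in> slab \<epsilon>")
      case True
      have "\<bar>\<tau> q / \<epsilon>\<bar> \<le> 1" using te[OF True] e by (simp add: abs_divide)
      then show ?thesis using True slab1 by (auto simp: f1_def clamp1_eq)
    next
      case False
      show ?thesis
      proof (cases "q \<in> slab 1")
        case q: True
        have "1 \<le> \<bar>\<tau> q / \<epsilon>\<bar>" using tgt[OF q False] e by (simp add: abs_divide)
        then have "pi / 2 * clamp1 (\<tau> q / \<epsilon>) = pi / 2 \<or> pi / 2 * clamp1 (\<tau> q / \<epsilon>) = - (pi / 2)" by (rule clamp1_far)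
        then have "lean_plane (d q) (pi / 2 * clamp1 (\<tau> q / \<epsilon>)) = iR"
          using dirn_nonzero[OF q] by (intro lean_plane_end) (simp_all add: d_def)
        then show ?thesis using False by (simp add: f1_def)
      qed (use False in \<open>simp add: f1_def\<close>)
    qed
    ultimately show ?thesis by (rule localhom_cong)
  qed
  moreover have "localhom (slab \<epsilon>) f1 f2"
  proof -
    \<comment> \<open>Both vectors have positive product with the round normal, so no convex
      combination of them vanishes.\<close>
    let ?v = "\<lambda>x. (1 - fst x) *\<^sub>R d (snd x) + fst x *\<^sub>R N (snd x)"
    let ?\<theta> = "\<lambda>x. pi / 2 * ((1 - fst x) * (\<tau> (snd x) / \<epsilon>) + fst x * clamp1 (H (snd x) / k))"
    have "localhom (slab \<epsilon>) (\<lambda>q. if q \<in> slab \<epsilon> then lean_plane (?v (0, q)) (?\<theta> (0, q)) else iR)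
      (\<lambda>q. if q \<in> slab \<epsilon> then lean_plane (?v (1, q)) (?\<theta> (1, q)) else iR)"
    proof (rule localhom_lean_patch[where w = ?v and \<theta> = ?\<theta> and B = "- (\<Phi> ` (spheres J \<times> {-\<epsilon><..<\<epsilon>}))"])
      show "closed (slab \<epsilon>)" by (rule compact_imp_closed[OF compact_slab[OF e(2)]])
      show "closed (- (\<Phi> ` (spheres J \<times> {-\<epsilon><..<\<epsilon>})))" by (rule closedB[OF e])
      show "slab \<epsilon> \<union> - (\<Phi> ` (spheres J \<times> {-\<epsilon><..<\<epsilon>})) = UNIV" by (rule cover)
      show "continuous_on ({0..1::real} \<times> slab \<epsilon>) ?v" by (intro continuous_intros sndc cT cR')
      show "continuous_on ({0..1::real} \<times> slab \<epsilon>) ?\<theta>" using e(1) k by (intro continuous_intros sndc cT cR') auto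
      show "?v x \<noteq> 0" if x: "x \<in> {0..1::real} \<times> slab \<epsilon>" for x
      proof -
        obtain s q where sq: "x = (s, q)" "0 \<le> s" "s \<le> 1" "q \<in> slab \<epsilon>" using x by auto
        have "N q \<bullet> N q = 1" using NN slabR sq(4) by blast
        then have "?v x \<bullet> N q = (1 - s) * (d q \<bullet> N q) + s" by (simp add: sq(1) inner_add_left)
        also have "\<dots> > 0"
        proof (cases "s = 0")
          case False
          then show ?thesis using sq dN[OF sq(4)] by (intro add_nonneg_pos mult_nonneg_nonneg) auto
        qed (use dN[OF sq(4)] in simp)
        finally show ?thesis by (metis inner_zero_left less_irrefl)
      qed
      fix s q assume s: "s \<in> {0..1::real}" and q: "q \<in> slab \<epsilon>" "q \<in> - (\<Phi> ` (spheres J \<times> {-\<epsilon><..<\<epsilon>}))"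
      obtain x t where x: "x \<in> spheres J" "q = \<Phi> (x, t)" "tinv q = (x, t)" using q(1) e(2) by (rule slabE) (rule that)
      have "t = \<epsilon> \<or> t = - \<epsilon>" using edge[OF q e(2)] by (auto simp: \<tau>_def x(3))
      then show "?\<theta> (s, q) = pi / 2 \<or> ?\<theta> (s, q) = - (pi / 2)"
      proof
        assume t: "t = \<epsilon>"
        then have "H q / k \<ge> 1" "\<tau> q / \<epsilon> = 1" using up[OF x(1)] k e x by (simp_all add: H_def \<tau>_def)
        then show ?thesis by (simp add: clamp1_eq)
      next
        assume t: "t = - \<epsilon>"
        then have "H q / k \<le> - 1" "\<tau> q / \<epsilon> = - 1" using down[OF x(1)] k e x by (simp_all add: H_def \<tau>_def field_simps)
        then have "?\<theta> (s, q) = pi / 2 * ((1 - s) * (- 1) + s * (- 1))" by (simp only: clamp1_eq fst_conv snd_conv)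
        then show ?thesis by (simp add: algebra_simps)
      qed
    qed
    moreover have "(if q \<in> slab \<epsilon> then lean_plane (?v (0, q)) (?\<theta> (0, q)) else iR) = f1 q" for q
      by (simp add: f1_def)
    moreover have "(if q \<in> slab \<epsilon> then lean_plane (?v (1, q)) (?\<theta> (1, q)) else iR) = f2 q" for q
    proof (cases "q \<in> region J \<and> q \<notin> slab \<epsilon>")
      case True
      \<comment> \<open>Points of height below k have been swallowed by the slab, so outside it the
        clamped angle is extremal and the plane is \<open>iR\<close>.\<close>
      then have "\<not> \<bar>height J q\<bar> < k" using slab_swallows_collar[OF e up down] by blast
      then have "1 \<le> \<bar>H q / k\<bar>" using k by (simp add: abs_divide H_def)
      then have "pi / 2 * clamp1 (H q / k) = pi / 2 \<or> pi / 2 * clamp1 (H q / k) = - (pi / 2)" by (rule clamp1_far)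
      moreover have "N q \<noteq> 0" using NN[of q] True by auto
      ultimately have "lean_plane (N q) (pi / 2 * clamp1 (H q / k)) = iR" by (intro lean_plane_end)
      then show ?thesis using True by (simp add: f2_def)
    next
      case False
      then show ?thesis using slabR by (auto simp: f2_def)
    qed
    ultimately show ?thesis by (rule localhom_cong)
  qed
  moreover have "localhom (region J) f2 (glue J shell shell_map)"
  proof -
    \<comment> \<open>The divisor of the height passes from k to the width. As k is at most the
      width, the clamped angle is extremal at all times on the boundary of the shells.\<close>
    let ?\<theta> = "\<lambda>x. pi / 2 * clamp1 (H (snd x) * ((1 - fst x) / k + fst x / w (snd x)))"
    have "localhom (region J) (\<lambda>q. if q \<in> region J then lean_plane (N (snd (0::real, q))) (?\<theta> (0, q)) else iR)
      (\<lambda>q. if q \<in> region J then lean_plane (N (snd (1::real, q))) (?\<theta> (1, q)) else iR)"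
    proof (rule localhom_lean_patch[where w = "\<lambda>x. N (snd x)" and \<theta> = ?\<theta> and B = "- interior_region J"])
      show "closed (region J)" by (rule closed_region[OF J])
      show "closed (- interior_region J)" using open_interior_region[OF J] by (rule closed_Compl)
      show "region J \<union> - interior_region J = UNIV" by (auto simp: interior_region_def[OF J])
      show "continuous_on ({0..1::real} \<times> region J) (\<lambda>x. N (snd x))" by (rule sndc[OF cR(1)])
      show "continuous_on ({0..1::real} \<times> region J) ?\<theta>"
        using k wp by (intro continuous_intros sndc cR) force+
      show "N (snd x) \<noteq> 0" if "x \<in> {0..1::real} \<times> region J" for x using NN[of "snd x"] that by auto
      fix s q assume s: "s \<in> {0..1::real}" and q: "q \<in> region J" "q \<in> - interior_region J"
      have Hw: "\<bar>H q\<bar> \<ge> w q" using q by (auto simp: interior_region_def[OF J] H_def w_def)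
      note wq = wp[OF q(1)] wk[OF q(1), folded w_def]
      have "\<bar>H q\<bar> / k \<ge> 1" "\<bar>H q\<bar> / w q \<ge> 1" using Hw wq k by simp_all
      then have "(1 - s) * 1 + s * 1 \<le> (1 - s) * (\<bar>H q\<bar> / k) + s * (\<bar>H q\<bar> / w q)"
        using s by (intro add_mono mult_left_mono) auto
      also have "\<dots> = \<bar>H q\<bar> * ((1 - s) / k + s / w q)" by (simp add: algebra_simps)
      also have "\<dots> = \<bar>H q * ((1 - s) / k + s / w q)\<bar>" using s k wq by (simp add: abs_mult)
      finally have "1 \<le> \<bar>H q * ((1 - s) / k + s / w q)\<bar>" by simp
      then show "?\<theta> (s, q) = pi / 2 \<or> ?\<theta> (s, q) = - (pi / 2)" by (simp only: clamp1_far fst_conv snd_conv)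
    qed
    moreover have "(if q \<in> region J then lean_plane (N (snd (0::real, q))) (?\<theta> (0, q)) else iR) = f2 q" for q
      by (simp add: f2_def)
    moreover have "(if q \<in> region J then lean_plane (N (snd (1::real, q))) (?\<theta> (1, q)) else iR) = glue J shell shell_map q" for q
    proof (cases "q \<in> region J")
      case True
      then obtain s where s: "s \<in> J" "q \<in> shell s" by (auto simp: region_def simp del: shell.simps)
      have "disjoint_family_on shell J" using J by (simp add: shells_ok_def)
      from glue_eq[OF this s] have "glue J shell shell_map q = shell_map s q" .
      also have "\<dots> = lean_plane (N q) (pi / 2 * (H q / w q))"
        unfolding N_def H_def w_def by (rule shell_map_lean_plane[OF J s])
      also have "H q / w q = clamp1 (H q / w q)"
        using height_le_width[OF J True] wp[OF True] by (simp add: clamp1_eq abs_divide H_def w_def)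
      finally show ?thesis using True by simp
    next
      case False
      then have "glue J shell shell_map q = iR" by (intro glue_outside) (simp add: region_def del: shell.simps)
      then show ?thesis using False by simp
    qed
    ultimately show ?thesis by (rule localhom_cong)
  qed
  ultimately have "localhom ?A f0 f1" "localhom ?A f1 f2" "localhom ?A f2 (glue J shell shell_map)"
    using slab1 localhom_mono by (blast | metis Un_upper1 Un_upper2 subset_trans)+
  then have "localhom ?A f0 (glue J shell shell_map)" using localhom_trans by blast
  then show ?thesis unfolding f0_def d_def \<tau>_def .
qed

lemma htpy_class_fold_map:
  "htpy_class Lag iR (fold_map (spheres J) \<Phi>) = htpy_class Lag iR (extend (glue J shell shell_map))"
proof -
  have "bounded (slab 1 \<union> region J)"
    using compact_imp_bounded[OF compact_slab[of 1]] bounded_region[OF J] by simp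
  from htpy_class_eq[OF localhom_homotopic[OF localhom_fold_map this]] show ?thesis by (simp only: fold_map_extend)
qed

end

section \<open>Round spheres as formal folds\<close>

text \<open>Because S is open, derivatives at its points see only the values on S.\<close>

lemma Ck_on_cong:
  "open S \<Longrightarrow> (\<And>x. x \<in> S \<Longrightarrow> f x = g x) \<Longrightarrow> Ck_on k S f \<Longrightarrow> Ck_on k S g"
proof (induction k arbitrary: f g)
  case 0
  then show ?case using continuous_on_cong[of S S f g] by simp
next
  case (Suc k)
  have D: "(g has_derivative frechet_derivative f (at x)) (at x)" if x: "x \<in> S" for x
  proof (rule has_derivative_transform_within_open[OF _ Suc.prems(1) x])
    show "(f has_derivative frechet_derivative f (at x)) (at x)"
      using Suc.prems(3) x frechet_derivative_works by auto
  qed (use Suc.prems(2) in auto)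
  then have "frechet_derivative f (at x) = frechet_derivative g (at x)" if "x \<in> S" for x
    using frechet_derivative_at that by blast
  then have "Ck_on k S (\<lambda>x. frechet_derivative g (at x) v)" for v
    using Suc.IH[OF Suc.prems(1), of "\<lambda>x. frechet_derivative f (at x) v"] Suc.prems(3) by simp
  then show ?case using D by (auto simp: differentiable_def)
qed

text \<open>Replaces the derivative selected by \<open>frechet_derivative\<close> by an explicit
  formula, so that induction on k can use the usual rules.\<close>

lemma Ck_on_SucI:
  assumes "open S" "\<And>x. x \<in> S \<Longrightarrow> (f has_derivative f' x) (at x)" "\<And>v. Ck_on k S (\<lambda>x. f' x v)"
  shows "Ck_on (Suc k) S f"
proof -
  have "f' x = frechet_derivative f (at x)" if "x \<in> S" for x
    by (rule frechet_derivative_at[OF assms(2)[OF that]])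
  then have "Ck_on k S (\<lambda>x. frechet_derivative f (at x) v)" for v
    by (intro Ck_on_cong[OF assms(1) _ assms(3)[of v]]) simp
  then show ?thesis using assms(2) by (auto simp: differentiable_def)
qed

lemma Ck_on_SucD:
  assumes "Ck_on (Suc k) S f"
  shows "x \<in> S \<Longrightarrow> (f has_derivative frechet_derivative f (at x)) (at x)"
    "Ck_on k S (\<lambda>x. frechet_derivative f (at x) v)"
  using assms frechet_derivative_works by auto

lemma Ck_on_Suc_imp: "Ck_on (Suc k) S f \<Longrightarrow> Ck_on k S f"
proof (induction k arbitrary: f)
  case 0
  then have "f differentiable (at x)" if "x \<in> S" for x using that by simp
  then show ?case
    by (auto intro!: continuous_at_imp_continuous_on differentiable_imp_continuous_within)
next
  case (Suc k)
  then show ?case by (meson Ck_on.simps(2))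
qed

lemma Ck_on_local:
  "(\<And>x. x \<in> S \<Longrightarrow> \<exists>U. open U \<and> x \<in> U \<and> Ck_on k U f) \<Longrightarrow> Ck_on k S f"
proof (induction k arbitrary: f)
  case 0
  have "isCont f x" if "x \<in> S" for x
    using 0[OF that] continuous_on_eq_continuous_at by fastforce
  then show ?case by (simp add: continuous_at_imp_continuous_on)
next
  case (Suc k)
  have "\<forall>x\<in>S. f differentiable (at x)" using Suc.prems by fastforce
  moreover have "Ck_on k S (\<lambda>x. frechet_derivative f (at x) v)" for v
    by (rule Suc.IH) (use Suc.prems in fastforce)
  ultimately show ?case by simp
qed

lemma Ck_on_const: "open S \<Longrightarrow> Ck_on k S (\<lambda>x. c)"
proof (induction k arbitrary: c)
  case (Suc k)
  then show ?case by (intro Ck_on_SucI[where f' = "\<lambda>x v. 0"]) auto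
qed simp

lemma Ck_on_linear:
  assumes "open S" "bounded_linear f" shows "Ck_on k S f"
proof (cases k)
  case 0
  then show ?thesis using assms(2) by (simp add: linear_continuous_on)
next
  case (Suc l)
  then show ?thesis
    using assms by (simp only:) (intro Ck_on_SucI[where f' = "\<lambda>x. f"] bounded_linear_imp_has_derivative Ck_on_const)
qed

lemma Ck_on_add:
  "open S \<Longrightarrow> Ck_on k S f \<Longrightarrow> Ck_on k S g \<Longrightarrow> Ck_on k S (\<lambda>x. f x + g x)"
proof (induction k arbitrary: f g)
  case 0
  then show ?case by (simp add: continuous_on_add)
next
  case (Suc k)
  note D = Ck_on_SucD[OF Suc.prems(2)] Ck_on_SucD[OF Suc.prems(3)]
  show ?case
    by (rule Ck_on_SucI[OF Suc.prems(1), where f' = "\<lambda>x v. frechet_derivative f (at x) v + frechet_derivative g (at x) v"])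
      (intro has_derivative_add D Suc.IH[OF Suc.prems(1)] | assumption)+
qed

lemma Ck_on_bilinear:
  assumes "bounded_bilinear B" "open S"
  shows "Ck_on k S f \<Longrightarrow> Ck_on k S g \<Longrightarrow> Ck_on k S (\<lambda>x. B (f x) (g x))"
proof (induction k arbitrary: f g)
  case 0
  then show ?case using bounded_bilinear.continuous_on[OF assms(1)] by simp
next
  case (Suc k)
  note D = Ck_on_SucD[OF Suc.prems(1)] Ck_on_SucD[OF Suc.prems(2)]
  show ?case
    by (rule Ck_on_SucI[OF assms(2), where f' = "\<lambda>x v. B (f x) (frechet_derivative g (at x) v) + B (frechet_derivative f (at x) v) (g x)"])
      (intro bounded_bilinear.FDERIV[OF assms(1)] D Suc.IH Ck_on_add[OF assms(2)] Ck_on_Suc_imp[OF Suc.prems(1)] Ck_on_Suc_imp[OF Suc.prems(2)] | assumption)+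
qed

text \<open>The derivative of 1/f is a product of 1/f, f' and 1/f, so one order less of 1/f itself
  is what the induction supplies.\<close>

lemma Ck_on_inverse:
  fixes f :: "'a::real_normed_vector \<Rightarrow> real"
  assumes "open S" "\<And>x. x \<in> S \<Longrightarrow> f x \<noteq> 0"
  shows "Ck_on k S f \<Longrightarrow> Ck_on k S (\<lambda>x. inverse (f x))"
proof (induction k)
  case 0
  then show ?case using assms(2) by (simp add: continuous_on_inverse)
next
  case (Suc k)
  note D = Ck_on_SucD[OF Suc.prems]
  have IH: "Ck_on k S (\<lambda>x. inverse (f x))" by (rule Suc.IH[OF Ck_on_Suc_imp[OF Suc.prems]])
  note mult = Ck_on_bilinear[OF bounded_bilinear_mult assms(1)]
  show ?case
  proof (rule Ck_on_SucI[OF assms(1), where f' = "\<lambda>x v. - 1 * (inverse (f x) * frechet_derivative f (at x) v * inverse (f x))"])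
    show "((\<lambda>x. inverse (f x)) has_derivative (\<lambda>v. - 1 * (inverse (f x) * frechet_derivative f (at x) v * inverse (f x)))) (at x)"
      if "x \<in> S" for x
      using Deriv.has_derivative_inverse[OF assms(2)[OF that] D(1)[OF that]] by simp
  qed (intro mult Ck_on_const assms(1) IH D(2))
qed

text \<open>Inversion in the unit sphere about 0. With \<open>inverse 0 = 0\<close> it is an
  involution of the whole space, which spares case distinctions.\<close>

definition inversion :: "real^'n \<Rightarrow> real^'n" where
  "inversion y = inverse (y \<bullet> y) *\<^sub>R y"

lemma inversion_inversion: "inversion (inversion y) = y"
  by (cases "y = 0") (simp_all add: inversion_def)

lemma inversion_eq_0: "inversion y = 0 \<longleftrightarrow> y = 0"
  by (auto simp: inversion_def)

lemma smooth_on_inversion: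
  assumes "open S" "a \<notin> S" shows "smooth_on S (\<lambda>y. b + inversion (y - a))"
  unfolding smooth_on_def inversion_def
proof
  fix k
  have d: "Ck_on k S (\<lambda>y. y - a)"
    using Ck_on_add[OF assms(1) Ck_on_linear[OF assms(1) bounded_linear_ident] Ck_on_const[OF assms(1), of k "- a"]] by simp
  show "Ck_on k S (\<lambda>y. b + inverse ((y - a) \<bullet> (y - a)) *\<^sub>R (y - a))"
    by (intro Ck_on_add assms(1) Ck_on_const Ck_on_bilinear[OF bounded_bilinear_scaleR] Ck_on_inverse
        Ck_on_bilinear[OF bounded_bilinear_inner] d) (use assms(2) in auto)
qed

context
  fixes J :: "((real^'n) \<times> real \<times> real \<times> real) set"
  assumes J: "shells_ok J"
begin

text \<open>Inversion centred at a point \<open>a\<close> of a sphere flattens the sphere to a hyperplane.\<close>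

lemma hypersurface_spheres: "hypersurface (spheres J)"
  unfolding hypersurface_def
proof
  fix p assume p: "p \<in> spheres J"
  obtain c R h e where s: "(c, R, h, e) \<in> J" "p \<in> shell (c, R, h, e)" "0 < h" "h < R" "e = 1 \<or> e = - 1"
    "height J p = e * (norm (p - c) - R)"
    by (rule regionE[OF J spheres_region[OF J p]]) (rule that)
  have np: "norm (p - c) = R" using p s(5,6) by (auto simp: spheres_iff[OF J])
  have R: "R > 0" using s by simp
  define k :: 'n where "k = undefined"
  define E where "E = axis k (1::real)"
  have E: "E \<bullet> E = 1" "y \<bullet> E = y $ k" "E $ k = 1" for y
    by (simp add: E_def inner_axis_axis, simp add: E_def inner_axis, simp add: E_def axis_def)
  \<comment> \<open>One of the two poles on the k-th axis differs from p; it will be the centre of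
    the inversion.\<close>
  obtain \<sigma> :: real where \<sigma>: "\<sigma> = 1 \<or> \<sigma> = - 1" "p \<noteq> c + (\<sigma> * R) *\<^sub>R E"
  proof (cases "p = c + R *\<^sub>R E")
    case True
    have "p \<noteq> c + (- 1 * R) *\<^sub>R E"
    proof
      assume "p = c + (- 1 * R) *\<^sub>R E"
      then have "(2 * R) *\<^sub>R E = 0" using True by (simp add: algebra_simps scaleR_2[symmetric])
      then show False using R E(1) by auto
    qed
    then show ?thesis using that[of "- 1"] by blast
  qed (use that[of 1] in auto)
  \<comment> \<open>Inversion at a sends the sphere to the hyperplane with k-th coordinate
    -\<sigma>/(2 R); the shift by b moves it to 0.\<close>
  define a b where "a = c + (\<sigma> * R) *\<^sub>R E" and "b = (\<sigma> / (2 * R)) *\<^sub>R E"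
  define f g where "f = (\<lambda>y. b + inversion (y - a))" and "g = (\<lambda>z. a + inversion (z - b))"
  define U where "U = {y. \<bar>norm (y - c) - R\<bar> < h} - {a}"
  have oU: "open U" unfolding U_def
    by (intro open_Diff open_Collect_less continuous_intros)
  have gf: "g (f y) = y" and fg: "f (g z) = z" for y z
    by (simp_all add: f_def g_def inversion_inversion)
  have fU: "f ` U = - {b} \<inter> g -` U"
  proof (intro equalityI subsetI)
    fix z assume "z \<in> f ` U"
    then obtain y where y: "y \<in> U" "z = f y" by blast
    then have "y \<noteq> a" by (auto simp: U_def)
    then have "z \<noteq> b" by (simp add: y(2) f_def inversion_eq_0)
    then show "z \<in> - {b} \<inter> g -` U" using y gf by simp
  qed (use fg in \<open>metis Int_iff image_eqI vimage_eq\<close>)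
  have "smooth_on (- {b}) g" unfolding g_def by (rule smooth_on_inversion) auto
  then have cg: "continuous_on (- {b}) g" unfolding smooth_on_def by (metis Ck_on.simps(1))
  have oV: "open (f ` U)" unfolding fU
    by (rule continuous_open_preimage[OF cg _ oU]) (simp add: open_Compl)
  have sf: "smooth_on U f" unfolding f_def by (rule smooth_on_inversion[OF oU]) (simp add: U_def)
  have sg: "smooth_on (f ` U) g" unfolding g_def by (rule smooth_on_inversion[OF oV]) (simp add: fU)
  have cont: "continuous_on U f" "continuous_on (f ` U) g"
    using sf sg unfolding smooth_on_def by (metis Ck_on.simps(1))+
  have "homeomorphism U (f ` U) f g"
    by (rule homeomorphismI[OF cont]) (use gf fg in auto)
  then have "diffeo_on U (f ` U) f g" unfolding diffeo_on_def using oU oV sf sg by blast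
  moreover have "p \<in> U" using np s(3) \<sigma>(2) by (simp add: U_def a_def)
  moreover have "f ` (U \<inter> spheres J) = f ` U \<inter> {y. y $ k = 0}"
  proof -
    have "y \<in> spheres J \<longleftrightarrow> f y $ k = 0" if y: "y \<in> U" for y
    proof -
      define w where "w = y - a"
      have w: "w \<noteq> 0" using y by (auto simp: w_def U_def)
      then have ww: "w \<bullet> w > 0" by simp
      have "y \<in> shell (c, R, h, e)" using y by (auto simp: U_def)
      note v = in_shell_values[OF J s(1) this]
      have "y \<in> spheres J \<longleftrightarrow> norm (y - c) = R" using v s(5) by (auto simp: spheres_iff[OF J])
      also have "\<dots> \<longleftrightarrow> (y - c) \<bullet> (y - c) = R\<^sup>2"
        using R by (simp add: dot_square_norm power2_eq_iff_nonneg)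
      also have "y - c = w + (\<sigma> * R) *\<^sub>R E" by (simp add: w_def a_def)
      also have "(w + (\<sigma> * R) *\<^sub>R E) \<bullet> (w + (\<sigma> * R) *\<^sub>R E) = w \<bullet> w + 2 * \<sigma> * R * (w $ k) + R\<^sup>2"
        using \<sigma>(1) E by (auto simp: inner_add_left inner_add_right inner_commute[of E] power2_eq_square algebra_simps)
      finally have 1: "y \<in> spheres J \<longleftrightarrow> w \<bullet> w + 2 * \<sigma> * R * (w $ k) = 0" by simp
      have "f y $ k = \<sigma> / (2 * R) * (E $ k) + inverse (w \<bullet> w) * (w $ k)"
        by (simp only: f_def b_def inversion_def w_def vector_add_component vector_scaleR_component real_scaleR_def)
      also have "\<dots> = \<sigma> / (2 * R) + w $ k / (w \<bullet> w)"
        by (simp only: E(3) mult_1_right divide_inverse mult.commute[of "inverse (w \<bullet> w)"])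
      also have "\<dots> = (\<sigma> * (w \<bullet> w) + 2 * R * (w $ k)) / (2 * R * (w \<bullet> w))"
        by (subst add_frac_eq) (use R ww in \<open>simp_all add: mult.commute\<close>)
      finally have "f y $ k = 0 \<longleftrightarrow> \<sigma> * (w \<bullet> w) + 2 * R * (w $ k) = 0"
        using R ww by (simp only: divide_eq_0_iff) simp
      also have "\<dots> \<longleftrightarrow> w \<bullet> w + 2 * \<sigma> * R * (w $ k) = 0" using \<sigma>(1) by auto
      finally show ?thesis using 1 by simp
    qed
    then show ?thesis by blast
  qed
  ultimately have Q: "p \<in> U \<and> diffeo_on U (f ` U) f g \<and> f ` (U \<inter> spheres J) = f ` U \<inter> {y. y $ k = 0}"
    by (intro conjI)
  show "\<exists>U V f g k. p \<in> U \<and> diffeo_on U V f g \<and> f ` (U \<inter> spheres J) = V \<inter> {y :: real^'n. y $ k = 0}"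
    by (rule exI[of _ U], rule exI[of _ "f ` U"], rule exI[of _ f], rule exI[of _ g], rule exI[of _ k], rule Q)
qed

lemma formal_fold_spheres: "formal_fold (spheres J) (normal_at J)"
  unfolding formal_fold_def coorientation_def
proof (intro conjI ballI compact_spheres[OF J] hypersurface_spheres)
  show "continuous_on (spheres J) (normal_at J)"
    by (rule continuous_on_subset[OF collar_continuous(1)[OF J]]) (use spheres_region[OF J] in blast)
  show "norm (normal_at J x) = 1" if "x \<in> spheres J" for x
    by (rule norm_normal_at[OF J spheres_region[OF J that]])
  show "normal_at J x \<bullet> w = 0" if "x \<in> spheres J" "w \<in> tangent (spheres J) x" for x w
    using that(2) by (simp add: tangent_spheres[OF J that(1)] inner_commute)
qed

section \<open>The round collar as a tubular neighbourhood\<close>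

text \<open>Dividing by the constant R instead of the norm of x - c makes the formula polynomial
  near each sphere. On the sphere it is motion along the unit normal with the width as
  speed.\<close>

definition collar :: "(real^'n) \<times> real \<Rightarrow> real^'n" where
  "collar p = (case the_shell J (fst p) of (c, R, h, e) \<Rightarrow> fst p + (snd p * (h * e / R)) *\<^sub>R (fst p - c))"

lemma collar_eq:
  assumes "(c, R, h, e) \<in> J" "fst p \<in> shell (c, R, h, e)"
  shows "collar p = fst p + (snd p * (h * e / R)) *\<^sub>R (fst p - c)"
  unfolding collar_def the_shell_eq[OF J assms] by simp

lemma collar_normal:
  assumes x: "x \<in> spheres J" shows "collar (x, t) = x + (t * width J x) *\<^sub>R normal_at J x"
proof -
  obtain c R h e where s: "(c, R, h, e) \<in> J" "x \<in> shell (c, R, h, e)" "0 < h" "h < R" "e = 1 \<or> e = - 1"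
    "normal_at J x = e *\<^sub>R sgn (x - c)" "height J x = e * (norm (x - c) - R)" "width J x = h" "norm (x - c) > 0"
    by (rule regionE[OF J spheres_region[OF J x]]) (rule that)
  have np: "norm (x - c) = R" using x s(5,7) by (auto simp: spheres_iff[OF J])
  have "(t * (h * e / R)) *\<^sub>R (x - c) = (t * h) *\<^sub>R (e *\<^sub>R sgn (x - c))"
    by (simp add: sgn_div_norm np divide_inverse mult.assoc)
  moreover have "collar (x, t) = x + (t * (h * e / R)) *\<^sub>R (x - c)"
    using collar_eq[OF s(1), of "(x, t)"] s(2) by (simp del: shell.simps)
  ultimately show ?thesis by (simp only: s(6,8))
qed

lemma open_shell: "open ({y. \<bar>norm (y - c) - R\<bar> < h} \<times> (UNIV :: real set))" for c :: "real^'n"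
  by (intro open_Times open_Collect_less continuous_intros open_UNIV)

lemma collar_smooth:
  assumes s: "(c, R, h, e) \<in> J"
  shows "Ck_on k ({y. \<bar>norm (y - c) - R\<bar> < h} \<times> UNIV) collar"
proof (rule Ck_on_cong[OF open_shell, where f = "\<lambda>p. fst p + (snd p * (h * e / R)) *\<^sub>R (fst p + - c)"])
  show "fst p + (snd p * (h * e / R)) *\<^sub>R (fst p + - c) = collar p" if "p \<in> {y. \<bar>norm (y - c) - R\<bar> < h} \<times> UNIV" for p
    using that by (subst collar_eq[OF s]) auto
  show "Ck_on k ({y. \<bar>norm (y - c) - R\<bar> < h} \<times> UNIV) (\<lambda>p. fst p + (snd p * (h * e / R)) *\<^sub>R (fst p + - c))"
    by (intro Ck_on_add open_shell Ck_on_bilinear[OF bounded_bilinear_scaleR] Ck_on_bilinear[OF bounded_bilinear_mult]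
        Ck_on_const Ck_on_linear bounded_linear_fst bounded_linear_snd)
qed

lemma collar_derivative:
  assumes s: "(c, R, h, e) \<in> J" and x: "\<bar>norm (x - c) - R\<bar> < h"
  shows "frechet_derivative collar (at (x, t)) = (\<lambda>v. fst v + ((t * (h * e / R)) *\<^sub>R fst v + (snd v * (h * e / R)) *\<^sub>R (x - c)))"
proof (rule frechet_derivative_at[symmetric])
  have "R \<noteq> 0" using shell_params(1,2)[OF J s] by linarith
  then have "((\<lambda>p. fst p + (snd p * (h * e / R)) *\<^sub>R (fst p - c)) has_derivative
      (\<lambda>v. fst v + ((snd (x, t) * (h * e / R)) *\<^sub>R fst v + (snd v * (h * e / R)) *\<^sub>R (fst (x, t) - c)))) (at (x, t))"
    by (auto intro!: derivative_eq_intros)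
  then have "((\<lambda>p. fst p + (snd p * (h * e / R)) *\<^sub>R (fst p - c)) has_derivative
      (\<lambda>v. fst v + ((t * (h * e / R)) *\<^sub>R fst v + (snd v * (h * e / R)) *\<^sub>R (x - c)))) (at (x, t))" by simp
  then show "(collar has_derivative (\<lambda>v. fst v + ((t * (h * e / R)) *\<^sub>R fst v + (snd v * (h * e / R)) *\<^sub>R (x - c)))) (at (x, t))"
  proof (rule has_derivative_transform_within_open[OF _ open_shell])
    show "(x, t) \<in> {y. \<bar>norm (y - c) - R\<bar> < h} \<times> UNIV" using x by simp
    show "fst p + (snd p * (h * e / R)) *\<^sub>R (fst p - c) = collar p" if "p \<in> {y. \<bar>norm (y - c) - R\<bar> < h} \<times> UNIV" for p
      using that by (subst collar_eq[OF s]) auto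
  qed
qed

lemma tubular_collar: "tubular (spheres J) (normal_at J) collar"
  unfolding tubular_def
proof (intro conjI ballI)
  let ?W = "\<Union>(c, R, h, e)\<in>J. {y. \<bar>norm (y - c) - R\<bar> < h} \<times> (UNIV :: real set)"
  have par: thesis if x: "x \<in> spheres J" and th: "\<And>c R h e. (c, R, h, e) \<in> J \<Longrightarrow> 0 < h \<Longrightarrow> h < R \<Longrightarrow> e = 1 \<or> e = - 1 \<Longrightarrow>
    normal_at J x = e *\<^sub>R sgn (x - c) \<Longrightarrow> norm (x - c) = R \<Longrightarrow> thesis" for x thesis
    by (rule regionE[OF J spheres_region[OF J x]], rule th) (use x in \<open>auto simp: spheres_iff[OF J]\<close>)
  show "\<exists>W. open W \<and> spheres J \<times> {- 1..1} \<subseteq> W \<and> smooth_on W collar"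
  proof (intro exI conjI)
    show "open ?W" using open_shell by (intro open_UN) auto
    show "spheres J \<times> {- 1..1} \<subseteq> ?W"
    proof
      fix q assume "q \<in> spheres J \<times> {- 1..1::real}"
      then obtain x t where q: "q = (x, t)" "x \<in> spheres J" by blast
      from q(2) show "q \<in> ?W"
      proof (rule par)
        fix c R h e assume "(c, R, h, e) \<in> J" "0 < h" "norm (x - c) = R"
        then show "q \<in> ?W" using q(1) by force
      qed
    qed
    show "smooth_on ?W collar"
      unfolding smooth_on_def
    proof (intro allI Ck_on_local)
      fix k q assume "q \<in> ?W"
      then obtain c R h e where s: "(c, R, h, e) \<in> J" "q \<in> {y. \<bar>norm (y - c) - R\<bar> < h} \<times> UNIV" by blast
      then show "\<exists>U. open U \<and> q \<in> U \<and> Ck_on k U collar" using open_shell collar_smooth[OF s(1)] by blast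
    qed
  qed
  show "inj_on collar (spheres J \<times> {- 1..1})"
  proof (rule inj_onI)
    fix p q assume pq: "p \<in> spheres J \<times> {- 1..1::real}" "q \<in> spheres J \<times> {- 1..1::real}" "collar p = collar q"
    obtain x t y u where e: "p = (x, t)" "q = (y, u)" "x \<in> spheres J" "y \<in> spheres J" "\<bar>t\<bar> \<le> 1" "\<bar>u\<bar> \<le> 1"
      using pq(1,2) by (auto simp: abs_le_iff)
    have w: "width J x > 0" "width J y > 0" using width_pos[OF J spheres_region[OF J]] e by blast+
    have "\<bar>t\<bar> * width J x \<le> 1 * width J x" "\<bar>u\<bar> * width J y \<le> 1 * width J y"
      using e w by (intro mult_right_mono; simp)+
    then have "\<bar>t * width J x\<bar> \<le> width J x" "\<bar>u * width J y\<bar> \<le> width J y" using w by (simp_all add: abs_mult)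
    \<comment> \<open>Normal, height and width at the image point determine those at the start,
      hence x and t.\<close>
    note X = collar_values[OF J e(3) this(1), folded collar_normal[OF e(3)]]
      and Y = collar_values[OF J e(4) this(2), folded collar_normal[OF e(4)]]
    have eq: "collar (x, t) = collar (y, u)" using pq(3) e by simp
    have n: "normal_at J x = normal_at J y" using X(2) Y(2) eq by simp
    have hh: "t * width J x = u * width J y" using X(3) Y(3) eq by simp
    have ww: "width J x = width J y" using X(4) Y(4) eq by simp
    have "x = y" using eq unfolding collar_normal[OF e(3)] collar_normal[OF e(4)] n hh by simp
    moreover have "t = u" using hh ww w by simp
    ultimately show "p = q" using e by simp
  qed
  show "inj_on (frechet_derivative collar (at (x, t))) (tangent (spheres J) x \<times> UNIV)" if x: "x \<in> spheres J" and t: "t \<in> {- 1..1}" for x t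
    using x
  proof (rule par)
    fix c R h e assume s: "(c, R, h, e) \<in> J" "0 < h" "h < R" "e = 1 \<or> e = - 1"
      "normal_at J x = e *\<^sub>R sgn (x - c)" "norm (x - c) = R"
    have "\<bar>norm (x - c) - R\<bar> < h" using s by simp
    note D = collar_derivative[OF s(1) this]
    have key: "(v, r) = (v', r')" if v: "v \<in> tangent (spheres J) x" "v' \<in> tangent (spheres J) x"
      and eq: "frechet_derivative collar (at (x, t)) (v, r) = frechet_derivative collar (at (x, t)) (v', r')" for v v' r r'
    proof -
      have "v \<bullet> (e *\<^sub>R sgn (x - c)) = 0" "v' \<bullet> (e *\<^sub>R sgn (x - c)) = 0"
        using v by (simp_all add: tangent_spheres[OF J x] s(5))
      then have o: "v \<bullet> (x - c) = 0" "v' \<bullet> (x - c) = 0" using s(2-4) s(6) by (auto simp: sgn_div_norm)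
      let ?m = "h * e / R"
      have m: "?m \<noteq> 0" using s by auto
      have E: "v + ((t * ?m) *\<^sub>R v + (r * ?m) *\<^sub>R (x - c)) = v' + ((t * ?m) *\<^sub>R v' + (r' * ?m) *\<^sub>R (x - c))"
        using eq by (simp add: D)
      \<comment> \<open>The product with x - c removes the tangential parts and isolates the
        t-components.\<close>
      then have "(v + ((t * ?m) *\<^sub>R v + (r * ?m) *\<^sub>R (x - c))) \<bullet> (x - c) = (v' + ((t * ?m) *\<^sub>R v' + (r' * ?m) *\<^sub>R (x - c))) \<bullet> (x - c)"
        by (rule arg_cong)
      then have "r * ?m * ((x - c) \<bullet> (x - c)) = r' * ?m * ((x - c) \<bullet> (x - c))"
        unfolding inner_add_left inner_scaleR_left o by simp
      moreover have "(x - c) \<bullet> (x - c) \<noteq> 0" using s by auto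
      ultimately have r: "r = r'" using m by simp
      have "(1 + t * ?m) *\<^sub>R v = (1 + t * ?m) *\<^sub>R v'" using E unfolding r by (simp add: scaleR_add_left)
      \<comment> \<open>The factor by which the leaf at level t is scaled; it is positive because h
        < R.\<close>
      moreover have "1 + t * ?m > 0"
      proof -
        have "\<bar>t * ?m\<bar> = \<bar>t\<bar> * (h / R)" using s by (auto simp: abs_mult)
        also have "\<dots> \<le> 1 * (h / R)" using t s by (intro mult_right_mono) (auto simp: abs_le_iff)
        also have "\<dots> < 1" using s by simp
        finally show ?thesis by linarith
      qed
      ultimately have "v = v'" by (metis less_irrefl scaleR_cancel_left)
      then show ?thesis using r by simp
    qed
    show ?thesis
    proof (rule inj_onI)
      fix p q assume "p \<in> tangent (spheres J) x \<times> (UNIV :: real set)" "q \<in> tangent (spheres J) x \<times> (UNIV :: real set)"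
        "frechet_derivative collar (at (x, t)) p = frechet_derivative collar (at (x, t)) q"
      then show "p = q" using key[of "fst p" "fst q" "snd p" "snd q"] by (simp add: mem_Times_iff)
    qed
  qed
  show "collar (x, 0) = x" if "x \<in> spheres J" for x using collar_normal[OF that] by simp
  show "0 < frechet_derivative collar (at (x, 0)) (0, 1) \<bullet> normal_at J x" if x: "x \<in> spheres J" for x
    using x
  proof (rule par)
    fix c R h e assume s: "(c, R, h, e) \<in> J" "0 < h" "h < R" "e = 1 \<or> e = - 1"
      "normal_at J x = e *\<^sub>R sgn (x - c)" "norm (x - c) = R"
    have b: "\<bar>norm (x - c) - R\<bar> < h" using s by simp
    have "frechet_derivative collar (at (x, 0)) (0, 1) \<bullet> normal_at J x = (e * e) * (h * (((x - c) \<bullet> (x - c)) / (R * R)))"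
      by (simp add: collar_derivative[OF s(1) b] s(5) sgn_div_norm s(6) divide_inverse mult_ac)
    also have "(x - c) \<bullet> (x - c) = R * R" by (simp add: dot_square_norm s(6) power2_eq_square)
    also have "(e * e) * (h * (R * R / (R * R))) = h" using s(2,3,4) by auto
    finally have "frechet_derivative collar (at (x, 0)) (0, 1) \<bullet> normal_at J x = h" .
    then show ?thesis using s(2) by simp
  qed
qed

end

theorem theorem2p11:
  fixes c :: "((real^'n) option \<Rightarrow> (complex^'n) set) set"
  assumes "c \<in> stab_kernel"
  shows "\<exists>(\<Sigma> :: (real^'n) set) v. formal_fold \<Sigma> v \<and> alpha \<Sigma> v = c"
proof -
  obtain J :: "((real^'n) \<times> real \<times> real \<times> real) set" where J: "shells_ok J"
    "c = htpy_class Lag iR (extend (glue J shell shell_map))"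
    by (rule stab_kernel_shells[OF assms]) (rule that)
  have "htpy_class Lag iR (fold_map (spheres J) \<Phi>) = c" if "tubular (spheres J) (normal_at J) \<Phi>" for \<Phi>
    unfolding J(2) by (rule htpy_class_fold_map[OF J(1) that])
  \<comment> \<open>\<open>alpha\<close> is a union over tubular neighbourhoods. Each contributes
    the class c, and the round collar shows that the union is not empty.\<close>
  then have "alpha (spheres J) (normal_at J) = c"
    unfolding alpha_def using tubular_collar[OF J(1)] by blast
  then show ?thesis using formal_fold_spheres[OF J(1)] by blast
qed

end
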